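(* (a) Let $n\ge1$ and let $E$ be a left $A$-module such that $J^n_dE=A\,j^n_{d,E}(E)$, such that the $n$-jet sequence at $E$ is right exact (i.e. $S^n_dE\to J^n_dE\to J^{n-1}_dE\to0$ is exact), and suppose that for all $0\le k<n$ we have a left connection $\nabla^{S^k_dE}\colon S^k_dE\to\Omega^1_dS^k_dE$ on $S^k_dE$ and a left $A$-linear left splitting $s^{1,k}\colon\Omega^1_dS^k_dE\to S^{k+1}_dE$ of $\iota^{k+1}_{\wedge,E}$, i.e. $s^{1,k}\circ\iota^{k+1}_{\wedge,E}=\mathrm{id}$. Then there is an induced natural $n$-quantization $q^n\colon\mathrm{Symb}^n_d(E,-)\to\mathrm{Diff}^n_d(E,-)$ for $E$, mapping a symbol $\sigma^n\in\mathrm{Symb}^n_d(E,F)$ to $$q^n(\sigma^n)=r^n_{d,E,F}(\sigma^n)\circ s^{1,n-1}\circ\nabla^{S^{n-1}_dE}\circ s^{1,n-2}\circ\nabla^{S^{n-2}_dE}\circ\dots\circ s^{1,1}\circ\nabla^{S^1_dE}\circ\nabla^E,$$ where $\nabla^E=\nabla^{S^0_dE}$ (and $s^{1,0}=\mathrm{id}$). (b) Let $E$ be a left $A$-module such that for all $n\ge0$ we have $J^n_dE=A\,j^n_{d,E}(E)$, the $n$-jet sequence at $E$ is right exact, and we have a left connection $\nabla^{S^n_dE}$ on $S^n_dE$ and a left $A$-linear left splitting $s^{1,n}$ of $\iota^{n+1}_{\wedge,E}$. Then there is an induced natural full quantization $q=\sum_{n\in\mathbb N}q^n$ for $E$.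
   Context: **Setting.** $\Bbbk$ is a commutative unital ring, $A$ an associative unital $\Bbbk$-algebra, $\otimes=\otimes_\Bbbk$. $(\Omega^\bullet_d,\wedge,d)$ is an exterior algebra over $A$: a differential graded $\Bbbk$-algebra with $\Omega^0_d=A$, generated by $A$ and $dA$ (each $\Omega^k_d$ is spanned by elements $a_0da_1\wedge\dots\wedge da_k$), $d$ satisfying the graded Leibniz rule. $\Omega^k_d$ also denotes the functor $E\mapsto\Omega^k_dE=\Omega^k_d\otimes_AE$ on left $A$-modules. **1-jets.** For a left $A$-module $E$, $J^1_dE=(A\otimes E)/\{\sum_ia_i\otimes e_i:\sum_ia_ie_i=0,\ \sum_ida_i\otimes_Ae_i=0\}$, with $a[b\otimes e]=[ab\otimes e]$, functorial in $E$. Maps: $\pi^{1,0}_{d,E}([a\otimes e])=ae$, $j^1_{d,E}(e)=[1\otimes e]$ ($\Bbbk$-linear), $\iota^1_{d,E}\colon\Omega^1_dE\to J^1_dE$, $a\,db\otimes_Ae\mapsto[a\otimes be]-[ab\otimes e]$. **Holonomic jets.** Define $D^I_E\colon J^1_dJ^1_dE\to\Omega^1_dE$, $[a\otimes[c\otimes e]]\mapsto a\,dc\otimes_Ae$, and $D^{II}_E\colon J^1_dJ^1_dE\to\Omega^2_dE$, $[a\otimes[c\otimes e]]\mapsto da\wedge dc\otimes_Ae$. Put $J^0_dE=E$, $l^1=\mathrm{id}$, and for $n\ge2$ let $l^n_{d,E}\colon J^n_dE\hookrightarrow J^1_dJ^{n-1}_dE$ be the inclusion of the left $A$-submodule of those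 $x$ such that both $D^I_{J^{n-2}_dE}$ and $D^{II}_{J^{n-2}_dE}$ vanish on $J^1_d(l^{n-1}_{d,E})(x)$. $\pi^{n,n-1}_{d,E}=\pi^{1,0}_{d,J^{n-1}_dE}\circ l^n_{d,E}$; $J^{-1}_d=0$. Prolongations: $j^0=\mathrm{id}$, $l^n_{d,E}\circ j^n_{d,E}=j^1_{d,J^{n-1}_dE}\circ j^{n-1}_{d,E}$. **Symmetric forms.** $S^0_dE=E$, $S^1_dE=\Omega^1_dE$ with $\iota^1_{\wedge,E}=\mathrm{id}$; for $n\ge2$, $\iota^n_{\wedge,E}\colon S^n_dE\hookrightarrow\Omega^1_dS^{n-1}_dE$ is the kernel of $\Omega^1_dS^{n-1}_dE\xrightarrow{\Omega^1_d(\iota^{n-1}_{\wedge,E})}\Omega^1_d\Omega^1_dS^{n-2}_dE\xrightarrow{\wedge}\Omega^2_dS^{n-2}_dE$. $\iota^0_{d,E}=\mathrm{id}$, and $\iota^n_{d,E}\colon S^n_dE\to J^n_dE$ is the unique map with $l^n_{d,E}\circ\iota^n_{d,E}=\iota^1_{d,J^{n-1}_dE}\circ\Omega^1_d(\iota^{n-1}_{d,E})\circ\iota^n_{\wedge,E}$. The $n$-jet sequence at $E$ is $0\to S^n_dE\xrightarrow{\iota^n_{d,E}}J^n_dE\xrightarrow{\pi^{n,n-1}_{d,E}}J^{n-1}_dE\to0$. **Connections.** A left connection on a left $A$-module $M$ is a $\Bbbk$-linear $\nabla\colon M\to\Omega^1_d\otimes_AM$ with $\nabla(am)=da\otimes_Am+a\nabla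 m$. **Differential operators and symbols.** $\mathrm{Diff}^n_d(E,F)$ is the $\Bbbk$-module of $\Bbbk$-linear maps $\Delta\colon E\to F$ for which there is a left $A$-linear lift $\widetilde\Delta\colon J^n_dE\to F$ with $\widetilde\Delta\circ j^n_{d,E}=\Delta$; these are increasing in $n$ and $\mathrm{Diff}_d(E,F)=\bigcup_n\mathrm{Diff}^n_d(E,F)$. $\mathrm{Symb}^n_d(E,F)=\mathrm{Diff}^n_d(E,F)/\mathrm{Diff}^{n-1}_d(E,F)$ with quotient map $\varsigma^n_{d,E,F}$ ($\mathrm{Diff}^{-1}_d=0$); $\mathrm{Symb}^\bullet_d=\bigoplus_n\mathrm{Symb}^n_d$; all are functorial in $F$ by postcomposition. When $J^n_dE=A\,j^n_{d,E}(E)$, lifts are unique and the restriction symbol $r^n_{d,E,F}\colon\mathrm{Symb}^n_d(E,F)\to{}_A\mathrm{Hom}(S^n_dE,F)$, $\varsigma^n_d(\Delta)\mapsto\widetilde\Delta\circ\iota^n_{d,E}$, is well defined. **Natural quantization.** A natural $n$-quantization for $E$ is a natural transformation $q^n\colon\mathrm{Symb}^n_d(E,-)\to\mathrm{Diff}^n_d(E,-)$ of functors from left $A$-modules to $\Bbbk$-modules such that $\varsigma^n_{d,E}\circ q^n=\mathrm{id}$. A natural full quantization for $E$ is the map $q=\sum_nq^n\colon\mathrm{Symb}^\bullet_d(E,-)\to\mathrm{Diff}_d(E,-)$ determined by a collection $\{q^n\}_{n\in\mathbb N}$ of natural $n$-quantizations. *)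

theory Defs
  imports "HOL-Algebra.Module" "HOL-Algebra.AbelCoset" "HOL-Algebra.Generated_Groups"
begin

section \<open>Modules over a not necessarily commutative ring\<close>

text \<open>
  Modules are records of type \<^typ>\<open>('r, 'm) module\<close>, as in HOL-Algebra, where the locale
  \<^locale>\<open>module\<close> requires a commutative ring of scalars; the fields \<^const>\<open>mult\<close> and \<^const>\<open>one\<close>
  of such a record carry no information.
\<close>

locale left_module = R?: ring R + M?: abelian_group M
  for R :: "('r, 'y) ring_scheme" and M :: "('r, 'm, 'z) module_scheme" +
  assumes lsmult_closed:
      "\<lbrakk>a \<in> carrier R; x \<in> carrier M\<rbrakk> \<Longrightarrow> a \<odot>\<^bsub>M\<^esub> x \<in> carrier M"
    and lsmult_l_distr:
      "\<lbrakk>a \<in> carrier R; b \<in> carrier R; x \<in> carrier M\<rbrakk> \<Longrightarrow>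
        (a \<oplus>\<^bsub>R\<^esub> b) \<odot>\<^bsub>M\<^esub> x = a \<odot>\<^bsub>M\<^esub> x \<oplus>\<^bsub>M\<^esub> b \<odot>\<^bsub>M\<^esub> x"
    and lsmult_r_distr:
      "\<lbrakk>a \<in> carrier R; x \<in> carrier M; y \<in> carrier M\<rbrakk> \<Longrightarrow>
        a \<odot>\<^bsub>M\<^esub> (x \<oplus>\<^bsub>M\<^esub> y) = a \<odot>\<^bsub>M\<^esub> x \<oplus>\<^bsub>M\<^esub> a \<odot>\<^bsub>M\<^esub> y"
    and lsmult_assoc:
      "\<lbrakk>a \<in> carrier R; b \<in> carrier R; x \<in> carrier M\<rbrakk> \<Longrightarrow>
        (a \<otimes>\<^bsub>R\<^esub> b) \<odot>\<^bsub>M\<^esub> x = a \<odot>\<^bsub>M\<^esub> (b \<odot>\<^bsub>M\<^esub> x)"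
    and lsmult_one:
      "x \<in> carrier M \<Longrightarrow> \<one>\<^bsub>R\<^esub> \<odot>\<^bsub>M\<^esub> x = x"

definition mod_hom ::
    "('r, 'y) ring_scheme \<Rightarrow> ('r, 'm, 'z) module_scheme \<Rightarrow> ('r, 'n, 'z') module_scheme \<Rightarrow> ('m \<Rightarrow> 'n) set"
  where "mod_hom R M N =
    {f \<in> carrier M \<rightarrow> carrier N.
       (\<forall>x\<in>carrier M. \<forall>y\<in>carrier M. f (x \<oplus>\<^bsub>M\<^esub> y) = f x \<oplus>\<^bsub>N\<^esub> f y) \<and>
       (\<forall>a\<in>carrier R. \<forall>x\<in>carrier M. f (a \<odot>\<^bsub>M\<^esub> x) = a \<odot>\<^bsub>N\<^esub> f x)}"

definition quot_module :: "('r, 'm) module \<Rightarrow> 'm set \<Rightarrow> ('r, 'm set) module"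
  where "quot_module M N =
    \<lparr>carrier = a_rcosets\<^bsub>M\<^esub> N, mult = undefined, one = undefined,
     zero = N, add = set_add M,
     smult = (\<lambda>a X. \<Union>x\<in>X. N +>\<^bsub>M\<^esub> (a \<odot>\<^bsub>M\<^esub> x))\<rparr>"

definition lsum :: "('m, 'z) ring_scheme \<Rightarrow> ('x \<Rightarrow> 'm) \<Rightarrow> 'x list \<Rightarrow> 'm"
  where "lsum M f xs = foldr (\<lambda>x y. f x \<oplus>\<^bsub>M\<^esub> y) xs \<zero>\<^bsub>M\<^esub>"


section \<open>Exterior algebras\<close>

record ('k, 'w) dga = "('k, 'w) module" +
  grade :: "nat \<Rightarrow> 'w set"
  deriv :: "'w \<Rightarrow> 'w"

text \<open>
  \<open>forms \<Omega> n\<close> is the degree \<open>n\<close> part of \<open>\<Omega>\<close>, and \<open>alg \<Omega>\<close> is the algebra \<open>A\<close>.  For \<open>n > 0\<close> the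
  multiplication of \<open>\<Omega>\<close> serves only as the action of \<open>A\<close> on \<open>forms \<Omega> n\<close> from either side.
\<close>

definition forms :: "('k, 'w) dga \<Rightarrow> nat \<Rightarrow> 'w ring"
  where "forms \<Omega> n =
    \<lparr>carrier = grade \<Omega> n, mult = mult \<Omega>, one = one \<Omega>, zero = zero \<Omega>, add = add \<Omega>\<rparr>"

abbreviation alg :: "('k, 'w) dga \<Rightarrow> 'w ring"
  where "alg \<Omega> \<equiv> forms \<Omega> 0"

locale exterior_algebra = Mod: module K \<Omega> + Alg: ring \<Omega>
  for K :: "'k ring" and \<Omega> :: "('k, 'w) dga" +
  assumes smult_mult_left:
      "\<lbrakk>c \<in> carrier K; x \<in> carrier \<Omega>; y \<in> carrier \<Omega>\<rbrakk> \<Longrightarrow>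
        c \<odot>\<^bsub>\<Omega>\<^esub> (x \<otimes>\<^bsub>\<Omega>\<^esub> y) = (c \<odot>\<^bsub>\<Omega>\<^esub> x) \<otimes>\<^bsub>\<Omega>\<^esub> y"
    and smult_mult_right:
      "\<lbrakk>c \<in> carrier K; x \<in> carrier \<Omega>; y \<in> carrier \<Omega>\<rbrakk> \<Longrightarrow>
        c \<odot>\<^bsub>\<Omega>\<^esub> (x \<otimes>\<^bsub>\<Omega>\<^esub> y) = x \<otimes>\<^bsub>\<Omega>\<^esub> (c \<odot>\<^bsub>\<Omega>\<^esub> y)"
    and grade_submodule: "submodule (grade \<Omega> n) K \<Omega>"
    and grade_decomposition:
      "x \<in> carrier \<Omega> \<Longrightarrow>
        \<exists>!c. (\<forall>n. c n \<in> grade \<Omega> n) \<and> finite {n. c n \<noteq> \<zero>\<^bsub>\<Omega>\<^esub>} \<and>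
             x = (\<Oplus>\<^bsub>\<Omega>\<^esub>n\<in>{n. c n \<noteq> \<zero>\<^bsub>\<Omega>\<^esub>}. c n)"
    and one_grade: "\<one>\<^bsub>\<Omega>\<^esub> \<in> grade \<Omega> 0"
    and mult_grade:
      "\<lbrakk>x \<in> grade \<Omega> m; y \<in> grade \<Omega> n\<rbrakk> \<Longrightarrow> x \<otimes>\<^bsub>\<Omega>\<^esub> y \<in> grade \<Omega> (m + n)"
    and deriv_linear: "deriv \<Omega> \<in> mod_hom K \<Omega> \<Omega>"
    and deriv_grade: "x \<in> grade \<Omega> n \<Longrightarrow> deriv \<Omega> x \<in> grade \<Omega> (Suc n)"
    and deriv_deriv: "x \<in> carrier \<Omega> \<Longrightarrow> deriv \<Omega> (deriv \<Omega> x) = \<zero>\<^bsub>\<Omega>\<^esub>"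
    and graded_Leibniz:
      "\<lbrakk>x \<in> grade \<Omega> n; y \<in> carrier \<Omega>\<rbrakk> \<Longrightarrow>
        deriv \<Omega> (x \<otimes>\<^bsub>\<Omega>\<^esub> y) = deriv \<Omega> x \<otimes>\<^bsub>\<Omega>\<^esub> y \<oplus>\<^bsub>\<Omega>\<^esub>
          (if even n then x \<otimes>\<^bsub>\<Omega>\<^esub> deriv \<Omega> y else \<ominus>\<^bsub>\<Omega>\<^esub> (x \<otimes>\<^bsub>\<Omega>\<^esub> deriv \<Omega> y))"
    and generated:
      "grade \<Omega> n = generate (add_monoid \<Omega>)
        {a \<otimes>\<^bsub>\<Omega>\<^esub> foldr (\<lambda>b w. deriv \<Omega> b \<otimes>\<^bsub>\<Omega>\<^esub> w) bs \<one>\<^bsub>\<Omega>\<^esub> |a bs.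
           a \<in> grade \<Omega> 0 \<and> set bs \<subseteq> grade \<Omega> 0 \<and> length bs = n}"

text \<open>The \<open>\<Bbbk>\<close>-module underlying a left \<open>A\<close>-module, via the structure map \<open>c \<mapsto> c 1\<close> of \<open>A\<close>.\<close>

definition kmod :: "('k, 'w) dga \<Rightarrow> ('w, 'm) module \<Rightarrow> ('k, 'm) module"
  where "kmod \<Omega> M =
    \<lparr>carrier = carrier M, mult = mult M, one = one M, zero = zero M, add = add M,
     smult = (\<lambda>c m. (c \<odot>\<^bsub>\<Omega>\<^esub> \<one>\<^bsub>\<Omega>\<^esub>) \<odot>\<^bsub>M\<^esub> m)\<rparr>"


section \<open>Tensor products\<close>

text \<open>
  Two formal sums of pure tensors, written as lists of pairs, are equal in the tensor product over
  \<open>S\<close> of the right module \<open>X\<close>, with action \<open>\<rho>\<close>, and the left module \<open>M\<close>, iff they are related by the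
  following congruence.  The rule \<open>zero\<close> makes the quotient monoid a group.
\<close>

inductive tensor_eq ::
    "('r, 'y) ring_scheme \<Rightarrow> ('x, 'v) ring_scheme \<Rightarrow> ('x \<Rightarrow> 'r \<Rightarrow> 'x) \<Rightarrow> ('r, 'm, 'z) module_scheme \<Rightarrow>
      ('x \<times> 'm) list \<Rightarrow> ('x \<times> 'm) list \<Rightarrow> bool"
  for S X \<rho> M
  where
    refl: "set ts \<subseteq> carrier X \<times> carrier M \<Longrightarrow> tensor_eq S X \<rho> M ts ts"
  | sym: "tensor_eq S X \<rho> M ts us \<Longrightarrow> tensor_eq S X \<rho> M us ts"
  | trans: "tensor_eq S X \<rho> M ts us \<Longrightarrow> tensor_eq S X \<rho> M us vs \<Longrightarrow> tensor_eq S X \<rho> M ts vs"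
  | append: "tensor_eq S X \<rho> M ts ts' \<Longrightarrow> tensor_eq S X \<rho> M us us' \<Longrightarrow>
      tensor_eq S X \<rho> M (ts @ us) (ts' @ us')"
  | commute: "set ts \<subseteq> carrier X \<times> carrier M \<Longrightarrow> set us \<subseteq> carrier X \<times> carrier M \<Longrightarrow>
      tensor_eq S X \<rho> M (ts @ us) (us @ ts)"
  | zero: "m \<in> carrier M \<Longrightarrow> tensor_eq S X \<rho> M [(\<zero>\<^bsub>X\<^esub>, m)] []"
  | add_left: "x \<in> carrier X \<Longrightarrow> y \<in> carrier X \<Longrightarrow> m \<in> carrier M \<Longrightarrow>
      tensor_eq S X \<rho> M [(x \<oplus>\<^bsub>X\<^esub> y, m)] [(x, m), (y, m)]"
  | add_right: "x \<in> carrier X \<Longrightarrow> m \<in> carrier M \<Longrightarrow> n \<in> carrier M \<Longrightarrow>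
      tensor_eq S X \<rho> M [(x, m \<oplus>\<^bsub>M\<^esub> n)] [(x, m), (x, n)]"
  | balanced: "x \<in> carrier X \<Longrightarrow> s \<in> carrier S \<Longrightarrow> m \<in> carrier M \<Longrightarrow>
      tensor_eq S X \<rho> M [(\<rho> x s, m)] [(x, s \<odot>\<^bsub>M\<^esub> m)]"

text \<open>
  The iterated constructions \<open>J\<^sup>n\<close> and \<open>S\<^sup>n\<close> have to live in a single type.  \<open>FSum\<close> injects formal sums
  over this type into the type itself, and an element of a tensor product (or of a quotient of one) is
  encoded by \<open>FSum\<close> of a chosen representative of its class.  \<open>Base\<close> embeds the module \<open>E\<close>.
\<close>

datatype ('w, 'e) univ = Base (the_base: 'e) | FSum (summands: "('w \<times> ('w, 'e) univ) list")

definition tensor_cls ::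
    "('r, 'y) ring_scheme \<Rightarrow> ('w, 'v) ring_scheme \<Rightarrow> ('w \<Rightarrow> 'r \<Rightarrow> 'w) \<Rightarrow>
      ('r, ('w, 'e) univ, 'z) module_scheme \<Rightarrow> ('w \<times> ('w, 'e) univ) list \<Rightarrow> ('w, 'e) univ"
  where "tensor_cls S X \<rho> M ts = FSum (SOME us. tensor_eq S X \<rho> M ts us)"

text \<open>The left module structure comes from the multiplication of \<open>X\<close>.\<close>

definition tensor ::
    "('r, 'y) ring_scheme \<Rightarrow> ('w, 'v) ring_scheme \<Rightarrow> ('w \<Rightarrow> 'r \<Rightarrow> 'w) \<Rightarrow>
      ('r, ('w, 'e) univ, 'z) module_scheme \<Rightarrow> ('w, ('w, 'e) univ) module"
  where "tensor S X \<rho> M =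
    \<lparr>carrier = {tensor_cls S X \<rho> M ts |ts. set ts \<subseteq> carrier X \<times> carrier M},
     mult = undefined, one = undefined,
     zero = tensor_cls S X \<rho> M [],
     add = (\<lambda>t u. tensor_cls S X \<rho> M (summands t @ summands u)),
     smult = (\<lambda>a t. tensor_cls S X \<rho> M (map (apfst (\<lambda>x. a \<otimes>\<^bsub>X\<^esub> x)) (summands t)))\<rparr>"

definition base_module :: "('w, 'e) module \<Rightarrow> ('w, ('w, 'e) univ) module"
  where "base_module E =
    \<lparr>carrier = Base ` carrier E, mult = undefined, one = undefined,
     zero = Base \<zero>\<^bsub>E\<^esub>,
     add = (\<lambda>x y. Base (the_base x \<oplus>\<^bsub>E\<^esub> the_base y)),
     smult = (\<lambda>a x. Base (a \<odot>\<^bsub>E\<^esub> the_base x))\<rparr>"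

text \<open>Composition of nested formal sums: \<open>w \<otimes> (v \<otimes> m)\<close> becomes \<open>f w v \<otimes> m\<close>.\<close>

definition flatten ::
    "('w \<Rightarrow> 'w \<Rightarrow> 'w) \<Rightarrow> ('w, 'e) univ \<Rightarrow> ('w \<times> ('w, 'e) univ) list"
  where "flatten f t =
    concat (map (\<lambda>(w, y). map (\<lambda>(v, m). (f w v, m)) (summands y)) (summands t))"


section \<open>Forms and jets with values in a module\<close>

text \<open>
  Maps out of tensor products and jet modules are given by their formulas on pure tensors, evaluated on
  the chosen representatives.
\<close>

context
  fixes K :: "'k ring" and \<Omega> :: "('k, 'w) dga"
begin

definition form_cls ::
    "nat \<Rightarrow> ('w, ('w, 'e) univ) module \<Rightarrow> ('w \<times> ('w, 'e) univ) list \<Rightarrow> ('w, 'e) univ"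
  where "form_cls n M = tensor_cls (alg \<Omega>) (forms \<Omega> n) (mult \<Omega>) M"

text \<open>\<open>\<Omega>\<^sup>n \<otimes>\<^sub>A M\<close>\<close>

definition form_module ::
    "nat \<Rightarrow> ('w, ('w, 'e) univ) module \<Rightarrow> ('w, ('w, 'e) univ) module"
  where "form_module n M = tensor (alg \<Omega>) (forms \<Omega> n) (mult \<Omega>) M"

text \<open>The functor \<open>\<Omega>\<^sup>n\<close> on a map with codomain \<open>N\<close>.\<close>

definition form_map ::
    "nat \<Rightarrow> ('w, ('w, 'e) univ) module \<Rightarrow> (('w, 'e) univ \<Rightarrow> ('w, 'e) univ) \<Rightarrow>
      ('w, 'e) univ \<Rightarrow> ('w, 'e) univ"
  where "form_map n N \<phi> t = form_cls n N (map (apsnd \<phi>) (summands t))"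

text \<open>\<open>\<Omega>\<^sup>1 \<otimes>\<^sub>A \<Omega>\<^sup>1 \<otimes>\<^sub>A M \<rightarrow> \<Omega>\<^sup>2 \<otimes>\<^sub>A M\<close>\<close>

definition wedge_map :: "('w, ('w, 'e) univ) module \<Rightarrow> ('w, 'e) univ \<Rightarrow> ('w, 'e) univ"
  where "wedge_map M t = form_cls 2 M (flatten (mult \<Omega>) t)"

text \<open>\<open>A \<otimes>\<^sub>\<Bbbk> M\<close>\<close>

definition ktensor_cls ::
    "('w, ('w, 'e) univ) module \<Rightarrow> ('w \<times> ('w, 'e) univ) list \<Rightarrow> ('w, 'e) univ"
  where "ktensor_cls M = tensor_cls K (alg \<Omega>) (\<lambda>a c. c \<odot>\<^bsub>\<Omega>\<^esub> a) (kmod \<Omega> M)"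

definition ktensor :: "('w, ('w, 'e) univ) module \<Rightarrow> ('w, ('w, 'e) univ) module"
  where "ktensor M = tensor K (alg \<Omega>) (\<lambda>a c. c \<odot>\<^bsub>\<Omega>\<^esub> a) (kmod \<Omega> M)"

definition jet1_rel :: "('w, ('w, 'e) univ) module \<Rightarrow> ('w, 'e) univ set"
  where "jet1_rel M =
    {ktensor_cls M ts |ts. set ts \<subseteq> carrier (alg \<Omega>) \<times> carrier M \<and>
       lsum M (\<lambda>(a, m). a \<odot>\<^bsub>M\<^esub> m) ts = \<zero>\<^bsub>M\<^esub> \<and>
       form_cls 1 M (map (apfst (deriv \<Omega>)) ts) = \<zero>\<^bsub>form_module 1 M\<^esub>}"

text \<open>\<open>jet1_cls M [(a\<^sub>1, m\<^sub>1), \<dots>]\<close> is \<open>[a\<^sub>1 \<otimes> m\<^sub>1 + \<dots>]\<close>.\<close>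

definition jet1_cls ::
    "('w, ('w, 'e) univ) module \<Rightarrow> ('w \<times> ('w, 'e) univ) list \<Rightarrow> ('w, 'e) univ"
  where "jet1_cls M ts = (SOME t. t \<in> jet1_rel M +>\<^bsub>ktensor M\<^esub> ktensor_cls M ts)"

definition jet1 :: "('w, ('w, 'e) univ) module \<Rightarrow> ('w, ('w, 'e) univ) module"
  where "jet1 M =
    \<lparr>carrier = {jet1_cls M ts |ts. set ts \<subseteq> carrier (alg \<Omega>) \<times> carrier M},
     mult = undefined, one = undefined,
     zero = jet1_cls M [],
     add = (\<lambda>x y. jet1_cls M (summands x @ summands y)),
     smult = (\<lambda>a x. jet1_cls M (map (apfst (\<lambda>b. a \<otimes>\<^bsub>\<Omega>\<^esub> b)) (summands x)))\<rparr>"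

text \<open>The functor \<open>J\<^sup>1\<close> on a map with codomain \<open>N\<close>.\<close>

definition jet1_map ::
    "('w, ('w, 'e) univ) module \<Rightarrow> (('w, 'e) univ \<Rightarrow> ('w, 'e) univ) \<Rightarrow>
      ('w, 'e) univ \<Rightarrow> ('w, 'e) univ"
  where "jet1_map N \<phi> x = jet1_cls N (map (apsnd \<phi>) (summands x))"

definition jet1_proj :: "('w, ('w, 'e) univ) module \<Rightarrow> ('w, 'e) univ \<Rightarrow> ('w, 'e) univ"
  where "jet1_proj M x = lsum M (\<lambda>(a, m). a \<odot>\<^bsub>M\<^esub> m) (summands x)"

definition jet1_prolong :: "('w, ('w, 'e) univ) module \<Rightarrow> ('w, 'e) univ \<Rightarrow> ('w, 'e) univ"
  where "jet1_prolong M m = jet1_cls M [(\<one>\<^bsub>\<Omega>\<^esub>, m)]"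

definition jet1_iota :: "('w, ('w, 'e) univ) module \<Rightarrow> ('w, 'e) univ \<Rightarrow> ('w, 'e) univ"
  where "jet1_iota M t =
    (THE x. \<exists>zs. set zs \<subseteq> carrier (alg \<Omega>) \<times> carrier (alg \<Omega>) \<times> carrier M \<and>
       t = form_cls 1 M (map (\<lambda>(a, b, m). (a \<otimes>\<^bsub>\<Omega>\<^esub> deriv \<Omega> b, m)) zs) \<and>
       x = lsum (jet1 M)
             (\<lambda>(a, b, m). jet1_cls M [(a, b \<odot>\<^bsub>M\<^esub> m)] \<ominus>\<^bsub>jet1 M\<^esub> jet1_cls M [(a \<otimes>\<^bsub>\<Omega>\<^esub> b, m)]) zs)"

definition D_I :: "('w, ('w, 'e) univ) module \<Rightarrow> ('w, 'e) univ \<Rightarrow> ('w, 'e) univ"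
  where "D_I M x = form_cls 1 M (flatten (\<lambda>a c. a \<otimes>\<^bsub>\<Omega>\<^esub> deriv \<Omega> c) x)"

definition D_II :: "('w, ('w, 'e) univ) module \<Rightarrow> ('w, 'e) univ \<Rightarrow> ('w, 'e) univ"
  where "D_II M x = form_cls 2 M (flatten (\<lambda>a c. deriv \<Omega> a \<otimes>\<^bsub>\<Omega>\<^esub> deriv \<Omega> c) x)"


section \<open>Holonomic jets and symmetric forms\<close>

text \<open>
  The inclusions \<open>l\<^sup>n\<close> and \<open>\<iota>\<^sup>n\<^sub>\<and>\<close> are identity functions between carriers.  The functors \<open>J\<^sup>1\<close> and \<open>\<Omega>\<^sup>1\<close>
  need not preserve injectivity, and \<open>J\<^sup>1(l\<^sup>n)\<close> and \<open>\<Omega>\<^sup>1(\<iota>\<^sup>n\<^sub>\<and>)\<close> are not identity functions.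
\<close>

fun jet :: "('w, 'e) module \<Rightarrow> nat \<Rightarrow> ('w, ('w, 'e) univ) module"
  where
    "jet E 0 = base_module E"
  | "jet E (Suc 0) = jet1 (jet E 0)"
  | "jet E (Suc (Suc n)) = (jet1 (jet E (Suc n)))
      \<lparr>carrier := {x \<in> carrier (jet1 (jet E (Suc n))).
         let y = jet1_map (jet1 (jet E n)) (\<lambda>u. u) x
         in D_I (jet E n) y = \<zero>\<^bsub>form_module 1 (jet E n)\<^esub> \<and>
            D_II (jet E n) y = \<zero>\<^bsub>form_module 2 (jet E n)\<^esub>}\<rparr>"

fun prolong :: "('w, 'e) module \<Rightarrow> nat \<Rightarrow> 'e \<Rightarrow> ('w, 'e) univ"
  where
    "prolong E 0 e = Base e"
  | "prolong E (Suc n) e = jet1_prolong (jet E n) (prolong E n e)"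

fun sym_form :: "('w, 'e) module \<Rightarrow> nat \<Rightarrow> ('w, ('w, 'e) univ) module"
  where
    "sym_form E 0 = base_module E"
  | "sym_form E (Suc 0) = form_module 1 (sym_form E 0)"
  | "sym_form E (Suc (Suc n)) = (form_module 1 (sym_form E (Suc n)))
      \<lparr>carrier := {t \<in> carrier (form_module 1 (sym_form E (Suc n))).
         wedge_map (sym_form E n) (form_map 1 (form_module 1 (sym_form E n)) (\<lambda>u. u) t)
           = \<zero>\<^bsub>form_module 2 (sym_form E n)\<^esub>}\<rparr>"

fun iota :: "('w, 'e) module \<Rightarrow> nat \<Rightarrow> ('w, 'e) univ \<Rightarrow> ('w, 'e) univ"
  where
    "iota E 0 t = t"
  | "iota E (Suc n) t = jet1_iota (jet E n) (form_map 1 (jet E n) (iota E n) t)"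

text \<open>For \<open>n = 0\<close> the sequence ends in \<open>J\<^sup>-\<^sup>1 = 0\<close>.\<close>

definition jet_sequence_right_exact :: "('w, 'e) module \<Rightarrow> nat \<Rightarrow> bool"
  where "jet_sequence_right_exact E n \<longleftrightarrow>
    (case n of
       0 \<Rightarrow> iota E 0 ` carrier (sym_form E 0) = carrier (jet E 0)
     | Suc m \<Rightarrow>
         iota E n ` carrier (sym_form E n)
           = {x \<in> carrier (jet E n). jet1_proj (jet E m) x = \<zero>\<^bsub>jet E m\<^esub>} \<and>
         jet1_proj (jet E m) ` carrier (jet E n) = carrier (jet E m))"

definition generated_by_prolongations :: "('w, 'e) module \<Rightarrow> nat \<Rightarrow> bool"
  where "generated_by_prolongations E n \<longleftrightarrow>
    carrier (jet E n) =
      {lsum (jet E n) (\<lambda>(a, e). a \<odot>\<^bsub>jet E n\<^esub> prolong E n e) ts |ts.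
         set ts \<subseteq> carrier (alg \<Omega>) \<times> carrier E}"

definition left_connection ::
    "('w, ('w, 'e) univ) module \<Rightarrow> (('w, 'e) univ \<Rightarrow> ('w, 'e) univ) \<Rightarrow> bool"
  where "left_connection M D \<longleftrightarrow>
    D \<in> mod_hom K (kmod \<Omega> M) (kmod \<Omega> (form_module 1 M)) \<and>
    (\<forall>a\<in>carrier (alg \<Omega>). \<forall>m\<in>carrier M.
       D (a \<odot>\<^bsub>M\<^esub> m) =
         form_cls 1 M [(deriv \<Omega> a, m)] \<oplus>\<^bsub>form_module 1 M\<^esub> a \<odot>\<^bsub>form_module 1 M\<^esub> D m)"

text \<open>\<open>s\<close> is a left \<open>A\<close>-linear left inverse of \<open>\<iota>\<^sup>k\<^sup>+\<^sup>1\<^sub>\<and> : S\<^sup>k\<^sup>+\<^sup>1E \<rightarrow> \<Omega>\<^sup>1 S\<^sup>kE\<close>.\<close>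

definition left_splitting ::
    "('w, 'e) module \<Rightarrow> nat \<Rightarrow> (('w, 'e) univ \<Rightarrow> ('w, 'e) univ) \<Rightarrow> bool"
  where "left_splitting E k s \<longleftrightarrow>
    s \<in> mod_hom (alg \<Omega>) (form_module 1 (sym_form E k)) (sym_form E (Suc k)) \<and>
    (\<forall>t\<in>carrier (sym_form E (Suc k)). s t = t)"


section \<open>Differential operators and symbols\<close>

text \<open>Operators are extensional functions, so that their equality is equality on \<open>E\<close>.\<close>

definition diff_ops :: "('w, 'e) module \<Rightarrow> ('w, 'f) module \<Rightarrow> nat \<Rightarrow> ('e \<Rightarrow> 'f) set"
  where "diff_ops E F n =
    {\<Delta> \<in> mod_hom K (kmod \<Omega> E) (kmod \<Omega> F) \<inter> extensional (carrier E).
       \<exists>L \<in> mod_hom (alg \<Omega>) (jet E n) F. \<forall>e\<in>carrier E. L (prolong E n e) = \<Delta> e}"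

text \<open>\<open>diff_ops_below E F n\<close> consists of the operators of order \<open>n - 1\<close>, where \<open>Diff\<^sup>-\<^sup>1 = 0\<close>.\<close>

definition diff_ops_below :: "('w, 'e) module \<Rightarrow> ('w, 'f) module \<Rightarrow> nat \<Rightarrow> ('e \<Rightarrow> 'f) set"
  where "diff_ops_below E F n =
    (case n of 0 \<Rightarrow> {\<lambda>e\<in>carrier E. \<zero>\<^bsub>F\<^esub>} | Suc m \<Rightarrow> diff_ops E F m)"

definition operator_module ::
    "('w, 'e) module \<Rightarrow> ('w, 'f) module \<Rightarrow> ('e \<Rightarrow> 'f) set \<Rightarrow> ('k, 'e \<Rightarrow> 'f) module"
  where "operator_module E F D =
    \<lparr>carrier = D, mult = undefined, one = undefined,
     zero = (\<lambda>e\<in>carrier E. \<zero>\<^bsub>F\<^esub>),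
     add = (\<lambda>\<Delta> \<Delta>'. \<lambda>e\<in>carrier E. \<Delta> e \<oplus>\<^bsub>F\<^esub> \<Delta>' e),
     smult = (\<lambda>c \<Delta>. \<lambda>e\<in>carrier E. c \<odot>\<^bsub>kmod \<Omega> F\<^esub> \<Delta> e)\<rparr>"

definition Diff_n :: "('w, 'e) module \<Rightarrow> nat \<Rightarrow> ('w, 'f) module \<Rightarrow> ('k, 'e \<Rightarrow> 'f) module"
  where "Diff_n E n F = operator_module E F (diff_ops E F n)"

definition Diff :: "('w, 'e) module \<Rightarrow> ('w, 'f) module \<Rightarrow> ('k, 'e \<Rightarrow> 'f) module"
  where "Diff E F = operator_module E F (\<Union>n. diff_ops E F n)"

definition Diff_map ::
    "('w, 'e) module \<Rightarrow> ('w, 'f) module \<Rightarrow> ('w, 'g) module \<Rightarrow> ('f \<Rightarrow> 'g) \<Rightarrow> ('e \<Rightarrow> 'f) \<Rightarrow> ('e \<Rightarrow> 'g)"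
  where "Diff_map E F G \<psi> \<Delta> = compose (carrier E) \<psi> \<Delta>"

definition Symb_n :: "('w, 'e) module \<Rightarrow> nat \<Rightarrow> ('w, 'f) module \<Rightarrow> ('k, ('e \<Rightarrow> 'f) set) module"
  where "Symb_n E n F = quot_module (Diff_n E n F) (diff_ops_below E F n)"

definition symb :: "('w, 'e) module \<Rightarrow> nat \<Rightarrow> ('w, 'f) module \<Rightarrow> ('e \<Rightarrow> 'f) \<Rightarrow> ('e \<Rightarrow> 'f) set"
  where "symb E n F \<Delta> = diff_ops_below E F n +>\<^bsub>Diff_n E n F\<^esub> \<Delta>"

definition Symb_n_map ::
    "('w, 'e) module \<Rightarrow> nat \<Rightarrow> ('w, 'f) module \<Rightarrow> ('w, 'g) module \<Rightarrow> ('f \<Rightarrow> 'g) \<Rightarrow>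
      ('e \<Rightarrow> 'f) set \<Rightarrow> ('e \<Rightarrow> 'g) set"
  where "Symb_n_map E n F G \<psi> \<sigma> = (\<Union>\<Delta>\<in>\<sigma>. symb E n G (Diff_map E F G \<psi> \<Delta>))"

definition Symb :: "('w, 'e) module \<Rightarrow> ('w, 'f) module \<Rightarrow> ('k, nat \<Rightarrow> ('e \<Rightarrow> 'f) set) module"
  where "Symb E F =
    \<lparr>carrier = {\<sigma>. (\<forall>n. \<sigma> n \<in> carrier (Symb_n E n F)) \<and> finite {n. \<sigma> n \<noteq> \<zero>\<^bsub>Symb_n E n F\<^esub>}},
     mult = undefined, one = undefined,
     zero = (\<lambda>n. \<zero>\<^bsub>Symb_n E n F\<^esub>),
     add = (\<lambda>\<sigma> \<tau> n. \<sigma> n \<oplus>\<^bsub>Symb_n E n F\<^esub> \<tau> n),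
     smult = (\<lambda>c \<sigma> n. c \<odot>\<^bsub>Symb_n E n F\<^esub> \<sigma> n)\<rparr>"

definition Symb_map ::
    "('w, 'e) module \<Rightarrow> ('w, 'f) module \<Rightarrow> ('w, 'g) module \<Rightarrow> ('f \<Rightarrow> 'g) \<Rightarrow>
      (nat \<Rightarrow> ('e \<Rightarrow> 'f) set) \<Rightarrow> (nat \<Rightarrow> ('e \<Rightarrow> 'g) set)"
  where "Symb_map E F G \<psi> \<sigma> = (\<lambda>n. Symb_n_map E n F G \<psi> (\<sigma> n))"

text \<open>
  \<open>r\<^sup>n\<close>: the lift of any representative of the symbol, restricted along \<open>\<iota>\<^sup>n\<close>; this is unambiguous when
  \<open>J\<^sup>nE\<close> is generated by prolongations.
\<close>

definition restriction_symbol ::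
    "('w, 'e) module \<Rightarrow> nat \<Rightarrow> ('w, 'f) module \<Rightarrow> ('e \<Rightarrow> 'f) set \<Rightarrow> ('w, 'e) univ \<Rightarrow> 'f"
  where "restriction_symbol E n F \<sigma> =
    (THE \<rho>. \<exists>\<Delta>\<in>\<sigma>. \<exists>L\<in>mod_hom (alg \<Omega>) (jet E n) F.
       (\<forall>e\<in>carrier E. L (prolong E n e) = \<Delta> e) \<and>
       \<rho> = (\<lambda>t\<in>carrier (sym_form E n). L (iota E n t)))"


section \<open>Natural quantizations\<close>

text \<open>
  Functors from left \<open>A\<close>-modules (with elements in a type \<open>'f\<close>) to \<open>\<Bbbk>\<close>-modules are given by their object
  and morphism parts.
\<close>

definition natural_transformation ::
    "(('w, 'f) module \<Rightarrow> ('k, 'x) module) \<Rightarrow>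
     (('w, 'f) module \<Rightarrow> ('w, 'f) module \<Rightarrow> ('f \<Rightarrow> 'f) \<Rightarrow> 'x \<Rightarrow> 'x) \<Rightarrow>
     (('w, 'f) module \<Rightarrow> ('k, 'y) module) \<Rightarrow>
     (('w, 'f) module \<Rightarrow> ('w, 'f) module \<Rightarrow> ('f \<Rightarrow> 'f) \<Rightarrow> 'y \<Rightarrow> 'y) \<Rightarrow>
     (('w, 'f) module \<Rightarrow> 'x \<Rightarrow> 'y) \<Rightarrow> bool"
  where "natural_transformation P P_map Q Q_map q \<longleftrightarrow>
    (\<forall>F. left_module (alg \<Omega>) F \<longrightarrow> q F \<in> mod_hom K (P F) (Q F)) \<and>
    (\<forall>F G. left_module (alg \<Omega>) F \<longrightarrow> left_module (alg \<Omega>) G \<longrightarrow>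
       (\<forall>\<psi>\<in>mod_hom (alg \<Omega>) F G. \<forall>x\<in>carrier (P F). q G (P_map F G \<psi> x) = Q_map F G \<psi> (q F x)))"

definition natural_quantization ::
    "('w, 'e) module \<Rightarrow> nat \<Rightarrow> (('w, 'f) module \<Rightarrow> ('e \<Rightarrow> 'f) set \<Rightarrow> ('e \<Rightarrow> 'f)) \<Rightarrow> bool"
  where "natural_quantization E n q \<longleftrightarrow>
    natural_transformation (Symb_n E n) (Symb_n_map E n) (Diff_n E n) (Diff_map E) q \<and>
    (\<forall>F. left_module (alg \<Omega>) F \<longrightarrow> (\<forall>\<sigma>\<in>carrier (Symb_n E n F). symb E n F (q F \<sigma>) = \<sigma>))"

definition sum_quantization ::
    "('w, 'e) module \<Rightarrow> (nat \<Rightarrow> ('w, 'f) module \<Rightarrow> ('e \<Rightarrow> 'f) set \<Rightarrow> ('e \<Rightarrow> 'f)) \<Rightarrow>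
      ('w, 'f) module \<Rightarrow> (nat \<Rightarrow> ('e \<Rightarrow> 'f) set) \<Rightarrow> ('e \<Rightarrow> 'f)"
  where "sum_quantization E q F \<sigma> =
    (\<Oplus>\<^bsub>Diff E F\<^esub>n\<in>{n. \<sigma> n \<noteq> \<zero>\<^bsub>Symb_n E n F\<^esub>}. q n F (\<sigma> n))"

definition natural_full_quantization ::
    "('w, 'e) module \<Rightarrow> (('w, 'f) module \<Rightarrow> (nat \<Rightarrow> ('e \<Rightarrow> 'f) set) \<Rightarrow> ('e \<Rightarrow> 'f)) \<Rightarrow> bool"
  where "natural_full_quantization E q \<longleftrightarrow>
    natural_transformation (Symb E) (Symb_map E) (Diff E) (Diff_map E) q \<and>
    (\<exists>qs. (\<forall>n. natural_quantization E n (qs n)) \<and>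
       (\<forall>F. left_module (alg \<Omega>) F \<longrightarrow> (\<forall>\<sigma>\<in>carrier (Symb E F). q F \<sigma> = sum_quantization E qs F \<sigma>)))"

end

text \<open>\<open>iterated s D n = s\<^sub>n\<^sub>-\<^sub>1 \<circ> D\<^sub>n\<^sub>-\<^sub>1 \<circ> \<dots> \<circ> s\<^sub>0 \<circ> D\<^sub>0\<close>, where \<open>E\<close> is identified with \<open>S\<^sup>0E\<close> by \<open>Base\<close>.\<close>

fun iterated ::
    "(nat \<Rightarrow> ('w, 'e) univ \<Rightarrow> ('w, 'e) univ) \<Rightarrow> (nat \<Rightarrow> ('w, 'e) univ \<Rightarrow> ('w, 'e) univ) \<Rightarrow>
      nat \<Rightarrow> 'e \<Rightarrow> ('w, 'e) univ"
  where
    "iterated s D 0 = Base"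
  | "iterated s D (Suc n) = s n \<circ> D n \<circ> iterated s D n"

definition induced_quantization ::
    "'k ring \<Rightarrow> ('k, 'w) dga \<Rightarrow> ('w, 'e) module \<Rightarrow>
      (nat \<Rightarrow> ('w, 'e) univ \<Rightarrow> ('w, 'e) univ) \<Rightarrow> (nat \<Rightarrow> ('w, 'e) univ \<Rightarrow> ('w, 'e) univ) \<Rightarrow>
      nat \<Rightarrow> ('w, 'f) module \<Rightarrow> ('e \<Rightarrow> 'f) set \<Rightarrow> ('e \<Rightarrow> 'f)"
  where "induced_quantization K \<Omega> E s D n F \<sigma> =
    (\<lambda>e\<in>carrier E. restriction_symbol K \<Omega> E n F \<sigma> (iterated s D n e))"

end

theory Submission
  imports Defs
begin

text \<open>
  Two maps out of \<open>J\<^sup>1M\<close>, the projection \<open>\<pi>\<close> and the additive map \<open>\<delta> [a \<otimes> m] = da \<otimes> m\<close> to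
  \<open>\<Omega>\<^sup>1 \<otimes> M\<close>, are jointly injective, and \<open>\<delta> (a x) = da \<otimes> \<pi> x + a \<delta> x\<close>.  In these coordinates the
  embedding \<open>\<iota>\<^sup>1\<close> sends \<open>t\<close> to the element with \<open>\<pi> = 0\<close> and \<open>\<delta> = - t\<close>, and a connection \<open>\<nabla>\<close> lifts to the
  left linear map \<open>x \<mapsto> \<nabla> (\<pi> x) - \<delta> x\<close>, which is left inverse to \<open>\<iota>\<^sup>1\<close>.  Composing such lifts with the
  splittings gives a left linear map \<open>J\<^sup>nE \<rightarrow> S\<^sup>nE\<close> that lifts the iterated connection and is left
  inverse to \<open>\<iota>\<^sup>n\<close>.  Hence the lift of \<open>q\<^sup>n(\<sigma>)\<close> and the lift of any representative of \<open>\<sigma>\<close> agree on the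
  image of \<open>\<iota>\<^sup>n\<close>; as this image is the kernel of the surjection \<open>J\<^sup>nE \<rightarrow> J\<^sup>n\<^sup>-\<^sup>1E\<close>, they differ by an
  operator of order \<open>n - 1\<close>.
\<close>

section \<open>Additive maps and modules\<close>

text \<open>Joint injectivity is the definition of \<open>J^1\<close> in coordinates: the relations
  divided out of \<open>A \<otimes> M\<close> are the common kernel of \<pi> and \<delta>. The sign
  in the embedding comes from
  \<open>da \<otimes> b m - d(ab) \<otimes> m = - a db \<otimes> m\<close>. As \<delta> obeys the
  same Leibniz rule as \<nabla>, the inhomogeneous terms cancel in
  \<open>\<nabla> (\<pi> x) - \<delta> x\<close>. The obstacle is holonomy: it is imposed after
  \<open>J^1\<close> of an inclusion, which need not be injective, and \<open>D_II\<close> is in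
  general not \<open>A\<close>-linear. In coordinates
  \<open>D_I x = \<delta> (\<pi> x) - \<Omega>^1(\<pi>) (\<delta> x)\<close>, and
  \<open>D_II (a x) = a D_II x + da \<and> D_I x\<close>, so that it is the joint vanishing that
  defines a submodule. The embedding of symmetric forms has holonomic values because their wedge
  condition turns into \<open>D_II = 0\<close>. Generation by prolongations makes lifts unique,
  hence restriction symbols well defined. Since the quantization precomposes a lift with a fixed
  endomorphism of \<open>J^n\<close>, it is linear and natural.\<close>

lemma (in abelian_group) a_inv_zero [simp]: "\<ominus> \<zero> = \<zero>"
  using minus_equality[of \<zero> \<zero>] by simp

lemma (in abelian_group) eq_if_minus_eq_zero:
  assumes "x \<ominus> y = \<zero>" and "x \<in> carrier G" and "y \<in> carrier G"
  shows "x = y"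
proof -
  have "x = (x \<ominus> y) \<oplus> y"
    using assms(2,3) by (simp add: minus_eq a_assoc l_neg)
  then show ?thesis
    using assms by simp
qed

text \<open>Connections, \<delta> and the coordinate form of \<open>D_II\<close> are additive
  without being \<open>A\<close>-linear, so the extension and uniqueness principles below are stated
  for additive maps, with linearity as a separate condition (\<open>mod_hom_iff\<close>).\<close>

definition additive_maps :: "('m, 'y) ring_scheme \<Rightarrow> ('n, 'z) ring_scheme \<Rightarrow> ('m \<Rightarrow> 'n) set"
  where "additive_maps M N =
    {f \<in> carrier M \<rightarrow> carrier N.
       \<forall>x\<in>carrier M. \<forall>y\<in>carrier M. f (x \<oplus>\<^bsub>M\<^esub> y) = f x \<oplus>\<^bsub>N\<^esub> f y}"

lemma additive_mapsI:
  assumes "\<And>x. x \<in> carrier M \<Longrightarrow> f x \<in> carrier N"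
    and "\<And>x y. \<lbrakk>x \<in> carrier M; y \<in> carrier M\<rbrakk> \<Longrightarrow> f (x \<oplus>\<^bsub>M\<^esub> y) = f x \<oplus>\<^bsub>N\<^esub> f y"
  shows "f \<in> additive_maps M N"
  using assms by (auto simp: additive_maps_def)

lemma additive_maps_closed: "\<lbrakk>f \<in> additive_maps M N; x \<in> carrier M\<rbrakk> \<Longrightarrow> f x \<in> carrier N"
  by (auto simp: additive_maps_def)

lemma additive_maps_add:
  "\<lbrakk>f \<in> additive_maps M N; x \<in> carrier M; y \<in> carrier M\<rbrakk> \<Longrightarrow> f (x \<oplus>\<^bsub>M\<^esub> y) = f x \<oplus>\<^bsub>N\<^esub> f y"
  by (auto simp: additive_maps_def)

lemma additive_maps_zero:
  assumes "abelian_group M" and "abelian_group N" and "f \<in> additive_maps M N"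
  shows "f \<zero>\<^bsub>M\<^esub> = \<zero>\<^bsub>N\<^esub>"
proof -
  interpret M: abelian_group M by fact
  interpret N: abelian_group N by fact
  have "f \<zero>\<^bsub>M\<^esub> \<oplus>\<^bsub>N\<^esub> f \<zero>\<^bsub>M\<^esub> = f \<zero>\<^bsub>M\<^esub> \<oplus>\<^bsub>N\<^esub> \<zero>\<^bsub>N\<^esub>"
    using assms(3) by (metis M.l_zero M.zero_closed N.r_zero additive_maps_add additive_maps_closed)
  then show ?thesis
    using additive_maps_closed[OF assms(3) M.zero_closed] by simp
qed

lemma additive_maps_minus:
  assumes "abelian_group M" and "abelian_group N" and "f \<in> additive_maps M N" and "x \<in> carrier M"
  shows "f (\<ominus>\<^bsub>M\<^esub> x) = \<ominus>\<^bsub>N\<^esub> f x"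
proof -
  interpret M: abelian_group M by fact
  interpret N: abelian_group N by fact
  have "f (\<ominus>\<^bsub>M\<^esub> x) \<oplus>\<^bsub>N\<^esub> f x = f (\<ominus>\<^bsub>M\<^esub> x \<oplus>\<^bsub>M\<^esub> x)"
    using assms by (simp add: additive_maps_add)
  also have "\<dots> = \<zero>\<^bsub>N\<^esub>"
    using assms by (simp add: M.l_neg additive_maps_zero)
  finally show ?thesis
    using assms additive_maps_closed[OF assms(3)] by (metis M.a_inv_closed N.minus_equality)
qed

lemma additive_maps_diff:
  assumes "abelian_group M" and "abelian_group N" and "f \<in> additive_maps M N"
    and "x \<in> carrier M" and "y \<in> carrier M"
  shows "f (x \<ominus>\<^bsub>M\<^esub> y) = f x \<ominus>\<^bsub>N\<^esub> f y"
  using assms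
  by (simp add: a_minus_def additive_maps_add additive_maps_minus abelian_group.a_inv_closed)

lemma additive_maps_compose:
  assumes "f \<in> additive_maps M N" and "g \<in> additive_maps N P"
  shows "(\<lambda>x. g (f x)) \<in> additive_maps M P"
  using assms by (auto simp: additive_maps_def Pi_def)

lemma additive_maps_plus:
  assumes "abelian_group N" and "f \<in> additive_maps M N" and "g \<in> additive_maps M N"
  shows "(\<lambda>x. f x \<oplus>\<^bsub>N\<^esub> g x) \<in> additive_maps M N"
proof -
  interpret N: abelian_group N by fact
  show ?thesis
  proof (rule additive_mapsI)
    fix x y assume "x \<in> carrier M" "y \<in> carrier M"
    then show "f (x \<oplus>\<^bsub>M\<^esub> y) \<oplus>\<^bsub>N\<^esub> g (x \<oplus>\<^bsub>M\<^esub> y) = f x \<oplus>\<^bsub>N\<^esub> g x \<oplus>\<^bsub>N\<^esub> (f y \<oplus>\<^bsub>N\<^esub> g y)"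
      using assms(2,3)
      by (simp add: additive_maps_add N.a_ac additive_maps_closed)
  qed (use assms(2,3) in \<open>simp add: additive_maps_closed\<close>)
qed

lemma additive_maps_uminus:
  assumes "abelian_group N" and "f \<in> additive_maps M N"
  shows "(\<lambda>x. \<ominus>\<^bsub>N\<^esub> f x) \<in> additive_maps M N"
proof -
  interpret N: abelian_group N by fact
  show ?thesis
    using assms(2)
    by (intro additive_mapsI) (simp_all add: additive_maps_add N.minus_add additive_maps_closed)
qed

lemma additive_maps_subtract:
  assumes "abelian_group N" and "f \<in> additive_maps M N" and "g \<in> additive_maps M N"
  shows "(\<lambda>x. f x \<ominus>\<^bsub>N\<^esub> g x) \<in> additive_maps M N"
  unfolding a_minus_def
  using additive_maps_plus[OF assms(1,2) additive_maps_uminus[OF assms(1,3)]] .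

lemma mod_homI:
  assumes "\<And>x. x \<in> carrier M \<Longrightarrow> f x \<in> carrier N"
    and "\<And>x y. \<lbrakk>x \<in> carrier M; y \<in> carrier M\<rbrakk> \<Longrightarrow> f (x \<oplus>\<^bsub>M\<^esub> y) = f x \<oplus>\<^bsub>N\<^esub> f y"
    and "\<And>a x. \<lbrakk>a \<in> carrier R; x \<in> carrier M\<rbrakk> \<Longrightarrow> f (a \<odot>\<^bsub>M\<^esub> x) = a \<odot>\<^bsub>N\<^esub> f x"
  shows "f \<in> mod_hom R M N"
  using assms by (auto simp: mod_hom_def)

lemma mod_hom_additive: "f \<in> mod_hom R M N \<Longrightarrow> f \<in> additive_maps M N"
  by (auto simp: additive_maps_def mod_hom_def)

lemma mod_hom_iff:
  "f \<in> mod_hom R M N \<longleftrightarrow> f \<in> additive_maps M N \<and>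
    (\<forall>a\<in>carrier R. \<forall>x\<in>carrier M. f (a \<odot>\<^bsub>M\<^esub> x) = a \<odot>\<^bsub>N\<^esub> f x)"
  by (auto simp: additive_maps_def mod_hom_def)

lemma mod_hom_closed: "\<lbrakk>f \<in> mod_hom R M N; x \<in> carrier M\<rbrakk> \<Longrightarrow> f x \<in> carrier N"
  by (auto simp: mod_hom_def)

lemma mod_hom_add:
  "\<lbrakk>f \<in> mod_hom R M N; x \<in> carrier M; y \<in> carrier M\<rbrakk> \<Longrightarrow> f (x \<oplus>\<^bsub>M\<^esub> y) = f x \<oplus>\<^bsub>N\<^esub> f y"
  by (auto simp: mod_hom_def)

lemma mod_hom_smult:
  "\<lbrakk>f \<in> mod_hom R M N; a \<in> carrier R; x \<in> carrier M\<rbrakk> \<Longrightarrow> f (a \<odot>\<^bsub>M\<^esub> x) = a \<odot>\<^bsub>N\<^esub> f x"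
  by (auto simp: mod_hom_def)

lemma mod_hom_compose:
  assumes "f \<in> mod_hom R M N" and "g \<in> mod_hom R N P"
  shows "(\<lambda>x. g (f x)) \<in> mod_hom R M P"
  using assms by (auto simp: mod_hom_def Pi_def)

section \<open>Sums over lists\<close>

lemma lsum_simps [simp]:
  "lsum M f [] = \<zero>\<^bsub>M\<^esub>"
  "lsum M f (x # xs) = f x \<oplus>\<^bsub>M\<^esub> lsum M f xs"
  by (simp_all add: lsum_def)

lemma lsum_map: "lsum M f (map g xs) = lsum M (\<lambda>x. f (g x)) xs"
  by (induction xs) auto

lemma lsum_cong:
  "(\<And>x. x \<in> set xs \<Longrightarrow> f x = g x) \<Longrightarrow> lsum M f xs = lsum M g xs"
  by (induction xs) auto

lemma lsum_closed:
  assumes "abelian_group M" and "\<And>x. x \<in> set xs \<Longrightarrow> f x \<in> carrier M"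
  shows "lsum M f xs \<in> carrier M"
proof -
  interpret abelian_group M by fact
  show ?thesis using assms(2) by (induction xs) auto
qed

lemma lsum_append:
  assumes "abelian_group M" and "\<And>x. x \<in> set xs \<Longrightarrow> f x \<in> carrier M"
    and "\<And>x. x \<in> set ys \<Longrightarrow> f x \<in> carrier M"
  shows "lsum M f (xs @ ys) = lsum M f xs \<oplus>\<^bsub>M\<^esub> lsum M f ys"
proof -
  interpret abelian_group M by fact
  show ?thesis
    using assms(2,3) by (induction xs) (auto simp: a_assoc lsum_closed[OF assms(1)])
qed

lemma lsum_plus:
  assumes "abelian_group N" and "\<And>x. x \<in> set xs \<Longrightarrow> f x \<in> carrier N" and "\<And>x. x \<in> set xs \<Longrightarrow> g x \<in> carrier N"
  shows "lsum N (\<lambda>x. f x \<oplus>\<^bsub>N\<^esub> g x) xs = lsum N f xs \<oplus>\<^bsub>N\<^esub> lsum N g xs"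
proof -
  interpret N: abelian_group N by fact
  show ?thesis
    using assms(2,3)
  proof (induction xs)
    case (Cons x xs)
    then show ?case
      using lsum_closed[OF assms(1), of xs f] lsum_closed[OF assms(1), of xs g] by (simp add: N.a_ac)
  qed simp
qed

lemma additive_maps_lsum:
  assumes "abelian_group M" and "abelian_group N" and "h \<in> additive_maps M N"
    and "\<And>x. x \<in> set xs \<Longrightarrow> f x \<in> carrier M"
  shows "h (lsum M f xs) = lsum N (\<lambda>x. h (f x)) xs"
  using assms(4)
  by (induction xs)
    (auto simp: additive_maps_zero[OF assms(1-3)] additive_maps_add[OF assms(3)] lsum_closed[OF assms(1)])

section \<open>Left modules and submodules\<close>

lemma left_module_abelian_group: "left_module R M \<Longrightarrow> abelian_group M"
  by (simp add: left_module_def)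

lemma left_module_ring: "left_module R M \<Longrightarrow> ring R"
  by (simp add: left_module_def)

lemma left_moduleI:
  assumes "ring R" and "abelian_group M"
    and "\<And>a x. \<lbrakk>a \<in> carrier R; x \<in> carrier M\<rbrakk> \<Longrightarrow> a \<odot>\<^bsub>M\<^esub> x \<in> carrier M"
    and "\<And>a b x. \<lbrakk>a \<in> carrier R; b \<in> carrier R; x \<in> carrier M\<rbrakk> \<Longrightarrow>
        (a \<oplus>\<^bsub>R\<^esub> b) \<odot>\<^bsub>M\<^esub> x = a \<odot>\<^bsub>M\<^esub> x \<oplus>\<^bsub>M\<^esub> b \<odot>\<^bsub>M\<^esub> x"
    and "\<And>a x y. \<lbrakk>a \<in> carrier R; x \<in> carrier M; y \<in> carrier M\<rbrakk> \<Longrightarrow>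
        a \<odot>\<^bsub>M\<^esub> (x \<oplus>\<^bsub>M\<^esub> y) = a \<odot>\<^bsub>M\<^esub> x \<oplus>\<^bsub>M\<^esub> a \<odot>\<^bsub>M\<^esub> y"
    and "\<And>a b x. \<lbrakk>a \<in> carrier R; b \<in> carrier R; x \<in> carrier M\<rbrakk> \<Longrightarrow>
        (a \<otimes>\<^bsub>R\<^esub> b) \<odot>\<^bsub>M\<^esub> x = a \<odot>\<^bsub>M\<^esub> (b \<odot>\<^bsub>M\<^esub> x)"
    and "\<And>x. x \<in> carrier M \<Longrightarrow> \<one>\<^bsub>R\<^esub> \<odot>\<^bsub>M\<^esub> x = x"
  shows "left_module R M"
  using assms by (simp add: left_module_def left_module_axioms_def)

lemma left_module_smult_additive:
  assumes "left_module R M" and "a \<in> carrier R"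
  shows "(\<lambda>x. a \<odot>\<^bsub>M\<^esub> x) \<in> additive_maps M M"
  using assms by (auto intro!: additive_mapsI simp: left_module.lsmult_closed left_module.lsmult_r_distr)

lemma left_module_smult_zero:
  assumes "left_module R M" and "a \<in> carrier R"
  shows "a \<odot>\<^bsub>M\<^esub> \<zero>\<^bsub>M\<^esub> = \<zero>\<^bsub>M\<^esub>"
  using left_module_smult_additive[OF assms] left_module_abelian_group[OF assms(1)]
    additive_maps_zero by blast

lemma left_module_zero_smult:
  assumes "left_module R M" and "x \<in> carrier M"
  shows "\<zero>\<^bsub>R\<^esub> \<odot>\<^bsub>M\<^esub> x = \<zero>\<^bsub>M\<^esub>"
proof -
  interpret left_module R M by fact
  have "(\<lambda>a. a \<odot>\<^bsub>M\<^esub> x) \<in> additive_maps R M"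
    using assms(2) by (auto intro!: additive_mapsI simp: lsmult_closed lsmult_l_distr)
  then show ?thesis
    using additive_maps_zero R.is_abelian_group left_module_abelian_group[OF assms(1)] by blast
qed

lemma left_module_minus_one_smult:
  assumes "left_module R M" and "x \<in> carrier M"
  shows "(\<ominus>\<^bsub>R\<^esub> \<one>\<^bsub>R\<^esub>) \<odot>\<^bsub>M\<^esub> x = \<ominus>\<^bsub>M\<^esub> x"
proof -
  interpret left_module R M by fact
  have "(\<lambda>a. a \<odot>\<^bsub>M\<^esub> x) \<in> additive_maps R M"
    using assms(2) by (auto intro!: additive_mapsI simp: lsmult_closed lsmult_l_distr)
  then show ?thesis
    using additive_maps_minus[OF R.is_abelian_group left_module_abelian_group[OF assms(1)]] assms(2) lsmult_one
    by (metis R.one_closed)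
qed

text \<open>Closure under negation is automatic because negation is the action of \<open>- 1\<close>.\<close>

lemma left_module_restrict_carrier:
  assumes "left_module R M" and "H \<subseteq> carrier M" and "\<zero>\<^bsub>M\<^esub> \<in> H"
    and "\<And>x y. \<lbrakk>x \<in> H; y \<in> H\<rbrakk> \<Longrightarrow> x \<oplus>\<^bsub>M\<^esub> y \<in> H"
    and "\<And>a x. \<lbrakk>a \<in> carrier R; x \<in> H\<rbrakk> \<Longrightarrow> a \<odot>\<^bsub>M\<^esub> x \<in> H"
  shows "left_module R (M\<lparr>carrier := H\<rparr>)"
proof -
  interpret left_module R M by fact
  show ?thesis
  proof (rule left_moduleI)
    show "abelian_group (M\<lparr>carrier := H\<rparr>)"
    proof (rule abelian_groupI)
      fix x assume "x \<in> carrier (M\<lparr>carrier := H\<rparr>)"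
      then have x: "x \<in> H" by simp
      then have "(\<ominus>\<^bsub>R\<^esub> \<one>\<^bsub>R\<^esub>) \<odot>\<^bsub>M\<^esub> x \<in> H"
        by (intro assms(5)) auto
      then have "\<ominus>\<^bsub>M\<^esub> x \<in> H"
        using left_module_minus_one_smult[OF assms(1)] x assms(2) by auto
      then show "\<exists>y\<in>carrier (M\<lparr>carrier := H\<rparr>). y \<oplus>\<^bsub>M\<lparr>carrier := H\<rparr>\<^esub> x = \<zero>\<^bsub>M\<lparr>carrier := H\<rparr>\<^esub>"
        using x assms(2) M.l_neg by auto
    qed (use assms(2-4) in \<open>auto simp: subset_iff M.a_ac\<close>)
    show "ring R" by (rule left_module_ring[OF assms(1)])
  qed (use assms(2,5) in \<open>simp_all add: subset_iff lsmult_l_distr lsmult_r_distr lsmult_assoc lsmult_one\<close>)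
qed

section \<open>Cosets in modules\<close>

text \<open>The scalar action on a coset is a union over its members; these differ by elements of
  \<open>H\<close>, so all the cosets in that union coincide. That \<open>H\<close> is a submodule
  is expressed by its restricted record being a left module; closure under negation then comes from
  the action of \<open>- 1\<close>.\<close>

lemma
  assumes "left_module R M" and "left_module R (M\<lparr>carrier := H\<rparr>)" and "H \<subseteq> carrier M"
  shows coset_self: "x \<in> carrier M \<Longrightarrow> x \<in> H +>\<^bsub>M\<^esub> x"
    and coset_memD: "y \<in> H +>\<^bsub>M\<^esub> x \<Longrightarrow> \<exists>h\<in>H. y = h \<oplus>\<^bsub>M\<^esub> x"
    and coset_eq: "\<lbrakk>x \<in> carrier M; h \<in> H\<rbrakk> \<Longrightarrow> H +>\<^bsub>M\<^esub> (h \<oplus>\<^bsub>M\<^esub> x) = H +>\<^bsub>M\<^esub> x"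
    and coset_add: "\<lbrakk>x \<in> carrier M; y \<in> carrier M\<rbrakk> \<Longrightarrow>
        (H +>\<^bsub>M\<^esub> x) \<oplus>\<^bsub>quot_module M H\<^esub> (H +>\<^bsub>M\<^esub> y) = H +>\<^bsub>M\<^esub> (x \<oplus>\<^bsub>M\<^esub> y)"
    and coset_smult: "\<lbrakk>a \<in> carrier R; x \<in> carrier M\<rbrakk> \<Longrightarrow>
        a \<odot>\<^bsub>quot_module M H\<^esub> (H +>\<^bsub>M\<^esub> x) = H +>\<^bsub>M\<^esub> (a \<odot>\<^bsub>M\<^esub> x)"
    and coset_zero: "\<zero>\<^bsub>quot_module M H\<^esub> = H +>\<^bsub>M\<^esub> \<zero>\<^bsub>M\<^esub>"
proof -
  interpret M: left_module R M by fact
  interpret H: left_module R "M\<lparr>carrier := H\<rparr>" by fact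
  have mem: "y \<in> H +>\<^bsub>M\<^esub> x \<longleftrightarrow> (\<exists>h\<in>H. y = h \<oplus>\<^bsub>M\<^esub> x)" for x y
    by (auto simp: a_r_coset_def' )
  have zero: "\<zero>\<^bsub>M\<^esub> \<in> H" and add: "\<And>h k. h \<in> H \<Longrightarrow> k \<in> H \<Longrightarrow> h \<oplus>\<^bsub>M\<^esub> k \<in> H"
    and smult: "\<And>a h. a \<in> carrier R \<Longrightarrow> h \<in> H \<Longrightarrow> a \<odot>\<^bsub>M\<^esub> h \<in> H"
    using H.M.zero_closed H.M.a_closed H.lsmult_closed by auto
  have neg: "\<ominus>\<^bsub>M\<^esub> h \<in> H" if "h \<in> H" for h
  proof -
    have "(\<ominus>\<^bsub>R\<^esub> \<one>\<^bsub>R\<^esub>) \<odot>\<^bsub>M\<^esub> h = \<ominus>\<^bsub>M\<^esub> h"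
      using assms(3) that by (intro left_module_minus_one_smult[OF assms(1)]) auto
    moreover have "(\<ominus>\<^bsub>R\<^esub> \<one>\<^bsub>R\<^esub>) \<odot>\<^bsub>M\<^esub> h \<in> H"
      using that by (intro smult) auto
    ultimately show ?thesis by simp
  qed
  show self: "x \<in> H +>\<^bsub>M\<^esub> x" if "x \<in> carrier M" for x
    unfolding mem using zero that by (intro bexI[of _ "\<zero>\<^bsub>M\<^esub>"]) auto
  show "\<exists>h\<in>H. y = h \<oplus>\<^bsub>M\<^esub> x" if "y \<in> H +>\<^bsub>M\<^esub> x" for x y
    using that mem by blast
  have sub: "H +>\<^bsub>M\<^esub> (h \<oplus>\<^bsub>M\<^esub> x) \<subseteq> H +>\<^bsub>M\<^esub> x" if "x \<in> carrier M" "h \<in> H" for x h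
  proof
    fix y assume "y \<in> H +>\<^bsub>M\<^esub> (h \<oplus>\<^bsub>M\<^esub> x)"
    then obtain k where "k \<in> H" "y = k \<oplus>\<^bsub>M\<^esub> (h \<oplus>\<^bsub>M\<^esub> x)" using mem by blast
    then have "y = (k \<oplus>\<^bsub>M\<^esub> h) \<oplus>\<^bsub>M\<^esub> x" "k \<oplus>\<^bsub>M\<^esub> h \<in> H"
      using that assms(3) add by (auto simp: M.M.a_assoc subset_iff)
    then show "y \<in> H +>\<^bsub>M\<^esub> x" using mem by blast
  qed
  show eq: "H +>\<^bsub>M\<^esub> (h \<oplus>\<^bsub>M\<^esub> x) = H +>\<^bsub>M\<^esub> x" if "x \<in> carrier M" "h \<in> H" for x h
  proof
    have "x = \<ominus>\<^bsub>M\<^esub> h \<oplus>\<^bsub>M\<^esub> (h \<oplus>\<^bsub>M\<^esub> x)"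
      using that assms(3) by (metis M.M.r_neg1 subsetD)
    then show "H +>\<^bsub>M\<^esub> x \<subseteq> H +>\<^bsub>M\<^esub> (h \<oplus>\<^bsub>M\<^esub> x)"
      using sub[of "h \<oplus>\<^bsub>M\<^esub> x" "\<ominus>\<^bsub>M\<^esub> h"] that assms(3) neg by (auto simp: subset_iff)
  qed (use that sub in auto)
  show "(H +>\<^bsub>M\<^esub> x) \<oplus>\<^bsub>quot_module M H\<^esub> (H +>\<^bsub>M\<^esub> y) = H +>\<^bsub>M\<^esub> (x \<oplus>\<^bsub>M\<^esub> y)"
    if "x \<in> carrier M" "y \<in> carrier M" for x y
  proof -
    have set_add: "z \<in> set_add M X Y \<longleftrightarrow> (\<exists>p\<in>X. \<exists>q\<in>Y. z = p \<oplus>\<^bsub>M\<^esub> q)" for X Y z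
      by (auto simp: set_add_def set_mult_def)
    have bex: "(\<exists>p\<in>H +>\<^bsub>M\<^esub> x. P p) \<longleftrightarrow> (\<exists>h\<in>H. P (h \<oplus>\<^bsub>M\<^esub> x))" for P x
      by (force simp: Bex_def mem)
    have "set_add M (H +>\<^bsub>M\<^esub> x) (H +>\<^bsub>M\<^esub> y) = H +>\<^bsub>M\<^esub> (x \<oplus>\<^bsub>M\<^esub> y)"
    proof (rule Set.set_eqI)
      fix z
      have "z \<in> set_add M (H +>\<^bsub>M\<^esub> x) (H +>\<^bsub>M\<^esub> y) \<longleftrightarrow>
          (\<exists>h\<in>H. \<exists>k\<in>H. z = (h \<oplus>\<^bsub>M\<^esub> x) \<oplus>\<^bsub>M\<^esub> (k \<oplus>\<^bsub>M\<^esub> y))"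
        by (simp only: set_add bex)
      also have "\<dots> \<longleftrightarrow> (\<exists>h\<in>H. \<exists>k\<in>H. z = (h \<oplus>\<^bsub>M\<^esub> k) \<oplus>\<^bsub>M\<^esub> (x \<oplus>\<^bsub>M\<^esub> y))"
        using that assms(3) by (intro bex_cong HOL.refl) (auto simp: M.M.a_ac subset_iff)
      also have "\<dots> \<longleftrightarrow> (\<exists>h\<in>H. z = h \<oplus>\<^bsub>M\<^esub> (x \<oplus>\<^bsub>M\<^esub> y))"
      proof
        assume "\<exists>h\<in>H. z = h \<oplus>\<^bsub>M\<^esub> (x \<oplus>\<^bsub>M\<^esub> y)"
        then obtain h where "h \<in> H" "z = (h \<oplus>\<^bsub>M\<^esub> \<zero>\<^bsub>M\<^esub>) \<oplus>\<^bsub>M\<^esub> (x \<oplus>\<^bsub>M\<^esub> y)"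
          using assms(3) by (auto simp: subset_iff)
        then show "\<exists>h\<in>H. \<exists>k\<in>H. z = (h \<oplus>\<^bsub>M\<^esub> k) \<oplus>\<^bsub>M\<^esub> (x \<oplus>\<^bsub>M\<^esub> y)" using zero by blast
      qed (use add in blast)
      finally show "z \<in> set_add M (H +>\<^bsub>M\<^esub> x) (H +>\<^bsub>M\<^esub> y) \<longleftrightarrow> z \<in> H +>\<^bsub>M\<^esub> (x \<oplus>\<^bsub>M\<^esub> y)"
        by (simp add: mem)
    qed
    then show ?thesis by (simp add: quot_module_def)
  qed
  show "a \<odot>\<^bsub>quot_module M H\<^esub> (H +>\<^bsub>M\<^esub> x) = H +>\<^bsub>M\<^esub> (a \<odot>\<^bsub>M\<^esub> x)"
    if "a \<in> carrier R" "x \<in> carrier M" for a x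
  proof -
    have "H +>\<^bsub>M\<^esub> (a \<odot>\<^bsub>M\<^esub> y) = H +>\<^bsub>M\<^esub> (a \<odot>\<^bsub>M\<^esub> x)" if y: "y \<in> H +>\<^bsub>M\<^esub> x" for y
    proof -
      obtain h where h: "h \<in> H" "y = h \<oplus>\<^bsub>M\<^esub> x" using y by (auto simp: mem)
      then have "a \<odot>\<^bsub>M\<^esub> y = a \<odot>\<^bsub>M\<^esub> h \<oplus>\<^bsub>M\<^esub> a \<odot>\<^bsub>M\<^esub> x"
        using \<open>a \<in> carrier R\<close> \<open>x \<in> carrier M\<close> assms(3) by (simp add: M.lsmult_r_distr subset_iff)
      then show ?thesis
        using eq smult h \<open>a \<in> carrier R\<close> \<open>x \<in> carrier M\<close> M.lsmult_closed by auto
    qed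
    then have "(\<Union>y\<in>H +>\<^bsub>M\<^esub> x. H +>\<^bsub>M\<^esub> (a \<odot>\<^bsub>M\<^esub> y)) = (\<Union>y\<in>H +>\<^bsub>M\<^esub> x. H +>\<^bsub>M\<^esub> (a \<odot>\<^bsub>M\<^esub> x))"
      by (rule SUP_cong[OF HOL.refl])
    also have "\<dots> = H +>\<^bsub>M\<^esub> (a \<odot>\<^bsub>M\<^esub> x)"
      using self[OF that(2)] by (simp only: UN_constant) (metis empty_iff)
    finally show ?thesis
      by (simp add: quot_module_def)
  qed
  have "H +>\<^bsub>M\<^esub> \<zero>\<^bsub>M\<^esub> = H"
  proof -
    have "h \<oplus>\<^bsub>M\<^esub> \<zero>\<^bsub>M\<^esub> = h" if "h \<in> H" for h
      using that assms(3) by auto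
    then show ?thesis
      by (auto simp: a_r_coset_def')
  qed
  then show "\<zero>\<^bsub>quot_module M H\<^esub> = H +>\<^bsub>M\<^esub> \<zero>\<^bsub>M\<^esub>"
    by (simp add: quot_module_def)
qed

lemma carrier_quot_module: "carrier (quot_module M H) = (\<lambda>x. H +>\<^bsub>M\<^esub> x) ` carrier M"
  by (auto simp: quot_module_def A_RCOSETS_def' a_r_coset_def')

section \<open>Exterior algebras\<close>

context exterior_algebra
begin

abbreviation "G n \<equiv> grade \<Omega> n"

lemma carrier_forms [simp]: "carrier (forms \<Omega> n) = G n"
  and mult_forms [simp]: "mult (forms \<Omega> n) = mult \<Omega>"
  and one_forms [simp]: "one (forms \<Omega> n) = one \<Omega>"
  and zero_forms [simp]: "zero (forms \<Omega> n) = zero \<Omega>"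
  and add_forms [simp]: "add (forms \<Omega> n) = add \<Omega>"
  by (simp_all add: forms_def)

lemma grade_subset: "G n \<subseteq> carrier \<Omega>"
  using grade_submodule[of n] by (simp add: submodule_def submodule_axioms_def subgroup_def)

lemma grade_carrier [simp]: "w \<in> G n \<Longrightarrow> w \<in> carrier \<Omega>"
  using grade_subset by blast

lemma grade_add [simp]: "\<lbrakk>v \<in> G n; w \<in> G n\<rbrakk> \<Longrightarrow> v \<oplus>\<^bsub>\<Omega>\<^esub> w \<in> G n"
  using submodule.axioms(1)[OF grade_submodule[of n]] subgroup.m_closed by fastforce

lemma grade_zero [simp]: "\<zero>\<^bsub>\<Omega>\<^esub> \<in> G n"
  using submodule.axioms(1)[OF grade_submodule[of n]] subgroup.one_closed by fastforce

lemma grade_minus [simp]: "w \<in> G n \<Longrightarrow> \<ominus>\<^bsub>\<Omega>\<^esub> w \<in> G n"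
  using subgroup.m_inv_closed[OF submodule.axioms(1)[OF grade_submodule[of n]]] by (simp add: a_inv_def)

lemma grade_smult [simp]: "\<lbrakk>c \<in> carrier K; w \<in> G n\<rbrakk> \<Longrightarrow> c \<odot>\<^bsub>\<Omega>\<^esub> w \<in> G n"
  using submodule.smult_closed[OF grade_submodule[of n]] by blast

lemma grade_one [simp]: "\<one>\<^bsub>\<Omega>\<^esub> \<in> G 0"
  by (rule one_grade)

lemma grade_mult_left [simp]: "\<lbrakk>a \<in> G 0; w \<in> G n\<rbrakk> \<Longrightarrow> a \<otimes>\<^bsub>\<Omega>\<^esub> w \<in> G n"
  using mult_grade[of a 0 w n] by simp

lemma grade_mult_right [simp]: "\<lbrakk>w \<in> G n; a \<in> G 0\<rbrakk> \<Longrightarrow> w \<otimes>\<^bsub>\<Omega>\<^esub> a \<in> G n"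
  using mult_grade[of w n a 0] by simp

lemma deriv_one_form [simp]: "a \<in> G 0 \<Longrightarrow> deriv \<Omega> a \<in> G (Suc 0)"
  using deriv_grade[of a 0] by simp

lemma deriv_two_form [simp]: "w \<in> G (Suc 0) \<Longrightarrow> deriv \<Omega> w \<in> G 2"
  using deriv_grade[of w 1] by (simp add: numeral_2_eq_2)

lemma deriv_carrier [simp]: "w \<in> carrier \<Omega> \<Longrightarrow> deriv \<Omega> w \<in> carrier \<Omega>"
  by (rule mod_hom_closed[OF deriv_linear])

lemma wedge_one_forms [simp]: "\<lbrakk>v \<in> G (Suc 0); w \<in> G (Suc 0)\<rbrakk> \<Longrightarrow> v \<otimes>\<^bsub>\<Omega>\<^esub> w \<in> G 2"
  using mult_grade[of v 1 w 1] by (simp add: numeral_2_eq_2)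

lemma ring_alg: "ring (alg \<Omega>)"
proof (rule ringI)
  show "abelian_group (alg \<Omega>)"
  proof (rule abelian_groupI)
    show "\<exists>y\<in>carrier (alg \<Omega>). y \<oplus>\<^bsub>alg \<Omega>\<^esub> x = \<zero>\<^bsub>alg \<Omega>\<^esub>" if "x \<in> carrier (alg \<Omega>)" for x
      using that by (intro bexI[of _ "\<ominus>\<^bsub>\<Omega>\<^esub> x"]) (simp_all add: Mod.M.l_neg)
  qed (simp_all add: Mod.M.a_ac)
  show "monoid (alg \<Omega>)"
    by (rule monoidI) (auto simp: Alg.m_assoc)
qed (auto simp: Alg.l_distr Alg.r_distr)

lemma deriv_add: "\<lbrakk>v \<in> G n; w \<in> G n\<rbrakk> \<Longrightarrow> deriv \<Omega> (v \<oplus>\<^bsub>\<Omega>\<^esub> w) = deriv \<Omega> v \<oplus>\<^bsub>\<Omega>\<^esub> deriv \<Omega> w"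
  by (rule mod_hom_add[OF deriv_linear]) simp_all

lemma deriv_zero: "deriv \<Omega> \<zero>\<^bsub>\<Omega>\<^esub> = \<zero>\<^bsub>\<Omega>\<^esub>"
  by (rule additive_maps_zero[OF Mod.M.abelian_group_axioms Mod.M.abelian_group_axioms mod_hom_additive[OF deriv_linear]])

lemma deriv_smult: "\<lbrakk>c \<in> carrier K; w \<in> G n\<rbrakk> \<Longrightarrow> deriv \<Omega> (c \<odot>\<^bsub>\<Omega>\<^esub> w) = c \<odot>\<^bsub>\<Omega>\<^esub> deriv \<Omega> w"
  by (rule mod_hom_smult[OF deriv_linear]) simp_all

lemma deriv_mult:
  "\<lbrakk>a \<in> G 0; w \<in> G n\<rbrakk> \<Longrightarrow>
    deriv \<Omega> (a \<otimes>\<^bsub>\<Omega>\<^esub> w) = deriv \<Omega> a \<otimes>\<^bsub>\<Omega>\<^esub> w \<oplus>\<^bsub>\<Omega>\<^esub> a \<otimes>\<^bsub>\<Omega>\<^esub> deriv \<Omega> w"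
  using graded_Leibniz[of a 0 w] by simp

lemma deriv_one_form_mult:
  "\<lbrakk>w \<in> G (Suc 0); a \<in> G 0\<rbrakk> \<Longrightarrow>
    deriv \<Omega> (w \<otimes>\<^bsub>\<Omega>\<^esub> a) = deriv \<Omega> w \<otimes>\<^bsub>\<Omega>\<^esub> a \<ominus>\<^bsub>\<Omega>\<^esub> w \<otimes>\<^bsub>\<Omega>\<^esub> deriv \<Omega> a"
  using graded_Leibniz[of w 1 a] by (simp add: a_minus_def)

text \<open>The Leibniz rule for \<open>1 = 1 1\<close> gives \<open>d1 = d1 + d1\<close>.\<close>

lemma deriv_one: "deriv \<Omega> \<one>\<^bsub>\<Omega>\<^esub> = \<zero>\<^bsub>\<Omega>\<^esub>"
proof -
  have d: "deriv \<Omega> \<one>\<^bsub>\<Omega>\<^esub> \<in> carrier \<Omega>"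
    by simp
  then have "deriv \<Omega> \<one>\<^bsub>\<Omega>\<^esub> = deriv \<Omega> \<one>\<^bsub>\<Omega>\<^esub> \<oplus>\<^bsub>\<Omega>\<^esub> deriv \<Omega> \<one>\<^bsub>\<Omega>\<^esub>"
    using deriv_mult[OF grade_one grade_one] by simp
  then show ?thesis
    using d by (metis Mod.M.add.r_cancel_one')
qed

text \<open>Scalars act on either side as multiplication by \<open>c 1\<close>, which is therefore
  central, and closed by \<open>deriv_smult_one\<close>. This makes maps involving
  \<open>deriv\<close> balanced over \<open>K\<close> and prolongations
  \<open>K\<close>-linear.\<close>

lemma smult_one_mult: "\<lbrakk>c \<in> carrier K; w \<in> carrier \<Omega>\<rbrakk> \<Longrightarrow> c \<odot>\<^bsub>\<Omega>\<^esub> w = (c \<odot>\<^bsub>\<Omega>\<^esub> \<one>\<^bsub>\<Omega>\<^esub>) \<otimes>\<^bsub>\<Omega>\<^esub> w"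
  by (metis Alg.l_one Alg.one_closed smult_mult_left)

lemma smult_mult_one: "\<lbrakk>c \<in> carrier K; w \<in> carrier \<Omega>\<rbrakk> \<Longrightarrow> c \<odot>\<^bsub>\<Omega>\<^esub> w = w \<otimes>\<^bsub>\<Omega>\<^esub> (c \<odot>\<^bsub>\<Omega>\<^esub> \<one>\<^bsub>\<Omega>\<^esub>)"
  by (metis Alg.r_one Alg.one_closed smult_mult_right)

lemma deriv_smult_one: "c \<in> carrier K \<Longrightarrow> deriv \<Omega> (c \<odot>\<^bsub>\<Omega>\<^esub> \<one>\<^bsub>\<Omega>\<^esub>) = \<zero>\<^bsub>\<Omega>\<^esub>"
  by (simp add: deriv_smult[of _ _ 0] deriv_one)

text \<open>The generators of degree 1 are the products \<open>a db\<close>, and the negative of one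
  is again one, \<open>(- a) db\<close>; so the group that they generate is reached by sums
  alone.\<close>

lemma one_form_induct [consumes 1, case_names zero exact add]:
  assumes "w \<in> G 1" and "P \<zero>\<^bsub>\<Omega>\<^esub>"
    and exact: "\<And>a b. \<lbrakk>a \<in> G 0; b \<in> G 0\<rbrakk> \<Longrightarrow> P (a \<otimes>\<^bsub>\<Omega>\<^esub> deriv \<Omega> b)"
    and "\<And>v w. \<lbrakk>v \<in> G 1; w \<in> G 1; P v; P w\<rbrakk> \<Longrightarrow> P (v \<oplus>\<^bsub>\<Omega>\<^esub> w)"
  shows "P w"
proof -
  let ?S = "{a \<otimes>\<^bsub>\<Omega>\<^esub> foldr (\<lambda>b w. deriv \<Omega> b \<otimes>\<^bsub>\<Omega>\<^esub> w) bs \<one>\<^bsub>\<Omega>\<^esub> |a bs.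
           a \<in> G 0 \<and> set bs \<subseteq> G 0 \<and> length bs = 1}"
  have S: "\<exists>a\<in>G 0. \<exists>b\<in>G 0. v = a \<otimes>\<^bsub>\<Omega>\<^esub> deriv \<Omega> b" if "v \<in> ?S" for v
  proof -
    from that obtain a b where "a \<in> G 0" "b \<in> G 0" "v = a \<otimes>\<^bsub>\<Omega>\<^esub> (deriv \<Omega> b \<otimes>\<^bsub>\<Omega>\<^esub> \<one>\<^bsub>\<Omega>\<^esub>)"
      by (auto simp: length_Suc_conv)
    moreover from this have "v = a \<otimes>\<^bsub>\<Omega>\<^esub> deriv \<Omega> b"
      by simp
    ultimately show ?thesis by blast
  qed
  have "w \<in> generate (add_monoid \<Omega>) ?S"
    using assms(1) generated[of 1] by simp
  then have "P w \<and> w \<in> G 1"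
  proof induction
    case one
    then show ?case using assms(2) by simp
  next
    case (incl h)
    then obtain a b where "a \<in> G 0" "b \<in> G 0" "h = a \<otimes>\<^bsub>\<Omega>\<^esub> deriv \<Omega> b"
      using S by blast
    then show ?case using exact by simp
  next
    case (inv h)
    then obtain a b where ab: "a \<in> G 0" "b \<in> G 0" "h = a \<otimes>\<^bsub>\<Omega>\<^esub> deriv \<Omega> b"
      using S by blast
    then have "\<ominus>\<^bsub>\<Omega>\<^esub> h = (\<ominus>\<^bsub>\<Omega>\<^esub> a) \<otimes>\<^bsub>\<Omega>\<^esub> deriv \<Omega> b"
      by (simp add: Alg.l_minus)
    then have "P (\<ominus>\<^bsub>\<Omega>\<^esub> h)" "\<ominus>\<^bsub>\<Omega>\<^esub> h \<in> G 1"
      using ab exact[of "\<ominus>\<^bsub>\<Omega>\<^esub> a" b] by simp_all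
    then show ?case by (simp add: a_inv_def)
  next
    case (eng v w)
    then show ?case using assms(4) by simp
  qed
  then show ?thesis ..
qed

end

section \<open>Modules of formal sums\<close>

text \<open>
  The common shape of \<^const>\<open>tensor\<close> and \<^const>\<open>jet1\<close>: a module whose elements are encoded classes of
  formal sums under a congruence \<open>Q\<close>.
\<close>

locale formal_sums = exterior_algebra K \<Omega> for K :: "'k ring" and \<Omega> :: "('k, 'w) dga" +
  fixes n :: nat and D :: "('w, 'e) univ set"
    and Q :: "('w \<times> ('w, 'e) univ) list \<Rightarrow> ('w \<times> ('w, 'e) univ) list \<Rightarrow> bool"
    and cls :: "('w \<times> ('w, 'e) univ) list \<Rightarrow> ('w, 'e) univ"
    and M :: "('w, ('w, 'e) univ) module"
  assumes Q_valid: "Q ts us \<Longrightarrow> set ts \<subseteq> G n \<times> D \<and> set us \<subseteq> G n \<times> D"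
    and Q_refl: "set ts \<subseteq> G n \<times> D \<Longrightarrow> Q ts ts"
    and Q_sym: "Q ts us \<Longrightarrow> Q us ts"
    and Q_trans: "Q ts us \<Longrightarrow> Q us vs \<Longrightarrow> Q ts vs"
    and Q_append: "Q ts ts' \<Longrightarrow> Q us us' \<Longrightarrow> Q (ts @ us) (ts' @ us')"
    and Q_commute: "set ts \<subseteq> G n \<times> D \<Longrightarrow> set us \<subseteq> G n \<times> D \<Longrightarrow> Q (ts @ us) (us @ ts)"
    and Q_zero: "m \<in> D \<Longrightarrow> Q [(\<zero>\<^bsub>\<Omega>\<^esub>, m)] []"
    and Q_add: "v \<in> G n \<Longrightarrow> w \<in> G n \<Longrightarrow> m \<in> D \<Longrightarrow> Q [(v \<oplus>\<^bsub>\<Omega>\<^esub> w, m)] [(v, m), (w, m)]"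
    and Q_action: "a \<in> G 0 \<Longrightarrow> Q ts us \<Longrightarrow> Q (map (apfst (\<lambda>x. a \<otimes>\<^bsub>\<Omega>\<^esub> x)) ts) (map (apfst (\<lambda>x. a \<otimes>\<^bsub>\<Omega>\<^esub> x)) us)"
    and Q_rep: "set ts \<subseteq> G n \<times> D \<Longrightarrow> Q ts (summands (cls ts))"
    and Q_cls: "Q ts us \<Longrightarrow> cls ts = cls us"
    and carrier_M: "carrier M = {cls ts |ts. set ts \<subseteq> G n \<times> D}"
    and zero_M: "zero M = cls []"
    and add_M: "add M = (\<lambda>t u. cls (summands t @ summands u))"
    and smult_M: "smult M = (\<lambda>a t. cls (map (apfst (\<lambda>x. a \<otimes>\<^bsub>\<Omega>\<^esub> x)) (summands t)))"
begin

lemma cls_eq_iff: "\<lbrakk>set ts \<subseteq> G n \<times> D; set us \<subseteq> G n \<times> D\<rbrakk> \<Longrightarrow> cls ts = cls us \<longleftrightarrow> Q ts us"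
  by (metis Q_cls Q_rep Q_sym Q_trans)

lemma cls_closed: "set ts \<subseteq> G n \<times> D \<Longrightarrow> cls ts \<in> carrier M"
  by (auto simp: carrier_M)

lemma summands_valid: "t \<in> carrier M \<Longrightarrow> set (summands t) \<subseteq> G n \<times> D"
  using Q_rep Q_valid by (fastforce simp: carrier_M)

lemma cls_summands: "t \<in> carrier M \<Longrightarrow> cls (summands t) = t"
  by (auto simp: carrier_M dest!: Q_rep Q_cls)

lemma cls_append:
  "\<lbrakk>set ts \<subseteq> G n \<times> D; set us \<subseteq> G n \<times> D\<rbrakk> \<Longrightarrow> cls ts \<oplus>\<^bsub>M\<^esub> cls us = cls (ts @ us)"
  unfolding add_M by (intro Q_cls Q_append Q_sym[OF Q_rep])

lemma set_action: "\<lbrakk>a \<in> G 0; set ts \<subseteq> G n \<times> D\<rbrakk> \<Longrightarrow> set (map (apfst (\<lambda>x. a \<otimes>\<^bsub>\<Omega>\<^esub> x)) ts) \<subseteq> G n \<times> D"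
  by (auto simp: apfst_def)

lemma smult_cls:
  "\<lbrakk>a \<in> G 0; set ts \<subseteq> G n \<times> D\<rbrakk> \<Longrightarrow> a \<odot>\<^bsub>M\<^esub> cls ts = cls (map (apfst (\<lambda>x. a \<otimes>\<^bsub>\<Omega>\<^esub> x)) ts)"
  unfolding smult_M by (intro Q_cls Q_action Q_sym[OF Q_rep])

text \<open>Inverses in the quotient come from here, although the rules for \<open>Q\<close> mention
  no negation. A pair \<open>(- w, m), (w, m)\<close> merges to \<open>(0, m)\<close> by
  \<open>Q_add\<close> and disappears by \<open>Q_zero\<close>; commutation moves the head
  \<open>(w, m)\<close> past the negated tail so that the pairs become adjacent.\<close>

lemma Q_action_minus:
  "set ts \<subseteq> G n \<times> D \<Longrightarrow> Q (map (apfst (\<lambda>x. \<ominus>\<^bsub>\<Omega>\<^esub> x)) ts @ ts) []"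
proof (induction ts)
  case Nil
  then show ?case using Q_refl by simp
next
  case (Cons p ts)
  obtain w m where p: "p = (w, m)" "w \<in> G n" "m \<in> D" using Cons.prems by (cases p) auto
  let ?N = "map (apfst (\<lambda>x. \<ominus>\<^bsub>\<Omega>\<^esub> x)) ts"
  have N: "set ?N \<subseteq> G n \<times> D" using Cons.prems by (auto simp: apfst_def)
  have "Q [(\<ominus>\<^bsub>\<Omega>\<^esub> w, m), (w, m)] []"
    using Q_trans[OF Q_sym[OF Q_add[of "\<ominus>\<^bsub>\<Omega>\<^esub> w" w m]], of "[]"] Q_zero[of m] p
    by (simp add: Mod.M.l_neg)
  then have 1: "Q ([(\<ominus>\<^bsub>\<Omega>\<^esub> w, m), (w, m)] @ (?N @ ts)) ([] @ [])"
    using Cons by (intro Q_append) auto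
  have "Q ([(\<ominus>\<^bsub>\<Omega>\<^esub> w, m)] @ (?N @ [(w, m)] @ ts)) ([(\<ominus>\<^bsub>\<Omega>\<^esub> w, m)] @ ([(w, m)] @ ?N @ ts))"
    using Q_append[OF Q_commute[OF N, of "[(w, m)]"] Q_refl[of ts]] Cons.prems p
    by (intro Q_append[OF Q_refl]) auto
  then show ?case
    using 1 Q_trans by (simp add: p)
qed

text \<open>Distributivity over the ring sum follows entry by entry from \<open>Q_add\<close>;
  commutation is needed because the right-hand side lists all \<open>a\<close>-terms before all
  \<open>b\<close>-terms.\<close>

lemma Q_action_add:
  assumes "a \<in> G 0" "b \<in> G 0"
  shows "set ts \<subseteq> G n \<times> D \<Longrightarrow> Q (map (apfst (\<lambda>x. (a \<oplus>\<^bsub>\<Omega>\<^esub> b) \<otimes>\<^bsub>\<Omega>\<^esub> x)) ts)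
    (map (apfst (\<lambda>x. a \<otimes>\<^bsub>\<Omega>\<^esub> x)) ts @ map (apfst (\<lambda>x. b \<otimes>\<^bsub>\<Omega>\<^esub> x)) ts)"
proof (induction ts)
  case Nil
  then show ?case using Q_refl by simp
next
  case (Cons p ts)
  obtain w m where p: "p = (w, m)" "w \<in> G n" "m \<in> D" using Cons.prems by (cases p) auto
  let ?A = "map (apfst (\<lambda>x. a \<otimes>\<^bsub>\<Omega>\<^esub> x)) ts" and ?B = "map (apfst (\<lambda>x. b \<otimes>\<^bsub>\<Omega>\<^esub> x)) ts"
  have AB: "set ?A \<subseteq> G n \<times> D" "set ?B \<subseteq> G n \<times> D"
    using Cons.prems assms set_action by auto
  have "Q [((a \<oplus>\<^bsub>\<Omega>\<^esub> b) \<otimes>\<^bsub>\<Omega>\<^esub> w, m)] ([(a \<otimes>\<^bsub>\<Omega>\<^esub> w, m), (b \<otimes>\<^bsub>\<Omega>\<^esub> w, m)])"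
    using Q_add[of "a \<otimes>\<^bsub>\<Omega>\<^esub> w" "b \<otimes>\<^bsub>\<Omega>\<^esub> w" m] p assms by (simp add: Alg.l_distr)
  then have 1: "Q ([((a \<oplus>\<^bsub>\<Omega>\<^esub> b) \<otimes>\<^bsub>\<Omega>\<^esub> w, m)] @ map (apfst (\<lambda>x. (a \<oplus>\<^bsub>\<Omega>\<^esub> b) \<otimes>\<^bsub>\<Omega>\<^esub> x)) ts)
      ([(a \<otimes>\<^bsub>\<Omega>\<^esub> w, m), (b \<otimes>\<^bsub>\<Omega>\<^esub> w, m)] @ (?A @ ?B))"
    using Cons by (intro Q_append) auto
  have "Q ([(a \<otimes>\<^bsub>\<Omega>\<^esub> w, m)] @ (([(b \<otimes>\<^bsub>\<Omega>\<^esub> w, m)] @ ?A) @ ?B)) ([(a \<otimes>\<^bsub>\<Omega>\<^esub> w, m)] @ ((?A @ [(b \<otimes>\<^bsub>\<Omega>\<^esub> w, m)]) @ ?B))"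
    using AB p assms by (intro Q_append Q_refl Q_commute) auto
  then show ?case
    using Q_trans[OF 1] by (simp add: p)
qed

lemma abelian_group_M: "abelian_group M"
proof (rule abelian_groupI)
  fix x y assume "x \<in> carrier M" "y \<in> carrier M"
  then obtain ts us where *: "set ts \<subseteq> G n \<times> D" "set us \<subseteq> G n \<times> D" "x = cls ts" "y = cls us"
    by (auto simp: carrier_M)
  then show "x \<oplus>\<^bsub>M\<^esub> y \<in> carrier M"
    using cls_closed by (simp add: cls_append)
  show "x \<oplus>\<^bsub>M\<^esub> y = y \<oplus>\<^bsub>M\<^esub> x"
    using * Q_cls[OF Q_commute] by (simp add: cls_append)
  fix z assume "z \<in> carrier M"
  then obtain vs where "set vs \<subseteq> G n \<times> D" "z = cls vs"
    by (auto simp: carrier_M)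
  then show "x \<oplus>\<^bsub>M\<^esub> y \<oplus>\<^bsub>M\<^esub> z = x \<oplus>\<^bsub>M\<^esub> (y \<oplus>\<^bsub>M\<^esub> z)"
    using * by (simp add: cls_append)
next
  fix x assume "x \<in> carrier M"
  then obtain ts where ts: "set ts \<subseteq> G n \<times> D" "x = cls ts" by (auto simp: carrier_M)
  then show "\<zero>\<^bsub>M\<^esub> \<oplus>\<^bsub>M\<^esub> x = x"
    by (simp add: zero_M cls_append)
  have "set (map (apfst (\<lambda>x. \<ominus>\<^bsub>\<Omega>\<^esub> x)) ts) \<subseteq> G n \<times> D"
    using ts by (auto simp: apfst_def)
  then show "\<exists>y\<in>carrier M. y \<oplus>\<^bsub>M\<^esub> x = \<zero>\<^bsub>M\<^esub>"
    using ts Q_cls[OF Q_action_minus[OF ts(1)]]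
    by (intro bexI[of _ "cls (map (apfst (\<lambda>x. \<ominus>\<^bsub>\<Omega>\<^esub> x)) ts)"]) (auto simp: cls_append zero_M cls_closed)
qed (use cls_closed[of "[]"] in \<open>simp add: zero_M\<close>)

lemma left_module_M: "left_module (alg \<Omega>) M"
proof (rule left_moduleI[OF ring_alg abelian_group_M])
  fix a x assume ax: "a \<in> carrier (alg \<Omega>)" "x \<in> carrier M"
  then have a: "a \<in> G 0" by simp
  obtain ts where ts: "set ts \<subseteq> G n \<times> D" "x = cls ts" using ax by (auto simp: carrier_M)
  show "a \<odot>\<^bsub>M\<^esub> x \<in> carrier M"
    using a ts cls_closed[OF set_action] by (simp add: smult_cls)
  { fix y assume "y \<in> carrier M"
    then obtain us where us: "set us \<subseteq> G n \<times> D" "y = cls us" by (auto simp: carrier_M)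
    show "a \<odot>\<^bsub>M\<^esub> (x \<oplus>\<^bsub>M\<^esub> y) = a \<odot>\<^bsub>M\<^esub> x \<oplus>\<^bsub>M\<^esub> a \<odot>\<^bsub>M\<^esub> y"
      using a ts us set_action[OF a ts(1)] set_action[OF a us(1)] by (simp add: smult_cls cls_append) }
  { fix b assume "b \<in> carrier (alg \<Omega>)"
    then have b: "b \<in> G 0" by simp
    show "(a \<oplus>\<^bsub>alg \<Omega>\<^esub> b) \<odot>\<^bsub>M\<^esub> x = a \<odot>\<^bsub>M\<^esub> x \<oplus>\<^bsub>M\<^esub> b \<odot>\<^bsub>M\<^esub> x"
      using a b ts set_action[OF a ts(1)] set_action[OF b ts(1)] Q_cls[OF Q_action_add[OF a b ts(1)]]
      by (simp add: smult_cls cls_append)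
    have "map (apfst (\<lambda>x. (a \<otimes>\<^bsub>\<Omega>\<^esub> b) \<otimes>\<^bsub>\<Omega>\<^esub> x)) ts
        = map (apfst (\<lambda>x. a \<otimes>\<^bsub>\<Omega>\<^esub> x)) (map (apfst (\<lambda>x. b \<otimes>\<^bsub>\<Omega>\<^esub> x)) ts)"
      using a b ts by (auto simp: Alg.m_assoc)
    then show "(a \<otimes>\<^bsub>alg \<Omega>\<^esub> b) \<odot>\<^bsub>M\<^esub> x = a \<odot>\<^bsub>M\<^esub> (b \<odot>\<^bsub>M\<^esub> x)"
      using a b ts set_action[OF b ts(1)] by (simp add: smult_cls del: map_map map_eq_conv) }
next
  fix x assume "x \<in> carrier M"
  then obtain ts where ts: "set ts \<subseteq> G n \<times> D" "x = cls ts" by (auto simp: carrier_M)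
  have "map (apfst (\<lambda>x. \<one>\<^bsub>\<Omega>\<^esub> \<otimes>\<^bsub>\<Omega>\<^esub> x)) ts = ts"
    using ts by (intro map_idI) auto
  then show "\<one>\<^bsub>alg \<Omega>\<^esub> \<odot>\<^bsub>M\<^esub> x = x"
    using ts by (simp add: smult_cls)
qed

lemma cls_lsum: "set ts \<subseteq> G n \<times> D \<Longrightarrow> cls ts = lsum M (\<lambda>p. cls [p]) ts"
proof (induction ts)
  case (Cons p ts)
  then show ?case using cls_append[of "[p]" ts] by simp
qed (simp add: zero_M)

text \<open>Handles the concatenated lists that \<open>flatten\<close> produces in
  \<open>wedge_map\<close>, \<open>D_I\<close> and \<open>D_II\<close>.\<close>

lemma cls_concat:
  "(\<And>ts. ts \<in> set tss \<Longrightarrow> set ts \<subseteq> G n \<times> D) \<Longrightarrow> cls (concat tss) = lsum M cls tss"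
proof (induction tss)
  case (Cons ts tss)
  have "set ts \<subseteq> G n \<times> D" "set (concat tss) \<subseteq> G n \<times> D"
    using Cons.prems by fastforce+
  then show ?case
    using Cons by (simp flip: cls_append)
qed (simp add: zero_M)

lemma additive_cls:
  assumes "abelian_group N" and "f \<in> additive_maps M N" and "set ts \<subseteq> G n \<times> D"
  shows "f (cls ts) = lsum N (\<lambda>p. f (cls [p])) ts"
proof -
  have "cls [p] \<in> carrier M" if "p \<in> set ts" for p
    using that assms(3) by (intro cls_closed) auto
  then show ?thesis
    using additive_maps_lsum[OF abelian_group_M assms(1,2), of ts "\<lambda>p. cls [p]"]
    by (simp add: cls_lsum[OF assms(3)])
qed

text \<open>Uniqueness half of the universal property: the classes of one-term sums generate the
  group. Most identities between maps on forms are reduced to pure tensors in this way.\<close>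

lemma additive_eqI:
  assumes "abelian_group N" and "f \<in> additive_maps M N" and "g \<in> additive_maps M N"
    and "\<And>w m. \<lbrakk>w \<in> G n; m \<in> D\<rbrakk> \<Longrightarrow> f (cls [(w, m)]) = g (cls [(w, m)])"
    and "t \<in> carrier M"
  shows "f t = g t"
proof -
  obtain ts where ts: "set ts \<subseteq> G n \<times> D" "t = cls ts" using assms(5) by (auto simp: carrier_M)
  show ?thesis
    unfolding ts(2) additive_cls[OF assms(1,2) ts(1)] additive_cls[OF assms(1,3) ts(1)]
    using ts(1) assms(4) by (auto intro!: lsum_cong)
qed

text \<open>For fixed \<open>a\<close> both sides of the linearity equation are additive in
  \<open>x\<close>, so it suffices to compare them on one-term sums.\<close>

lemma linearI:
  assumes N: "left_module (alg \<Omega>) N" and f: "f \<in> additive_maps M N"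
    and "\<And>a w m. \<lbrakk>a \<in> G 0; w \<in> G n; m \<in> D\<rbrakk> \<Longrightarrow> f (cls [(a \<otimes>\<^bsub>\<Omega>\<^esub> w, m)]) = a \<odot>\<^bsub>N\<^esub> f (cls [(w, m)])"
  shows "f \<in> mod_hom (alg \<Omega>) M N"
  unfolding mod_hom_iff
proof (intro conjI ballI f)
  fix a x assume a: "a \<in> carrier (alg \<Omega>)" and x: "x \<in> carrier M"
  have "(\<lambda>x. f (a \<odot>\<^bsub>M\<^esub> x)) \<in> additive_maps M N"
    by (rule additive_maps_compose[OF left_module_smult_additive[OF left_module_M a] f])
  moreover have "(\<lambda>x. a \<odot>\<^bsub>N\<^esub> f x) \<in> additive_maps M N"
    by (rule additive_maps_compose[OF f left_module_smult_additive[OF N a]])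
  ultimately show "f (a \<odot>\<^bsub>M\<^esub> x) = a \<odot>\<^bsub>N\<^esub> f x"
    using a x left_module_abelian_group[OF N]
    by (rule_tac additive_eqI[of N "\<lambda>x. f (a \<odot>\<^bsub>M\<^esub> x)" "\<lambda>x. a \<odot>\<^bsub>N\<^esub> f x"])
      (simp_all add: smult_cls assms(3))
qed

text \<open>Existence half of the universal property. The defined maps evaluate the chosen
  representative \<open>summands t\<close>; invariance of the sum under \<open>Q\<close> makes the
  choice immaterial and, as addition concatenates representatives, yields additivity.\<close>

lemma
  assumes N: "abelian_group N" and g: "\<And>w m. \<lbrakk>w \<in> G n; m \<in> D\<rbrakk> \<Longrightarrow> g (w, m) \<in> carrier N"
    and Q: "\<And>ts us. Q ts us \<Longrightarrow> lsum N g ts = lsum N g us"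
  shows lift_cls: "set ts \<subseteq> G n \<times> D \<Longrightarrow> lsum N g (summands (cls ts)) = lsum N g ts"
    and lift_additive: "(\<lambda>t. lsum N g (summands t)) \<in> additive_maps M N"
proof -
  show *: "lsum N g (summands (cls ts)) = lsum N g ts" if "set ts \<subseteq> G n \<times> D" for ts
    using Q[OF Q_rep[OF that]] by simp
  show "(\<lambda>t. lsum N g (summands t)) \<in> additive_maps M N"
  proof (rule additive_mapsI)
    fix x y assume "x \<in> carrier M" "y \<in> carrier M"
    then have xy: "set (summands x) \<subseteq> G n \<times> D" "set (summands y) \<subseteq> G n \<times> D"
      using summands_valid by auto
    then have "lsum N g (summands x @ summands y) = lsum N g (summands x) \<oplus>\<^bsub>N\<^esub> lsum N g (summands y)"
      using g by (intro lsum_append[OF N]) (auto simp: subset_iff)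
    then show "lsum N g (summands (x \<oplus>\<^bsub>M\<^esub> y)) = lsum N g (summands x) \<oplus>\<^bsub>N\<^esub> lsum N g (summands y)"
      using xy *[of "summands x @ summands y"] by (simp add: add_M)
  next
    fix x assume "x \<in> carrier M"
    then show "lsum N g (summands x) \<in> carrier N"
      using summands_valid[of x] g by (intro lsum_closed[OF N]) (auto simp: subset_iff)
  qed
qed

end

text \<open>The analogue for maps that act term by term into another module of formal sums. Apart
  from the domains, only compatibility of the two congruences enters, so it serves for \<delta>,
  where \<open>h\<close> differentiates the coefficients, as well as for the functor on
  forms.\<close>

lemma
  assumes "formal_sums K \<Omega> n D Q cls M" and "formal_sums K \<Omega> n' D' Q' cls' M'"
    and h: "\<And>p. p \<in> grade \<Omega> n \<times> D \<Longrightarrow> h p \<in> grade \<Omega> n' \<times> D'"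
    and Q: "\<And>ts us. Q ts us \<Longrightarrow> Q' (map h ts) (map h us)"
  shows map_summands_cls:
      "set ts \<subseteq> grade \<Omega> n \<times> D \<Longrightarrow> cls' (map h (summands (cls ts))) = cls' (map h ts)"
    and map_summands_additive: "(\<lambda>t. cls' (map h (summands t))) \<in> additive_maps M M'"
proof -
  interpret A: formal_sums K \<Omega> n D Q cls M by fact
  interpret B: formal_sums K \<Omega> n' D' Q' cls' M' by fact
  have valid: "set (map h ts) \<subseteq> A.G n' \<times> D'" if "set ts \<subseteq> A.G n \<times> D" for ts
    using h that by (simp only: set_map image_subset_iff) blast
  show *: "cls' (map h (summands (cls ts))) = cls' (map h ts)" if "set ts \<subseteq> A.G n \<times> D" for ts
    using B.Q_cls[OF Q[OF A.Q_rep[OF that]]] by simp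
  show "(\<lambda>t. cls' (map h (summands t))) \<in> additive_maps M M'"
  proof (rule additive_mapsI)
    fix x y assume "x \<in> carrier M" "y \<in> carrier M"
    then have xy: "set (summands x) \<subseteq> A.G n \<times> D" "set (summands y) \<subseteq> A.G n \<times> D"
      using A.summands_valid by auto
    then have "set (map h (summands x)) \<subseteq> A.G n' \<times> D'" "set (map h (summands y)) \<subseteq> A.G n' \<times> D'"
      by (simp_all only: valid)
    then show "cls' (map h (summands (x \<oplus>\<^bsub>M\<^esub> y)))
        = cls' (map h (summands x)) \<oplus>\<^bsub>M'\<^esub> cls' (map h (summands y))"
      using xy *[of "summands x @ summands y"] by (simp add: A.add_M B.cls_append)
  next
    fix x assume "x \<in> carrier M"
    then show "cls' (map h (summands x)) \<in> carrier M'"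
      by (intro B.cls_closed valid A.summands_valid)
  qed
qed

section \<open>Tensor products\<close>

text \<open>The universal property of the tensor product for a balanced biadditive \<open>g\<close>,
  by induction over the generation of the congruence. \<open>valid\<close> keeps the intermediate
  sums inside the domain, where \<open>lsum\<close> splits over concatenation.\<close>

lemma tensor_eq_lsum:
  assumes "tensor_eq S X \<rho> M ts us" and "abelian_group N"
    and closed: "\<And>x m. \<lbrakk>x \<in> carrier X; m \<in> carrier M\<rbrakk> \<Longrightarrow> g x m \<in> carrier N"
    and zero: "\<And>m. m \<in> carrier M \<Longrightarrow> g \<zero>\<^bsub>X\<^esub> m = \<zero>\<^bsub>N\<^esub>"
    and add_left: "\<And>x y m. \<lbrakk>x \<in> carrier X; y \<in> carrier X; m \<in> carrier M\<rbrakk> \<Longrightarrow>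
      g (x \<oplus>\<^bsub>X\<^esub> y) m = g x m \<oplus>\<^bsub>N\<^esub> g y m"
    and add_right: "\<And>x l m. \<lbrakk>x \<in> carrier X; l \<in> carrier M; m \<in> carrier M\<rbrakk> \<Longrightarrow>
      g x (l \<oplus>\<^bsub>M\<^esub> m) = g x l \<oplus>\<^bsub>N\<^esub> g x m"
    and balanced: "\<And>x s m. \<lbrakk>x \<in> carrier X; s \<in> carrier S; m \<in> carrier M\<rbrakk> \<Longrightarrow>
      g (\<rho> x s) m = g x (s \<odot>\<^bsub>M\<^esub> m)"
    and valid: "\<And>ts us. tensor_eq S X \<rho> M ts us \<Longrightarrow>
      set ts \<subseteq> carrier X \<times> carrier M \<and> set us \<subseteq> carrier X \<times> carrier M"
  shows "lsum N (\<lambda>(x, m). g x m) ts = lsum N (\<lambda>(x, m). g x m) us"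
proof -
  interpret N: abelian_group N by fact
  let ?s = "lsum N (\<lambda>(x, m). g x m)"
  have app: "?s (ts @ us) = ?s ts \<oplus>\<^bsub>N\<^esub> ?s us"
    if "set ts \<subseteq> carrier X \<times> carrier M" "set us \<subseteq> carrier X \<times> carrier M" for ts us
    using that closed by (intro lsum_append[OF assms(2)]) auto
  have cl: "?s ts \<in> carrier N" if "set ts \<subseteq> carrier X \<times> carrier M" for ts
    using that closed by (intro lsum_closed[OF assms(2)]) auto
  show ?thesis
    using assms(1)
  proof induction
    case (append ts ts' us us')
    then show ?case using valid by (metis app)
  next
    case (commute ts us)
    then show ?case by (simp add: app cl N.a_comm)
  qed (use closed zero add_left add_right balanced in auto)
qed

context exterior_algebra
begin

lemma tensor_eq_valid:
  assumes "\<And>x s. \<lbrakk>x \<in> carrier X; s \<in> carrier S\<rbrakk> \<Longrightarrow> \<rho> x s \<in> carrier X"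
    and "\<And>s m. \<lbrakk>s \<in> carrier S; m \<in> carrier M\<rbrakk> \<Longrightarrow> s \<odot>\<^bsub>M\<^esub> m \<in> carrier M"
    and "\<And>x y. \<lbrakk>x \<in> carrier X; y \<in> carrier X\<rbrakk> \<Longrightarrow> x \<oplus>\<^bsub>X\<^esub> y \<in> carrier X" and "\<zero>\<^bsub>X\<^esub> \<in> carrier X"
    and "\<And>l m. \<lbrakk>l \<in> carrier M; m \<in> carrier M\<rbrakk> \<Longrightarrow> l \<oplus>\<^bsub>M\<^esub> m \<in> carrier M"
    and "tensor_eq S X \<rho> M ts us"
  shows "set ts \<subseteq> carrier X \<times> carrier M \<and> set us \<subseteq> carrier X \<times> carrier M"
  using assms(6) by induction (use assms(1-5) in auto)

text \<open>The left action is multiplication in the first factor, and \<open>bimodule\<close> makes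
  it compatible with balancing. With \<rho> the multiplication of forms this covers forms with
  values in a module, with \<rho> the scalar action it covers
  \<open>A \<otimes>_K M\<close>.\<close>

lemma formal_sums_tensor:
  fixes M :: "('r, ('w, 'e) univ, 'z) module_scheme"
  assumes \<rho>: "\<And>x s. \<lbrakk>x \<in> G n; s \<in> carrier S\<rbrakk> \<Longrightarrow> \<rho> x s \<in> G n"
    and smult: "\<And>s m. \<lbrakk>s \<in> carrier S; m \<in> carrier M\<rbrakk> \<Longrightarrow> s \<odot>\<^bsub>M\<^esub> m \<in> carrier M"
    and add: "\<And>l m. \<lbrakk>l \<in> carrier M; m \<in> carrier M\<rbrakk> \<Longrightarrow> l \<oplus>\<^bsub>M\<^esub> m \<in> carrier M"
    and bimodule: "\<And>a x s. \<lbrakk>a \<in> G 0; x \<in> G n; s \<in> carrier S\<rbrakk> \<Longrightarrow> a \<otimes>\<^bsub>\<Omega>\<^esub> \<rho> x s = \<rho> (a \<otimes>\<^bsub>\<Omega>\<^esub> x) s"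
  shows "formal_sums K \<Omega> n (carrier M) (tensor_eq S (forms \<Omega> n) \<rho> M)
    (tensor_cls S (forms \<Omega> n) \<rho> M) (tensor S (forms \<Omega> n) \<rho> M)"
proof -
  let ?eq = "tensor_eq S (forms \<Omega> n) \<rho> M"
  have rep: "?eq ts (SOME us. ?eq ts us)" if "set ts \<subseteq> G n \<times> carrier M" for ts
    by (rule someI_ex, rule exI[of _ ts]) (rule tensor_eq.refl, simp add: that)
  have action: "?eq (map (apfst (\<lambda>x. a \<otimes>\<^bsub>\<Omega>\<^esub> x)) ts) (map (apfst (\<lambda>x. a \<otimes>\<^bsub>\<Omega>\<^esub> x)) us)"
    if a: "a \<in> G 0" and "?eq ts us" for a ts us
    using that(2)
  proof induction
    case (refl ts)
    then show ?case using a by (intro tensor_eq.refl) (auto simp: apfst_def)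
  next
    case (sym ts us)
    then show ?case by (rule_tac tensor_eq.sym)
  next
    case (trans ts us vs)
    then show ?case by (rule_tac tensor_eq.trans)
  next
    case (append ts ts' us us')
    then show ?case by (simp add: tensor_eq.append)
  next
    case (commute ts us)
    then show ?case using a unfolding map_append
      by (intro tensor_eq.commute) (auto simp: apfst_def)
  next
    case (zero m)
    then show ?case using a tensor_eq.zero[of m M S "forms \<Omega> n" \<rho>] by simp
  next
    case (add_left x y m)
    then show ?case
      using a tensor_eq.add_left[of "a \<otimes>\<^bsub>\<Omega>\<^esub> x" "forms \<Omega> n" "a \<otimes>\<^bsub>\<Omega>\<^esub> y" m M S \<rho>]
      by (simp add: Alg.r_distr)
  next
    case (add_right x m l)
    then show ?case
      using a tensor_eq.add_right[of "a \<otimes>\<^bsub>\<Omega>\<^esub> x" "forms \<Omega> n" m M l S \<rho>] by simp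
  next
    case (balanced x s m)
    then show ?case
      using a tensor_eq.balanced[of "a \<otimes>\<^bsub>\<Omega>\<^esub> x" "forms \<Omega> n" s S m M \<rho>] by (simp add: bimodule)
  qed
  show ?thesis
  proof unfold_locales
    show "set ts \<subseteq> G n \<times> carrier M \<and> set us \<subseteq> G n \<times> carrier M" if "?eq ts us" for ts us
      using tensor_eq_valid[of "forms \<Omega> n" S \<rho> M ts us] \<rho> smult add that by simp
    show "tensor_cls S (forms \<Omega> n) \<rho> M ts = tensor_cls S (forms \<Omega> n) \<rho> M us" if "?eq ts us" for ts us
    proof -
      \<comment> \<open>\<open>tensor_cls\<close> sees a list only through the predicate
        \<open>?eq ts\<close>, so congruent lists receive the same chosen representative.\<close>
      have "?eq ts = ?eq us"
        using that by (auto intro!: ext intro: tensor_eq.sym tensor_eq.trans)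
      then show ?thesis by (simp add: tensor_cls_def)
    qed
    show "?eq ts (summands (tensor_cls S (forms \<Omega> n) \<rho> M ts))" if "set ts \<subseteq> G n \<times> carrier M" for ts
      using rep[OF that] by (simp add: tensor_cls_def)
    show "?eq ts us \<Longrightarrow> ?eq us vs \<Longrightarrow> ?eq ts vs" for ts us vs
      by (rule tensor_eq.trans)
    show "?eq ts ts" if "set ts \<subseteq> G n \<times> carrier M" for ts
      by (rule tensor_eq.refl) (simp add: that)
    show "?eq (ts @ us) (us @ ts)" if "set ts \<subseteq> G n \<times> carrier M" "set us \<subseteq> G n \<times> carrier M" for ts us
      by (rule tensor_eq.commute) (simp_all add: that)
    show "?eq (ts @ us) (ts' @ us')" if "?eq ts ts'" "?eq us us'" for ts ts' us us'
      using that by (rule tensor_eq.append)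
  qed (use action in \<open>auto simp: tensor_def intro: tensor_eq.sym tensor_eq.zero[of _ _ _ "forms \<Omega> n", simplified] tensor_eq.add_left[of _ "forms \<Omega> n", simplified]\<close>)
qed

lemma smult_closed:
  assumes "left_module (alg \<Omega>) M" and "a \<in> G 0" and "m \<in> carrier M"
  shows "a \<odot>\<^bsub>M\<^esub> m \<in> carrier M"
  using left_module.lsmult_closed[OF assms(1)] assms(2,3) by simp

section \<open>Forms with values in a module\<close>

abbreviation form_eq
  where "form_eq n M \<equiv> tensor_eq (alg \<Omega>) (forms \<Omega> n) (mult \<Omega>) M"

lemma formal_sums_form:
  assumes "left_module (alg \<Omega>) M"
  shows "formal_sums K \<Omega> n (carrier M) (form_eq n M) (form_cls \<Omega> n M) (form_module \<Omega> n M)"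
  unfolding form_cls_def form_module_def
  by (rule formal_sums_tensor)
    (use left_module.lsmult_closed[OF assms] in
      \<open>simp_all add: Alg.m_assoc abelian_groupE(1)[OF left_module_abelian_group[OF assms]]\<close>)

lemma left_module_form: "left_module (alg \<Omega>) M \<Longrightarrow> left_module (alg \<Omega>) (form_module \<Omega> n M)"
  using formal_sums.left_module_M[OF formal_sums_form] .

lemma abelian_group_form: "left_module (alg \<Omega>) M \<Longrightarrow> abelian_group (form_module \<Omega> n M)"
  using formal_sums.abelian_group_M[OF formal_sums_form] .

abbreviation pure
  where "pure n M w m \<equiv> form_cls \<Omega> n M [(w, m)]"

lemma pure_closed:
  "\<lbrakk>left_module (alg \<Omega>) M; w \<in> G n; m \<in> carrier M\<rbrakk> \<Longrightarrow> pure n M w m \<in> carrier (form_module \<Omega> n M)"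
  by (rule formal_sums.cls_closed[OF formal_sums_form]) simp_all

lemma pure_add_left:
  assumes "left_module (alg \<Omega>) M" and "v \<in> G n" and "w \<in> G n" and "m \<in> carrier M"
  shows "pure n M (v \<oplus>\<^bsub>\<Omega>\<^esub> w) m = pure n M v m \<oplus>\<^bsub>form_module \<Omega> n M\<^esub> pure n M w m"
proof -
  interpret formal_sums K \<Omega> n "carrier M" "form_eq n M" "form_cls \<Omega> n M" "form_module \<Omega> n M"
    by (rule formal_sums_form[OF assms(1)])
  show ?thesis
    using assms Q_cls[OF Q_add] by (simp add: cls_append)
qed

lemma pure_add_right:
  assumes "left_module (alg \<Omega>) M" and "w \<in> G n" and "l \<in> carrier M" and "m \<in> carrier M"
  shows "pure n M w (l \<oplus>\<^bsub>M\<^esub> m) = pure n M w l \<oplus>\<^bsub>form_module \<Omega> n M\<^esub> pure n M w m"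
proof -
  interpret formal_sums K \<Omega> n "carrier M" "form_eq n M" "form_cls \<Omega> n M" "form_module \<Omega> n M"
    by (rule formal_sums_form[OF assms(1)])
  show ?thesis
    using assms Q_cls[OF tensor_eq.add_right[of w "forms \<Omega> n" l M m]] by (simp add: cls_append)
qed

lemma pure_balanced:
  assumes "left_module (alg \<Omega>) M" and "w \<in> G n" and "a \<in> G 0" and "m \<in> carrier M"
  shows "pure n M (w \<otimes>\<^bsub>\<Omega>\<^esub> a) m = pure n M w (a \<odot>\<^bsub>M\<^esub> m)"
  using assms
  by (intro formal_sums.Q_cls[OF formal_sums_form[OF assms(1)]] tensor_eq.balanced) simp_all

lemma pure_smult:
  assumes "left_module (alg \<Omega>) M" and "a \<in> G 0" and "w \<in> G n" and "m \<in> carrier M"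
  shows "a \<odot>\<^bsub>form_module \<Omega> n M\<^esub> pure n M w m = pure n M (a \<otimes>\<^bsub>\<Omega>\<^esub> w) m"
  using assms by (simp add: formal_sums.smult_cls[OF formal_sums_form])

lemma pure_zero_left:
  assumes "left_module (alg \<Omega>) M" and "m \<in> carrier M"
  shows "pure n M \<zero>\<^bsub>\<Omega>\<^esub> m = \<zero>\<^bsub>form_module \<Omega> n M\<^esub>"
  using assms formal_sums.Q_cls[OF formal_sums_form formal_sums.Q_zero[OF formal_sums_form]]
  by (simp add: formal_sums.zero_M[OF formal_sums_form])

lemma pure_additive_right:
  "\<lbrakk>left_module (alg \<Omega>) M; w \<in> G n\<rbrakk> \<Longrightarrow> pure n M w \<in> additive_maps M (form_module \<Omega> n M)"
  by (auto intro!: additive_mapsI pure_closed pure_add_right)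

lemma pure_additive_left:
  "\<lbrakk>left_module (alg \<Omega>) M; m \<in> carrier M\<rbrakk> \<Longrightarrow> (\<lambda>w. pure n M w m) \<in> additive_maps (forms \<Omega> n) (form_module \<Omega> n M)"
  by (auto intro!: additive_mapsI pure_closed pure_add_left)

lemma abelian_group_forms: "abelian_group (forms \<Omega> n)"
proof (rule abelian_groupI)
  show "\<exists>y\<in>carrier (forms \<Omega> n). y \<oplus>\<^bsub>forms \<Omega> n\<^esub> x = \<zero>\<^bsub>forms \<Omega> n\<^esub>" if "x \<in> carrier (forms \<Omega> n)" for x
    using that by (intro bexI[of _ "\<ominus>\<^bsub>\<Omega>\<^esub> x"]) (simp_all add: Mod.M.l_neg)
qed (simp_all add: Mod.M.a_ac)

lemma a_inv_forms [simp]: "w \<in> G n \<Longrightarrow> \<ominus>\<^bsub>forms \<Omega> n\<^esub> w = \<ominus>\<^bsub>\<Omega>\<^esub> w"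
  by (rule abelian_group.minus_equality[OF abelian_group_forms]) (simp_all add: Mod.M.l_neg)

lemma a_minus_forms [simp]: "\<lbrakk>v \<in> G n; w \<in> G n\<rbrakk> \<Longrightarrow> v \<ominus>\<^bsub>forms \<Omega> n\<^esub> w = v \<ominus>\<^bsub>\<Omega>\<^esub> w"
  by (simp add: a_minus_def)

lemma form_cls_lsum:
  assumes "left_module (alg \<Omega>) M" and "set ts \<subseteq> G n \<times> carrier M"
  shows "form_cls \<Omega> n M ts = lsum (form_module \<Omega> n M) (\<lambda>(w, m). pure n M w m) ts"
  unfolding formal_sums.cls_lsum[OF formal_sums_form[OF assms(1)] assms(2)]
  by (rule lsum_cong) auto

text \<open>The form in which maps out of \<open>\<Omega>^n \<otimes> M\<close> are constructed
  below: the value on pure tensors is prescribed, and additivity in each argument and balancing are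
  checked separately.\<close>

lemma
  fixes g :: "'w \<Rightarrow> ('w, 'e) univ \<Rightarrow> 'n"
  assumes M: "left_module (alg \<Omega>) M" and N: "abelian_group N"
    and left: "\<And>m. m \<in> carrier M \<Longrightarrow> (\<lambda>w. g w m) \<in> additive_maps (forms \<Omega> n) N"
    and right: "\<And>w. w \<in> G n \<Longrightarrow> g w \<in> additive_maps M N"
    and balanced: "\<And>w a m. \<lbrakk>w \<in> G n; a \<in> G 0; m \<in> carrier M\<rbrakk> \<Longrightarrow> g (w \<otimes>\<^bsub>\<Omega>\<^esub> a) m = g w (a \<odot>\<^bsub>M\<^esub> m)"
  shows form_lift_additive: "(\<lambda>t. lsum N (\<lambda>(w, m). g w m) (summands t)) \<in> additive_maps (form_module \<Omega> n M) N"
    and form_lift_pure: "\<lbrakk>w \<in> G n; m \<in> carrier M\<rbrakk> \<Longrightarrow>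
      lsum N (\<lambda>(w, m). g w m) (summands (pure n M w m)) = g w m"
proof -
  interpret N: abelian_group N by fact
  interpret formal_sums K \<Omega> n "carrier M" "form_eq n M" "form_cls \<Omega> n M" "form_module \<Omega> n M"
    by (rule formal_sums_form[OF M])
  have cl: "g w m \<in> carrier N" if "w \<in> G n" "m \<in> carrier M" for w m
    using additive_maps_closed[OF right] that by blast
  have Q: "lsum N (\<lambda>(w, m). g w m) ts = lsum N (\<lambda>(w, m). g w m) us" if "form_eq n M ts us" for ts us
  proof (rule tensor_eq_lsum[OF that N])
    show "g \<zero>\<^bsub>forms \<Omega> n\<^esub> m = \<zero>\<^bsub>N\<^esub>" if "m \<in> carrier M" for m
      using additive_maps_zero[OF abelian_group_forms N left[OF that]] .
    show "g (x \<oplus>\<^bsub>forms \<Omega> n\<^esub> y) m = g x m \<oplus>\<^bsub>N\<^esub> g y m"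
      if "x \<in> carrier (forms \<Omega> n)" "y \<in> carrier (forms \<Omega> n)" "m \<in> carrier M" for x y m
      using additive_maps_add[OF left[OF that(3)] that(1,2)] .
    show "g x (l \<oplus>\<^bsub>M\<^esub> m) = g x l \<oplus>\<^bsub>N\<^esub> g x m"
      if "x \<in> carrier (forms \<Omega> n)" "l \<in> carrier M" "m \<in> carrier M" for x l m
      using additive_maps_add[OF right] that by simp
  qed (use cl balanced Q_valid in simp_all)
  note lift = lift_cls[of N "\<lambda>(w, m). g w m", OF N _ Q] lift_additive[of N "\<lambda>(w, m). g w m", OF N _ Q]
  show "(\<lambda>t. lsum N (\<lambda>(w, m). g w m) (summands t)) \<in> additive_maps (form_module \<Omega> n M) N"
    by (rule lift(2)) (simp_all add: cl)
  show "lsum N (\<lambda>(w, m). g w m) (summands (pure n M w m)) = g w m" if "w \<in> G n" "m \<in> carrier M"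
    using that lift(1)[of "[(w, m)]"] by (simp add: cl)
qed

text \<open>The congruence is carried along \<phi> by induction on its generation; linearity of
  \<phi> enters in the cases \<open>add_right\<close> and \<open>balanced\<close>.\<close>

lemma
  assumes M: "left_module (alg \<Omega>) M" and N: "left_module (alg \<Omega>) N" and \<phi>: "\<phi> \<in> mod_hom (alg \<Omega>) M N"
  shows form_map_cls: "set ts \<subseteq> G n \<times> carrier M \<Longrightarrow>
      form_map \<Omega> n N \<phi> (form_cls \<Omega> n M ts) = form_cls \<Omega> n N (map (apsnd \<phi>) ts)"
    and form_map_linear: "form_map \<Omega> n N \<phi> \<in> mod_hom (alg \<Omega>) (form_module \<Omega> n M) (form_module \<Omega> n N)"
proof -
  interpret M: formal_sums K \<Omega> n "carrier M" "form_eq n M" "form_cls \<Omega> n M" "form_module \<Omega> n M"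
    by (rule formal_sums_form[OF M])
  interpret N: formal_sums K \<Omega> n "carrier N" "form_eq n N" "form_cls \<Omega> n N" "form_module \<Omega> n N"
    by (rule formal_sums_form[OF N])
  have cl: "\<phi> m \<in> carrier N" if "m \<in> carrier M" for m
    using mod_hom_closed[OF \<phi> that] .
  have Q: "form_eq n N (map (apsnd \<phi>) ts) (map (apsnd \<phi>) us)" if "form_eq n M ts us" for ts us
    using that
  proof induction
    case (refl ts)
    then show ?case using cl by (intro tensor_eq.refl) (auto simp: apsnd_def)
  next
    case (sym ts us)
    then show ?case by (rule_tac tensor_eq.sym)
  next
    case (trans ts us vs)
    then show ?case by (rule_tac tensor_eq.trans)
  next
    case (append ts ts' us us')
    then show ?case by (simp add: tensor_eq.append)
  next
    case (commute ts us)
    then show ?case using cl unfolding map_append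
      by (intro tensor_eq.commute) (auto simp: apsnd_def)
  next
    case (zero m)
    then show ?case using cl tensor_eq.zero[of "\<phi> m" N "alg \<Omega>" "forms \<Omega> n" "mult \<Omega>"] by simp
  next
    case (add_left x y m)
    then show ?case
      using cl tensor_eq.add_left[of x "forms \<Omega> n" y "\<phi> m" N "alg \<Omega>" "mult \<Omega>"] by simp
  next
    case (add_right x m l)
    then show ?case
      using cl tensor_eq.add_right[of x "forms \<Omega> n" "\<phi> m" N "\<phi> l" "alg \<Omega>" "mult \<Omega>"]
      by (simp add: mod_hom_add[OF \<phi>])
  next
    case (balanced x s m)
    then show ?case
      using cl tensor_eq.balanced[of x "forms \<Omega> n" s "alg \<Omega>" "\<phi> m" N "mult \<Omega>"]
      by (simp add: mod_hom_smult[OF \<phi>])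
  qed
  note map = map_summands_cls[OF M.formal_sums_axioms N.formal_sums_axioms, of "apsnd \<phi>", OF _ Q]
    map_summands_additive[OF M.formal_sums_axioms N.formal_sums_axioms, of "apsnd \<phi>", OF _ Q]
  show cls: "form_map \<Omega> n N \<phi> (form_cls \<Omega> n M ts) = form_cls \<Omega> n N (map (apsnd \<phi>) ts)"
    if "set ts \<subseteq> G n \<times> carrier M" for ts
    unfolding form_map_def by (rule map(1)[OF _ _ that]) (auto simp: cl)
  have "form_map \<Omega> n N \<phi> \<in> additive_maps (form_module \<Omega> n M) (form_module \<Omega> n N)"
    unfolding form_map_def[abs_def] by (rule map(2)) (auto simp: cl)
  then show "form_map \<Omega> n N \<phi> \<in> mod_hom (alg \<Omega>) (form_module \<Omega> n M) (form_module \<Omega> n N)"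
    by (rule M.linearI[OF N.left_module_M]) (simp add: cls cl pure_smult[OF N])
qed

lemma form_map_pure:
  assumes "left_module (alg \<Omega>) M" and "left_module (alg \<Omega>) N" and "\<phi> \<in> mod_hom (alg \<Omega>) M N"
    and "w \<in> G n" and "m \<in> carrier M"
  shows "form_map \<Omega> n N \<phi> (pure n M w m) = pure n N w (\<phi> m)"
  using form_map_cls[OF assms(1-3), of "[(w, m)]" n] assms(4,5) by simp

lemma form_additive_eqI:
  assumes "left_module (alg \<Omega>) M" and "abelian_group N"
    and "f \<in> additive_maps (form_module \<Omega> n M) N" and "g \<in> additive_maps (form_module \<Omega> n M) N"
    and "\<And>w m. \<lbrakk>w \<in> G n; m \<in> carrier M\<rbrakk> \<Longrightarrow> f (pure n M w m) = g (pure n M w m)"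
    and "t \<in> carrier (form_module \<Omega> n M)"
  shows "f t = g t"
  using formal_sums.additive_eqI[OF formal_sums_form[OF assms(1)] assms(2-4) _ assms(6)] assms(5)
  by blast

lemma form_map_comp:
  assumes M: "left_module (alg \<Omega>) M" and N: "left_module (alg \<Omega>) N" and P: "left_module (alg \<Omega>) P"
    and \<phi>: "\<phi> \<in> mod_hom (alg \<Omega>) M N" and \<psi>: "\<psi> \<in> mod_hom (alg \<Omega>) N P"
    and t: "t \<in> carrier (form_module \<Omega> n M)"
  shows "form_map \<Omega> n P \<psi> (form_map \<Omega> n N \<phi> t) = form_map \<Omega> n P (\<lambda>x. \<psi> (\<phi> x)) t"
proof (rule form_additive_eqI[OF M abelian_group_form[OF P] _ _ _ t])
  note \<phi>\<psi> = mod_hom_compose[OF \<phi> \<psi>]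
  show "(\<lambda>t. form_map \<Omega> n P \<psi> (form_map \<Omega> n N \<phi> t)) \<in> additive_maps (form_module \<Omega> n M) (form_module \<Omega> n P)"
    by (rule additive_maps_compose[OF mod_hom_additive[OF form_map_linear[OF M N \<phi>]]
          mod_hom_additive[OF form_map_linear[OF N P \<psi>]]])
  show "form_map \<Omega> n P (\<lambda>x. \<psi> (\<phi> x)) \<in> additive_maps (form_module \<Omega> n M) (form_module \<Omega> n P)"
    by (rule mod_hom_additive[OF form_map_linear[OF M P \<phi>\<psi>]])
  show "form_map \<Omega> n P \<psi> (form_map \<Omega> n N \<phi> (pure n M w m)) = form_map \<Omega> n P (\<lambda>x. \<psi> (\<phi> x)) (pure n M w m)"
    if "w \<in> G n" "m \<in> carrier M" for w m
    using that by (simp add: form_map_pure[OF M N \<phi>] form_map_pure[OF N P \<psi>] form_map_pure[OF M P \<phi>\<psi>]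
        mod_hom_closed[OF \<phi>])
qed

text \<open>Formulated for a \<phi> known only on the carrier, since it is applied to the embedding
  of symmetric forms followed by its left inverse.\<close>

lemma form_map_eq_identity:
  assumes M: "left_module (alg \<Omega>) M" and \<phi>: "\<And>m. m \<in> carrier M \<Longrightarrow> \<phi> m = m"
    and t: "t \<in> carrier (form_module \<Omega> n M)"
  shows "form_map \<Omega> n M \<phi> t = t"
proof -
  have hom: "\<phi> \<in> mod_hom (alg \<Omega>) M M"
    using \<phi> left_module.lsmult_closed[OF M] abelian_groupE(1)[OF left_module_abelian_group[OF M]]
    by (auto intro!: mod_homI)
  show ?thesis
    by (rule form_additive_eqI[OF M abelian_group_form[OF M] mod_hom_additive[OF form_map_linear[OF M M hom]] _ _ t])
      (auto simp: form_map_pure[OF M M hom] \<phi> intro: additive_mapsI abelian_groupE(1)[OF abelian_group_form[OF M]])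
qed

text \<open>Applied to the embedding followed by \<pi>, this removes the second term of
  \<open>D_I\<close> on embedded symmetric forms.\<close>

lemma form_map_eq_zero:
  assumes M: "left_module (alg \<Omega>) M" and N: "left_module (alg \<Omega>) N" and \<phi>: "\<phi> \<in> mod_hom (alg \<Omega>) M N"
    and "\<And>m. m \<in> carrier M \<Longrightarrow> \<phi> m = \<zero>\<^bsub>N\<^esub>"
    and t: "t \<in> carrier (form_module \<Omega> n M)"
  shows "form_map \<Omega> n N \<phi> t = \<zero>\<^bsub>form_module \<Omega> n N\<^esub>"
proof -
  interpret N: abelian_group "form_module \<Omega> n N" by (rule abelian_group_form[OF N])
  show ?thesis
    by (rule form_additive_eqI[OF M abelian_group_form[OF N] mod_hom_additive[OF form_map_linear[OF M N \<phi>]] _ _ t])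
      (auto simp: form_map_pure[OF M N \<phi>] assms(4) additive_maps_zero[OF left_module_abelian_group[OF N]
          abelian_group_form[OF N] pure_additive_right[OF N]] intro: additive_mapsI)
qed

end

declare One_nat_def [simp del]

lemma apfst_eq: "apfst f p = (f (fst p), snd p)"
  by (cases p) simp

context exterior_algebra
begin

section \<open>Exterior multiplication on forms with values in a module\<close>

lemmas deriv_one_form' [simp] = deriv_one_form[folded One_nat_def]
  and deriv_two_form' [simp] = deriv_two_form[folded One_nat_def]
  and wedge_one_forms' [simp] = wedge_one_forms[folded One_nat_def]
  and deriv_one_form_mult' = deriv_one_form_mult[folded One_nat_def]

text \<open>\<open>wedge_map\<close> acts on doubly nested sums. With the outer one-form
  \<open>w\<close> fixed it becomes a map out of a single tensor product, and
  \<open>wedge_map\<close> is then the lift of the pairing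
  \<open>(w, t) \<mapsto> wedge_left M w t\<close>.\<close>

definition wedge_left
  where "wedge_left M w t = lsum (form_module \<Omega> 2 M) (\<lambda>(v, m). pure 2 M (w \<otimes>\<^bsub>\<Omega>\<^esub> v) m) (summands t)"

context
  fixes M :: "('w, ('w, 'e) univ) module"
  assumes M: "left_module (alg \<Omega>) M"
begin

lemma
  assumes "w \<in> G 1"
  shows wedge_left_additive: "wedge_left M w \<in> additive_maps (form_module \<Omega> 1 M) (form_module \<Omega> 2 M)"
    and wedge_left_pure: "\<lbrakk>v \<in> G 1; m \<in> carrier M\<rbrakk> \<Longrightarrow> wedge_left M w (pure 1 M v m) = pure 2 M (w \<otimes>\<^bsub>\<Omega>\<^esub> v) m"
proof -
  have left: "(\<lambda>v. pure 2 M (w \<otimes>\<^bsub>\<Omega>\<^esub> v) m) \<in> additive_maps (forms \<Omega> 1) (form_module \<Omega> 2 M)" if "m \<in> carrier M" for m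
    using assms that by (intro additive_mapsI) (simp_all add: Alg.r_distr pure_add_left[OF M] pure_closed[OF M])
  have right: "pure 2 M (w \<otimes>\<^bsub>\<Omega>\<^esub> v) \<in> additive_maps M (form_module \<Omega> 2 M)" if "v \<in> G 1" for v
    using assms that by (intro pure_additive_right[OF M]) simp
  have bal: "pure 2 M (w \<otimes>\<^bsub>\<Omega>\<^esub> (v \<otimes>\<^bsub>\<Omega>\<^esub> a)) m = pure 2 M (w \<otimes>\<^bsub>\<Omega>\<^esub> v) (a \<odot>\<^bsub>M\<^esub> m)"
    if "v \<in> G 1" "a \<in> G 0" "m \<in> carrier M" for v a m
    using assms that by (simp add: pure_balanced[OF M, symmetric] Alg.m_assoc)
  note lift = form_lift_additive[OF M abelian_group_form[OF M], of "\<lambda>v. pure 2 M (w \<otimes>\<^bsub>\<Omega>\<^esub> v)" 1]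
    form_lift_pure[OF M abelian_group_form[OF M], of "\<lambda>v. pure 2 M (w \<otimes>\<^bsub>\<Omega>\<^esub> v)" 1]
  show "wedge_left M w \<in> additive_maps (form_module \<Omega> 1 M) (form_module \<Omega> 2 M)"
    unfolding wedge_left_def[abs_def] by (rule lift(1)[OF left right bal])
  show "\<lbrakk>v \<in> G 1; m \<in> carrier M\<rbrakk> \<Longrightarrow> wedge_left M w (pure 1 M v m) = pure 2 M (w \<otimes>\<^bsub>\<Omega>\<^esub> v) m"
    unfolding wedge_left_def by (rule lift(2)[OF left right bal])
qed

lemma wedge_left_cls:
  assumes "w \<in> G 1" and "set ts \<subseteq> G 1 \<times> carrier M"
  shows "form_cls \<Omega> 2 M (map (apfst (\<lambda>v. w \<otimes>\<^bsub>\<Omega>\<^esub> v)) ts) = wedge_left M w (form_cls \<Omega> 1 M ts)"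
proof -
  have "set (map (apfst (\<lambda>v. w \<otimes>\<^bsub>\<Omega>\<^esub> v)) ts) \<subseteq> G 2 \<times> carrier M"
    using assms by (auto simp: apfst_def)
  then have "form_cls \<Omega> 2 M (map (apfst (\<lambda>v. w \<otimes>\<^bsub>\<Omega>\<^esub> v)) ts)
      = lsum (form_module \<Omega> 2 M) (\<lambda>p. pure 2 M (w \<otimes>\<^bsub>\<Omega>\<^esub> fst p) (snd p)) ts"
    by (simp add: form_cls_lsum[OF M] lsum_map case_prod_unfold apfst_eq)
  also have "\<dots> = lsum (form_module \<Omega> 2 M) (\<lambda>p. wedge_left M w (form_cls \<Omega> 1 M [p])) ts"
    using assms by (intro lsum_cong) (auto simp: wedge_left_pure)
  also have "\<dots> = wedge_left M w (form_cls \<Omega> 1 M ts)"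
    by (rule formal_sums.additive_cls[OF formal_sums_form[OF M] abelian_group_form[OF M]
          wedge_left_additive assms(2), symmetric]) fact
  finally show ?thesis .
qed

lemma wedge_left_closed:
  "\<lbrakk>w \<in> G 1; t \<in> carrier (form_module \<Omega> 1 M)\<rbrakk> \<Longrightarrow> wedge_left M w t \<in> carrier (form_module \<Omega> 2 M)"
  using additive_maps_closed[OF wedge_left_additive] .

text \<open>The first identity is what balancing of the outer tensor product requires, the second
  gives linearity of \<open>wedge_map\<close>. Both reduce to associativity on pure tensors.\<close>

lemma wedge_left_smult:
  assumes a: "a \<in> G 0" and w: "w \<in> G 1" and t: "t \<in> carrier (form_module \<Omega> 1 M)"
  shows "wedge_left M (w \<otimes>\<^bsub>\<Omega>\<^esub> a) t = wedge_left M w (a \<odot>\<^bsub>form_module \<Omega> 1 M\<^esub> t)"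
    and "wedge_left M (a \<otimes>\<^bsub>\<Omega>\<^esub> w) t = a \<odot>\<^bsub>form_module \<Omega> 2 M\<^esub> wedge_left M w t"
proof -
  note smult = left_module_smult_additive[OF left_module_form[OF M]]
  show "wedge_left M (w \<otimes>\<^bsub>\<Omega>\<^esub> a) t = wedge_left M w (a \<odot>\<^bsub>form_module \<Omega> 1 M\<^esub> t)"
    by (rule form_additive_eqI[OF M abelian_group_form[OF M] wedge_left_additive
          additive_maps_compose[OF smult wedge_left_additive] _ t])
      (use a w in \<open>simp_all add: wedge_left_pure pure_smult[OF M] Alg.m_assoc\<close>)
  show "wedge_left M (a \<otimes>\<^bsub>\<Omega>\<^esub> w) t = a \<odot>\<^bsub>form_module \<Omega> 2 M\<^esub> wedge_left M w t"
    by (rule form_additive_eqI[OF M abelian_group_form[OF M] wedge_left_additive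
          additive_maps_compose[OF wedge_left_additive smult] _ t])
      (use a w in \<open>simp_all add: wedge_left_pure pure_smult[OF M] Alg.m_assoc\<close>)
qed

lemma wedge_left_additive_left:
  assumes t: "t \<in> carrier (form_module \<Omega> 1 M)"
  shows "(\<lambda>w. wedge_left M w t) \<in> additive_maps (forms \<Omega> 1) (form_module \<Omega> 2 M)"
proof (rule additive_mapsI)
  fix v w assume "v \<in> carrier (forms \<Omega> 1)" "w \<in> carrier (forms \<Omega> 1)"
  then have vw: "v \<in> G 1" "w \<in> G 1" by simp_all
  show "wedge_left M (v \<oplus>\<^bsub>forms \<Omega> 1\<^esub> w) t = wedge_left M v t \<oplus>\<^bsub>form_module \<Omega> 2 M\<^esub> wedge_left M w t"
    by (rule form_additive_eqI[OF M abelian_group_form[OF M] wedge_left_additive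
          additive_maps_plus[OF abelian_group_form[OF M] wedge_left_additive wedge_left_additive] _ t])
      (use vw in \<open>simp_all add: wedge_left_pure pure_add_left[OF M] Alg.l_distr\<close>)
qed (simp add: wedge_left_closed[OF _ t])

lemma
  shows wedge_map_linear:
      "wedge_map \<Omega> M \<in> mod_hom (alg \<Omega>) (form_module \<Omega> 1 (form_module \<Omega> 1 M)) (form_module \<Omega> 2 M)"
    and wedge_map_pure: "\<lbrakk>w \<in> G 1; t \<in> carrier (form_module \<Omega> 1 M)\<rbrakk> \<Longrightarrow>
      wedge_map \<Omega> M (pure 1 (form_module \<Omega> 1 M) w t) = wedge_left M w t"
proof -
  let ?F = "form_module \<Omega> 1 M"
  have F: "left_module (alg \<Omega>) ?F" by (rule left_module_form[OF M])
  interpret M: formal_sums K \<Omega> 1 "carrier M" "form_eq 1 M" "form_cls \<Omega> 1 M" ?F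
    by (rule formal_sums_form[OF M])
  interpret F: formal_sums K \<Omega> 1 "carrier ?F" "form_eq 1 ?F" "form_cls \<Omega> 1 ?F" "form_module \<Omega> 1 ?F"
    by (rule formal_sums_form[OF F])
  \<comment> \<open>The lift of the pairing by \<open>wedge_left\<close>. Additivity is known for
    \<open>W\<close> and then transferred, since \<open>wedge_map\<close> itself is given by
    flattened representatives.\<close>
  define W where "W t = lsum (form_module \<Omega> 2 M) (\<lambda>(w, y). wedge_left M w y) (summands t)" for t
  have eq: "wedge_map \<Omega> M t = W t" if t: "t \<in> carrier (form_module \<Omega> 1 ?F)" for t
  proof -
    let ?ts = "map (\<lambda>(w, y). map (apfst (\<lambda>v. w \<otimes>\<^bsub>\<Omega>\<^esub> v)) (summands y)) (summands t)"
    have t': "set (summands t) \<subseteq> G 1 \<times> carrier ?F"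
      by (rule F.summands_valid[OF t])
    have v: "set us \<subseteq> G 2 \<times> carrier M" if "us \<in> set ?ts" for us
    proof -
      from that obtain w y where "w \<in> G 1" "y \<in> carrier ?F"
        and us: "us = map (apfst (\<lambda>v. w \<otimes>\<^bsub>\<Omega>\<^esub> v)) (summands y)"
        using t' by auto
      then show ?thesis using M.summands_valid[of y] unfolding us by (auto simp: apfst_def)
    qed
    have "wedge_map \<Omega> M t = form_cls \<Omega> 2 M (concat ?ts)"
      unfolding wedge_map_def flatten_def by (simp add: apfst_def map_prod_def)
    also have "\<dots> = lsum (form_module \<Omega> 2 M) (form_cls \<Omega> 2 M) ?ts"
      by (rule formal_sums.cls_concat[OF formal_sums_form[OF M] v])
    also have "\<dots> = W t"
      unfolding lsum_map W_def
    proof (rule lsum_cong)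
      fix p assume "p \<in> set (summands t)"
      with t' obtain w y where p: "p = (w, y)" "w \<in> G 1" "y \<in> carrier ?F" by auto
      then show "form_cls \<Omega> 2 M (case p of (w, y) \<Rightarrow> map (apfst (\<lambda>v. w \<otimes>\<^bsub>\<Omega>\<^esub> v)) (summands y))
          = (case p of (w, y) \<Rightarrow> wedge_left M w y)"
        by (simp add: wedge_left_cls M.summands_valid M.cls_summands)
    qed
    finally show ?thesis .
  qed
  note W = form_lift_additive[OF F abelian_group_form[OF M] wedge_left_additive_left wedge_left_additive wedge_left_smult(1),
      folded W_def]
    form_lift_pure[OF F abelian_group_form[OF M] wedge_left_additive_left wedge_left_additive wedge_left_smult(1),
      folded W_def]
  have additive: "wedge_map \<Omega> M \<in> additive_maps (form_module \<Omega> 1 ?F) (form_module \<Omega> 2 M)"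
    by (rule additive_mapsI)
      (simp_all add: eq abelian_groupE(1)[OF F.abelian_group_M] additive_maps_closed[OF W(1)] additive_maps_add[OF W(1)])
  show pure: "wedge_map \<Omega> M (pure 1 ?F w t) = wedge_left M w t" if "w \<in> G 1" "t \<in> carrier ?F" for w t
    using that by (simp add: eq pure_closed[OF F] W(2))
  show "wedge_map \<Omega> M \<in> mod_hom (alg \<Omega>) (form_module \<Omega> 1 ?F) (form_module \<Omega> 2 M)"
    by (rule F.linearI[OF left_module_form[OF M] additive]) (simp add: pure wedge_left_smult(2))
qed

end

text \<open>Wedging acts on the form factor and \<phi> on the module factor. For \<phi> the
  embedding, this relates the wedge condition on symmetric forms to \<open>D_II\<close>.\<close>

lemma wedge_left_natural:
  assumes M: "left_module (alg \<Omega>) M" and N: "left_module (alg \<Omega>) N" and \<phi>: "\<phi> \<in> mod_hom (alg \<Omega>) M N"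
    and w: "w \<in> G 1" and t: "t \<in> carrier (form_module \<Omega> 1 M)"
  shows "wedge_left N w (form_map \<Omega> 1 N \<phi> t) = form_map \<Omega> 2 N \<phi> (wedge_left M w t)"
  by (rule form_additive_eqI[OF M abelian_group_form[OF N]
        additive_maps_compose[OF mod_hom_additive[OF form_map_linear[OF M N \<phi>]] wedge_left_additive[OF N w]]
        additive_maps_compose[OF wedge_left_additive[OF M w] mod_hom_additive[OF form_map_linear[OF M N \<phi>]]] _ t])
    (use w in \<open>simp_all add: form_map_pure[OF M N \<phi>] wedge_left_pure M N mod_hom_closed[OF \<phi>]\<close>)

section \<open>First jets\<close>

definition jet1_der
  where "jet1_der M x = form_cls \<Omega> 1 M (map (apfst (deriv \<Omega>)) (summands x))"

text \<open>The congruence behind first jets, as equality of the coordinates \<pi> and \<delta>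
  computed on formal sums. \<open>jet1_coset\<close> matches it with the cosets of
  \<open>jet1_rel\<close>, which lets \<open>jet1\<close> be treated by the same general theory as a
  tensor product.\<close>

definition jet1_eq
  where "jet1_eq M ts us \<longleftrightarrow> set ts \<subseteq> G 0 \<times> carrier M \<and> set us \<subseteq> G 0 \<times> carrier M \<and>
    lsum M (\<lambda>(a, m). a \<odot>\<^bsub>M\<^esub> m) ts = lsum M (\<lambda>(a, m). a \<odot>\<^bsub>M\<^esub> m) us \<and>
    form_cls \<Omega> 1 M (map (apfst (deriv \<Omega>)) ts) = form_cls \<Omega> 1 M (map (apfst (deriv \<Omega>)) us)"

lemma kmod_simps [simp]:
  "carrier (kmod \<Omega> M) = carrier M" "zero (kmod \<Omega> M) = zero M" "add (kmod \<Omega> M) = add M"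
  "c \<odot>\<^bsub>kmod \<Omega> M\<^esub> m = (c \<odot>\<^bsub>\<Omega>\<^esub> \<one>\<^bsub>\<Omega>\<^esub>) \<odot>\<^bsub>M\<^esub> m"
  by (simp_all add: kmod_def)

context
  fixes M :: "('w, ('w, 'e) univ) module"
  assumes M: "left_module (alg \<Omega>) M"
begin

interpretation M: left_module "alg \<Omega>" M by (rule M)

interpretation F: left_module "alg \<Omega>" "form_module \<Omega> 1 M" by (rule left_module_form[OF M])

abbreviation (input) "act_sum ts \<equiv> lsum M (\<lambda>(a, m). a \<odot>\<^bsub>M\<^esub> m) ts"

abbreviation (input) "der_sum ts \<equiv> form_cls \<Omega> 1 M (map (apfst (deriv \<Omega>)) ts)"

lemma act_sum_closed: "set ts \<subseteq> G 0 \<times> carrier M \<Longrightarrow> act_sum ts \<in> carrier M"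
  using smult_closed[OF M] by (intro lsum_closed[OF left_module_abelian_group[OF M]]) auto

lemma act_sum_append:
  "\<lbrakk>set ts \<subseteq> G 0 \<times> carrier M; set us \<subseteq> G 0 \<times> carrier M\<rbrakk> \<Longrightarrow>
    act_sum (ts @ us) = act_sum ts \<oplus>\<^bsub>M\<^esub> act_sum us"
  using smult_closed[OF M] by (intro lsum_append[OF left_module_abelian_group[OF M]]) auto

lemma der_sum_valid: "set ts \<subseteq> G 0 \<times> carrier M \<Longrightarrow> set (map (apfst (deriv \<Omega>)) ts) \<subseteq> G 1 \<times> carrier M"
  by (auto simp: apfst_def)

lemma der_sum_lsum:
  assumes "set ts \<subseteq> G 0 \<times> carrier M"
  shows "der_sum ts = lsum (form_module \<Omega> 1 M) (\<lambda>(a, m). pure 1 M (deriv \<Omega> a) m) ts"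
  using form_cls_lsum[OF M der_sum_valid[OF assms]] by (simp add: lsum_map case_prod_unfold apfst_eq)

lemma der_sum_closed: "set ts \<subseteq> G 0 \<times> carrier M \<Longrightarrow> der_sum ts \<in> carrier (form_module \<Omega> 1 M)"
  by (rule formal_sums.cls_closed[OF formal_sums_form[OF M] der_sum_valid])

lemma der_sum_append:
  "\<lbrakk>set ts \<subseteq> G 0 \<times> carrier M; set us \<subseteq> G 0 \<times> carrier M\<rbrakk> \<Longrightarrow>
    der_sum (ts @ us) = der_sum ts \<oplus>\<^bsub>form_module \<Omega> 1 M\<^esub> der_sum us"
  using formal_sums.cls_append[OF formal_sums_form[OF M] der_sum_valid der_sum_valid] by simp

lemma act_sum_smult:
  assumes "a \<in> G 0"
  shows "set ts \<subseteq> G 0 \<times> carrier M \<Longrightarrow> act_sum (map (apfst (\<lambda>x. a \<otimes>\<^bsub>\<Omega>\<^esub> x)) ts) = a \<odot>\<^bsub>M\<^esub> act_sum ts"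
proof (induction ts)
  case Nil
  then show ?case using assms by (simp add: left_module_smult_zero[OF M])
next
  case (Cons p ts)
  obtain b m where p: "p = (b, m)" "b \<in> G 0" "m \<in> carrier M" using Cons.prems by (cases p) auto
  then show ?case
    using Cons assms smult_closed[OF M] act_sum_closed[of ts] M.lsmult_assoc[of a b m]
      M.lsmult_r_distr[of a "b \<odot>\<^bsub>M\<^esub> m" "act_sum ts"]
    by simp
qed

text \<open>The rule \<open>d(a b) \<otimes> m = da \<otimes> b m + a db \<otimes> m\<close>, summed
  over the terms, collects its first parts into \<open>da\<close> tensored with the evaluated sum.
  This is the source of the Leibniz rule for \<delta>.\<close>

lemma der_sum_smult:
  assumes a: "a \<in> G 0" and "set ts \<subseteq> G 0 \<times> carrier M"
  shows "der_sum (map (apfst (\<lambda>x. a \<otimes>\<^bsub>\<Omega>\<^esub> x)) ts)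
    = pure 1 M (deriv \<Omega> a) (act_sum ts) \<oplus>\<^bsub>form_module \<Omega> 1 M\<^esub> a \<odot>\<^bsub>form_module \<Omega> 1 M\<^esub> der_sum ts"
proof -
  have *: "lsum (form_module \<Omega> 1 M) (\<lambda>(b, m). pure 1 M (deriv \<Omega> (a \<otimes>\<^bsub>\<Omega>\<^esub> b)) m) ts
    = pure 1 M (deriv \<Omega> a) (act_sum ts) \<oplus>\<^bsub>form_module \<Omega> 1 M\<^esub>
      a \<odot>\<^bsub>form_module \<Omega> 1 M\<^esub> lsum (form_module \<Omega> 1 M) (\<lambda>(b, m). pure 1 M (deriv \<Omega> b) m) ts"
    using assms(2)
  proof (induction ts)
    case Nil
    have "pure 1 M (deriv \<Omega> a) \<zero>\<^bsub>M\<^esub> = \<zero>\<^bsub>form_module \<Omega> 1 M\<^esub>"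
      by (rule additive_maps_zero[OF left_module_abelian_group[OF M] abelian_group_form[OF M]
            pure_additive_right[OF M]]) (simp add: a)
    then show ?case using a by (simp add: left_module_smult_zero[OF left_module_form[OF M]])
  next
    case (Cons p ts)
    obtain b m where p: "p = (b, m)" "b \<in> G 0" "m \<in> carrier M" using Cons.prems by (cases p) auto
    let ?L = "lsum (form_module \<Omega> 1 M) (\<lambda>(b, m). pure 1 M (deriv \<Omega> b) m) ts"
    have ts: "set ts \<subseteq> G 0 \<times> carrier M" using Cons.prems by simp
    have L: "?L \<in> carrier (form_module \<Omega> 1 M)"
      using der_sum_closed[OF ts] by (simp add: der_sum_lsum[OF ts])
    have cl: "pure 1 M v l \<in> carrier (form_module \<Omega> 1 M)" if "v \<in> G 1" "l \<in> carrier M" for v l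
      using pure_closed[OF M that] .
    have "pure 1 M (deriv \<Omega> (a \<otimes>\<^bsub>\<Omega>\<^esub> b)) m
        = pure 1 M (deriv \<Omega> a) (b \<odot>\<^bsub>M\<^esub> m) \<oplus>\<^bsub>form_module \<Omega> 1 M\<^esub> a \<odot>\<^bsub>form_module \<Omega> 1 M\<^esub> pure 1 M (deriv \<Omega> b) m"
      using a p by (simp add: deriv_mult pure_add_left[OF M] pure_balanced[OF M] pure_smult[OF M])
    moreover have "pure 1 M (deriv \<Omega> a) (b \<odot>\<^bsub>M\<^esub> m \<oplus>\<^bsub>M\<^esub> act_sum ts)
        = pure 1 M (deriv \<Omega> a) (b \<odot>\<^bsub>M\<^esub> m) \<oplus>\<^bsub>form_module \<Omega> 1 M\<^esub> pure 1 M (deriv \<Omega> a) (act_sum ts)"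
      using a p smult_closed[OF M] act_sum_closed[OF ts] by (intro pure_add_right[OF M]) simp_all
    moreover have "a \<odot>\<^bsub>form_module \<Omega> 1 M\<^esub> (pure 1 M (deriv \<Omega> b) m \<oplus>\<^bsub>form_module \<Omega> 1 M\<^esub> ?L)
        = a \<odot>\<^bsub>form_module \<Omega> 1 M\<^esub> pure 1 M (deriv \<Omega> b) m \<oplus>\<^bsub>form_module \<Omega> 1 M\<^esub> a \<odot>\<^bsub>form_module \<Omega> 1 M\<^esub> ?L"
      using a p L cl by (intro F.lsmult_r_distr) simp_all
    ultimately show ?case
      using Cons p a L cl smult_closed[OF M] act_sum_closed[OF ts] F.lsmult_closed
      by (simp add: F.M.a_ac)
  qed
  have "set (map (apfst (\<lambda>x. a \<otimes>\<^bsub>\<Omega>\<^esub> x)) ts) \<subseteq> G 0 \<times> carrier M"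
    using a assms(2) by (auto simp: apfst_eq)
  then show ?thesis
    unfolding der_sum_lsum[OF assms(2)] *[symmetric]
    by (simp only: der_sum_lsum lsum_map case_prod_unfold apfst_eq fst_conv snd_conv)
qed

section \<open>First jets as a quotient of \<open>A \<otimes>_K M\<close>\<close>

abbreviation (input) "ktensor_eq \<equiv> tensor_eq K (alg \<Omega>) (\<lambda>a c. c \<odot>\<^bsub>\<Omega>\<^esub> a) (kmod \<Omega> M)"

lemma formal_sums_ktensor: "formal_sums K \<Omega> 0 (carrier M) ktensor_eq (ktensor_cls K \<Omega> M) (ktensor K \<Omega> M)"
  using formal_sums_tensor[of 0 K "\<lambda>a c. c \<odot>\<^bsub>\<Omega>\<^esub> a" "kmod \<Omega> M"] smult_closed[OF M]
    abelian_groupE(1)[OF left_module_abelian_group[OF M]] smult_mult_right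
  by (simp add: ktensor_cls_def[abs_def] ktensor_def)

text \<open>Both coordinates are balanced over \<open>K\<close>: evaluation because
  \<open>c 1\<close> is central, differentiation because \<open>d(c a) = c da = da (c 1)\<close>. So
  they descend to \<open>A \<otimes>_K M\<close> before the jet relations are divided out.\<close>

lemma ktensor_eq_imp_jet1_eq:
  assumes "ktensor_eq ts us"
  shows "jet1_eq M ts us"
proof -
  interpret formal_sums K \<Omega> 0 "carrier M" ktensor_eq "ktensor_cls K \<Omega> M" "ktensor K \<Omega> M"
    by (rule formal_sums_ktensor)
  have valid: "set ts \<subseteq> G 0 \<times> carrier M" "set us \<subseteq> G 0 \<times> carrier M"
    using Q_valid[OF assms] by auto
  have "act_sum ts = act_sum us"
  proof (rule tensor_eq_lsum[OF assms left_module_abelian_group[OF M]])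
    show "\<zero>\<^bsub>alg \<Omega>\<^esub> \<odot>\<^bsub>M\<^esub> m = \<zero>\<^bsub>M\<^esub>" if "m \<in> carrier (kmod \<Omega> M)" for m
      using that left_module_zero_smult[OF M] by simp
    show "(c \<odot>\<^bsub>\<Omega>\<^esub> a) \<odot>\<^bsub>M\<^esub> m = a \<odot>\<^bsub>M\<^esub> (c \<odot>\<^bsub>kmod \<Omega> M\<^esub> m)"
      if "a \<in> carrier (alg \<Omega>)" "c \<in> carrier K" "m \<in> carrier (kmod \<Omega> M)" for a c m
      using that M.lsmult_assoc[of a "c \<odot>\<^bsub>\<Omega>\<^esub> \<one>\<^bsub>\<Omega>\<^esub>" m] smult_mult_one[of c a] by simp
  qed (use Q_valid M.lsmult_closed M.lsmult_l_distr M.lsmult_r_distr in simp_all)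
  moreover have "der_sum ts = der_sum us"
    unfolding der_sum_lsum[OF valid(1)] der_sum_lsum[OF valid(2)]
  proof (rule tensor_eq_lsum[OF assms abelian_group_form[OF M]])
    show "pure 1 M (deriv \<Omega> (c \<odot>\<^bsub>\<Omega>\<^esub> a)) m = pure 1 M (deriv \<Omega> a) (c \<odot>\<^bsub>kmod \<Omega> M\<^esub> m)"
      if "a \<in> carrier (alg \<Omega>)" "c \<in> carrier K" "m \<in> carrier (kmod \<Omega> M)" for a c m
      using that smult_mult_one[of c "deriv \<Omega> a"]
      by (simp add: deriv_smult[of _ _ 0] pure_balanced[OF M, symmetric])
  qed (use Q_valid in \<open>simp_all add: pure_closed[OF M] deriv_zero pure_zero_left[OF M] pure_add_left[OF M]
      pure_add_right[OF M] deriv_add[of _ 0]\<close>)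
  ultimately show ?thesis
    using valid by (simp add: jet1_eq_def)
qed

lemma jet1_eq_append:
  assumes "jet1_eq M ts ts'" and "jet1_eq M us us'"
  shows "jet1_eq M (ts @ us) (ts' @ us')"
  using assms by (simp add: jet1_eq_def act_sum_append der_sum_append del: map_append)

text \<open>The class of \<open>us\<close> lies in the coset of \<open>ts\<close> iff the difference
  has both coordinates zero, that is, iff the coordinates of \<open>us\<close> and \<open>ts\<close>
  agree.\<close>

lemma jet1_coset:
  assumes "set ts \<subseteq> G 0 \<times> carrier M"
  shows "jet1_rel K \<Omega> M +>\<^bsub>ktensor K \<Omega> M\<^esub> ktensor_cls K \<Omega> M ts = {ktensor_cls K \<Omega> M us |us. jet1_eq M ts us}"
    (is "?L = ?R")
proof -
  interpret T: formal_sums K \<Omega> 0 "carrier M" ktensor_eq "ktensor_cls K \<Omega> M" "ktensor K \<Omega> M"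
    by (rule formal_sums_ktensor)
  have coset: "?L = {h \<oplus>\<^bsub>ktensor K \<Omega> M\<^esub> ktensor_cls K \<Omega> M ts |h. h \<in> jet1_rel K \<Omega> M}"
    by (auto simp: a_r_coset_def')
  have rel: "jet1_rel K \<Omega> M = {ktensor_cls K \<Omega> M hs |hs. jet1_eq M hs []}"
    by (auto simp: jet1_rel_def jet1_eq_def formal_sums.zero_M[OF formal_sums_form[OF M]])
  have refl: "jet1_eq M us us" if "set us \<subseteq> G 0 \<times> carrier M" for us
    using that by (simp add: jet1_eq_def)
  have sym: "jet1_eq M us vs" if "jet1_eq M vs us" for us vs
    using that by (simp add: jet1_eq_def)
  have trans: "jet1_eq M us xs" if "jet1_eq M us vs" "jet1_eq M vs xs" for us vs xs
    using that by (simp add: jet1_eq_def)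
  show ?thesis
  proof
    show "?L \<subseteq> ?R"
    proof
      fix t assume "t \<in> ?L"
      then obtain hs where hs: "jet1_eq M hs []" "t = ktensor_cls K \<Omega> M hs \<oplus>\<^bsub>ktensor K \<Omega> M\<^esub> ktensor_cls K \<Omega> M ts"
        unfolding coset by (auto simp: rel)
      then have "t = ktensor_cls K \<Omega> M (hs @ ts)"
        using assms by (simp add: T.cls_append jet1_eq_def)
      moreover have "jet1_eq M ts (hs @ ts)"
        using jet1_eq_append[OF sym[OF hs(1)] refl[OF assms]] by simp
      ultimately show "t \<in> ?R" by blast
    qed
    show "?R \<subseteq> ?L"
    proof
      fix t assume "t \<in> ?R"
      then obtain us where us: "jet1_eq M ts us" "t = ktensor_cls K \<Omega> M us" by blast
      have us_valid: "set us \<subseteq> G 0 \<times> carrier M" using us by (simp add: jet1_eq_def)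
      \<comment> \<open>With negated coefficients, \<open>us @ ns\<close> represents the difference
        of \<open>us\<close> and \<open>ts\<close>, while \<open>ns @ ts\<close> cancels.\<close>
      define ns where "ns = map (apfst (\<lambda>x. \<ominus>\<^bsub>\<Omega>\<^esub> x)) ts"
      have ns: "set ns \<subseteq> G 0 \<times> carrier M" using assms by (auto simp: ns_def apfst_def)
      have nt: "ktensor_eq (ns @ ts) []" unfolding ns_def by (rule T.Q_action_minus[OF assms])
      have "ktensor_eq (us @ (ns @ ts)) (us @ [])"
        using nt us_valid by (intro T.Q_append T.Q_refl)
      then have "t = ktensor_cls K \<Omega> M (us @ (ns @ ts))"
        using T.Q_cls us(2) by simp
      also have "\<dots> = ktensor_cls K \<Omega> M (us @ ns) \<oplus>\<^bsub>ktensor K \<Omega> M\<^esub> ktensor_cls K \<Omega> M ts"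
        using us_valid ns assms by (simp add: T.cls_append)
      finally have "t = ktensor_cls K \<Omega> M (us @ ns) \<oplus>\<^bsub>ktensor K \<Omega> M\<^esub> ktensor_cls K \<Omega> M ts" .
      moreover have "jet1_eq M (us @ ns) []"
      proof -
        have "jet1_eq M (us @ ns) (ts @ ns)"
          by (rule jet1_eq_append[OF sym[OF us(1)] refl[OF ns]])
        moreover have "ktensor_eq (ts @ ns) (ns @ ts)"
          by (rule T.Q_commute[OF assms ns])
        then have "jet1_eq M (ts @ ns) []"
          using T.Q_trans nt ktensor_eq_imp_jet1_eq by blast
        ultimately show ?thesis by (rule trans)
      qed
      ultimately show "t \<in> ?L" unfolding coset by (auto simp: rel)
    qed
  qed
qed

lemma formal_sums_jet1: "formal_sums K \<Omega> 0 (carrier M) (jet1_eq M) (jet1_cls K \<Omega> M) (jet1 K \<Omega> M)"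
proof -
  interpret T: formal_sums K \<Omega> 0 "carrier M" ktensor_eq "ktensor_cls K \<Omega> M" "ktensor K \<Omega> M"
    by (rule formal_sums_ktensor)
  show ?thesis
  proof unfold_locales
    fix ts us assume *: "jet1_eq M ts us"
    \<comment> \<open>Equal predicates give equal cosets, hence the same chosen element.\<close>
    then have "jet1_eq M ts = jet1_eq M us" "set ts \<subseteq> G 0 \<times> carrier M" "set us \<subseteq> G 0 \<times> carrier M"
      by (auto simp: jet1_eq_def)
    then show "jet1_cls K \<Omega> M ts = jet1_cls K \<Omega> M us"
      unfolding jet1_cls_def by (simp add: jet1_coset)
    fix a assume "a \<in> G 0"
    then show "jet1_eq M (map (apfst (\<lambda>x. a \<otimes>\<^bsub>\<Omega>\<^esub> x)) ts) (map (apfst (\<lambda>x. a \<otimes>\<^bsub>\<Omega>\<^esub> x)) us)"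
      using * unfolding jet1_eq_def
      by (simp add: act_sum_smult der_sum_smult T.set_action del: map_map set_map)
  next
    fix ts assume ts: "set ts \<subseteq> G 0 \<times> carrier M"
    then have "jet1_eq M ts ts" by (simp add: jet1_eq_def)
    then have "ktensor_cls K \<Omega> M ts \<in> {ktensor_cls K \<Omega> M us |us. jet1_eq M ts us}" by blast
    \<comment> \<open>Two choices are nested here: an element of the coset, and a list representing
      that element of \<open>A \<otimes>_K M\<close>. Neither changes the coordinates.\<close>
    then have "jet1_cls K \<Omega> M ts \<in> {ktensor_cls K \<Omega> M us |us. jet1_eq M ts us}"
      unfolding jet1_cls_def jet1_coset[OF ts] by (rule someI)
    then obtain us where us: "jet1_cls K \<Omega> M ts = ktensor_cls K \<Omega> M us" "jet1_eq M ts us" by blast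
    then have "jet1_eq M us (summands (ktensor_cls K \<Omega> M us))"
      by (intro ktensor_eq_imp_jet1_eq T.Q_rep) (simp add: jet1_eq_def)
    then show "jet1_eq M ts (summands (jet1_cls K \<Omega> M ts))"
      using us by (simp add: jet1_eq_def)
  next
    show "jet1_eq M (ts @ us) (ts' @ us')" if "jet1_eq M ts ts'" "jet1_eq M us us'" for ts ts' us us'
      using that by (rule jet1_eq_append)
    show "jet1_eq M (ts @ us) (us @ ts)"
      if "set ts \<subseteq> G 0 \<times> carrier M" "set us \<subseteq> G 0 \<times> carrier M" for ts us
      using that by (intro ktensor_eq_imp_jet1_eq T.Q_commute)
    show "jet1_eq M [(\<zero>\<^bsub>\<Omega>\<^esub>, m)] []" if "m \<in> carrier M" for m
      using that by (intro ktensor_eq_imp_jet1_eq T.Q_zero)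
    show "jet1_eq M [(v \<oplus>\<^bsub>\<Omega>\<^esub> w, m)] [(v, m), (w, m)]" if "v \<in> G 0" "w \<in> G 0" "m \<in> carrier M" for v w m
      using that by (intro ktensor_eq_imp_jet1_eq T.Q_add)
  qed (auto simp: jet1_eq_def jet1_def)
qed

lemma left_module_jet1: "left_module (alg \<Omega>) (jet1 K \<Omega> M)"
  by (rule formal_sums.left_module_M[OF formal_sums_jet1])

lemma abelian_group_jet1: "abelian_group (jet1 K \<Omega> M)"
  by (rule formal_sums.abelian_group_M[OF formal_sums_jet1])

interpretation J: formal_sums K \<Omega> 0 "carrier M" "jet1_eq M" "jet1_cls K \<Omega> M" "jet1 K \<Omega> M"
  by (rule formal_sums_jet1)

lemma jet1_proj_cls: "set ts \<subseteq> G 0 \<times> carrier M \<Longrightarrow> jet1_proj M (jet1_cls K \<Omega> M ts) = act_sum ts"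
  unfolding jet1_proj_def by (rule J.lift_cls[OF left_module_abelian_group[OF M]])
    (auto simp: smult_closed[OF M] jet1_eq_def)

lemma jet1_der_cls: "set ts \<subseteq> G 0 \<times> carrier M \<Longrightarrow> jet1_der M (jet1_cls K \<Omega> M ts) = der_sum ts"
  using J.Q_rep[of ts] by (simp add: jet1_der_def jet1_eq_def)

lemma jet1_proj_linear: "jet1_proj M \<in> mod_hom (alg \<Omega>) (jet1 K \<Omega> M) M"
proof (rule J.linearI[OF M])
  show "jet1_proj M \<in> additive_maps (jet1 K \<Omega> M) M"
    unfolding jet1_proj_def[abs_def] by (rule J.lift_additive[OF left_module_abelian_group[OF M]])
      (auto simp: smult_closed[OF M] jet1_eq_def)
qed (use M.lsmult_assoc in \<open>auto simp: jet1_proj_cls smult_closed[OF M]\<close>)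

lemma jet1_proj_closed: "x \<in> carrier (jet1 K \<Omega> M) \<Longrightarrow> jet1_proj M x \<in> carrier M"
  by (rule mod_hom_closed[OF jet1_proj_linear])

lemma jet1_der_additive: "jet1_der M \<in> additive_maps (jet1 K \<Omega> M) (form_module \<Omega> 1 M)"
  unfolding jet1_der_def[abs_def]
proof (rule map_summands_additive[OF J.formal_sums_axioms formal_sums_form[OF M]])
  show "form_eq 1 M (map (apfst (deriv \<Omega>)) ts) (map (apfst (deriv \<Omega>)) us)" if "jet1_eq M ts us" for ts us
    using that formal_sums.cls_eq_iff[OF formal_sums_form[OF M] der_sum_valid der_sum_valid]
    unfolding jet1_eq_def by blast
qed auto

lemma jet1_der_closed: "x \<in> carrier (jet1 K \<Omega> M) \<Longrightarrow> jet1_der M x \<in> carrier (form_module \<Omega> 1 M)"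
  by (rule additive_maps_closed[OF jet1_der_additive])

lemma jet1_der_smult:
  assumes "a \<in> G 0" and "x \<in> carrier (jet1 K \<Omega> M)"
  shows "jet1_der M (a \<odot>\<^bsub>jet1 K \<Omega> M\<^esub> x)
    = pure 1 M (deriv \<Omega> a) (jet1_proj M x) \<oplus>\<^bsub>form_module \<Omega> 1 M\<^esub> a \<odot>\<^bsub>form_module \<Omega> 1 M\<^esub> jet1_der M x"
proof -
  obtain ts where ts: "set ts \<subseteq> G 0 \<times> carrier M" "x = jet1_cls K \<Omega> M ts"
    using assms(2) by (auto simp: J.carrier_M)
  then show ?thesis
    using J.set_action[OF assms(1) ts(1)] assms(1)
    by (simp add: J.smult_cls jet1_der_cls jet1_proj_cls der_sum_smult del: map_map set_map)
qed

text \<open>Immediate from \<open>jet1_eq\<close> being equality of coordinates. From here on,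
  identities between first jets are proved by comparing coordinates instead of
  representatives.\<close>

lemma jet1_eqI:
  assumes "x \<in> carrier (jet1 K \<Omega> M)" and "y \<in> carrier (jet1 K \<Omega> M)"
    and "jet1_proj M x = jet1_proj M y" and "jet1_der M x = jet1_der M y"
  shows "x = y"
proof -
  obtain ts where ts: "set ts \<subseteq> G 0 \<times> carrier M" "x = jet1_cls K \<Omega> M ts"
    using assms(1) by (auto simp: J.carrier_M)
  obtain us where us: "set us \<subseteq> G 0 \<times> carrier M" "y = jet1_cls K \<Omega> M us"
    using assms(2) by (auto simp: J.carrier_M)
  have "jet1_eq M ts us"
    using assms(3,4) ts us by (simp add: jet1_eq_def jet1_proj_cls jet1_der_cls)
  then show ?thesis
    using J.Q_cls ts us by simp
qed

text \<open>The prolongation of \<open>m\<close> has coordinates \<open>(m, 0)\<close> because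
  \<open>d1 = 0\<close>.\<close>

lemma
  assumes "m \<in> carrier M"
  shows jet1_prolong_closed: "jet1_prolong K \<Omega> M m \<in> carrier (jet1 K \<Omega> M)"
    and jet1_proj_prolong: "jet1_proj M (jet1_prolong K \<Omega> M m) = m"
    and jet1_der_prolong: "jet1_der M (jet1_prolong K \<Omega> M m) = \<zero>\<^bsub>form_module \<Omega> 1 M\<^esub>"
  using assms M.lsmult_one[of m]
  by (auto simp: jet1_prolong_def jet1_proj_cls jet1_der_cls deriv_one pure_zero_left[OF M] intro!: J.cls_closed)

end

end

context exterior_algebra
begin

section \<open>Maps between jet modules\<close>

context
  fixes M N :: "('w, ('w, 'e) univ) module" and \<phi> :: "('w, 'e) univ \<Rightarrow> ('w, 'e) univ"
  assumes M: "left_module (alg \<Omega>) M" and N: "left_module (alg \<Omega>) N" and \<phi>: "\<phi> \<in> mod_hom (alg \<Omega>) M N"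
begin

text \<open>On representatives \<phi> acts on the module entries and \<open>deriv\<close> on the
  coefficients, so the two operations do not interfere.\<close>

lemma
  assumes x: "x \<in> carrier (jet1 K \<Omega> M)"
  shows jet1_map_closed: "jet1_map K \<Omega> N \<phi> x \<in> carrier (jet1 K \<Omega> N)"
    and jet1_proj_map: "jet1_proj N (jet1_map K \<Omega> N \<phi> x) = \<phi> (jet1_proj M x)"
    and jet1_der_map: "jet1_der N (jet1_map K \<Omega> N \<phi> x) = form_map \<Omega> 1 N \<phi> (jet1_der M x)"
proof -
  interpret M: left_module "alg \<Omega>" M by (rule M)
  have ts: "set (summands x) \<subseteq> G 0 \<times> carrier M"
    by (rule formal_sums.summands_valid[OF formal_sums_jet1[OF M] x])
  have us: "set (map (apsnd \<phi>) (summands x)) \<subseteq> G 0 \<times> carrier N"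
    using ts mod_hom_closed[OF \<phi>] by (auto simp: apsnd_def)
  show "jet1_map K \<Omega> N \<phi> x \<in> carrier (jet1 K \<Omega> N)"
    unfolding jet1_map_def by (rule formal_sums.cls_closed[OF formal_sums_jet1[OF N] us])
  have "lsum N (\<lambda>(a, m). a \<odot>\<^bsub>N\<^esub> m) (map (apsnd \<phi>) (summands x)) = lsum N (\<lambda>p. \<phi> (fst p \<odot>\<^bsub>M\<^esub> snd p)) (summands x)"
    unfolding lsum_map using ts mod_hom_smult[OF \<phi>] by (intro lsum_cong) auto
  also have "\<dots> = \<phi> (lsum M (\<lambda>p. fst p \<odot>\<^bsub>M\<^esub> snd p) (summands x))"
    by (rule additive_maps_lsum[OF left_module_abelian_group[OF M] left_module_abelian_group[OF N]
          mod_hom_additive[OF \<phi>], symmetric]) (use ts smult_closed[OF M] in auto)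
  finally show "jet1_proj N (jet1_map K \<Omega> N \<phi> x) = \<phi> (jet1_proj M x)"
    unfolding jet1_map_def jet1_proj_cls[OF N us] by (simp add: jet1_proj_def case_prod_unfold)
  have "map (apfst (deriv \<Omega>)) (map (apsnd \<phi>) (summands x)) = map (apsnd \<phi>) (map (apfst (deriv \<Omega>)) (summands x))"
    by auto
  then have "jet1_der N (jet1_map K \<Omega> N \<phi> x) = form_cls \<Omega> 1 N (map (apsnd \<phi>) (map (apfst (deriv \<Omega>)) (summands x)))"
    unfolding jet1_map_def jet1_der_cls[OF N us] by (simp only:)
  then show "jet1_der N (jet1_map K \<Omega> N \<phi> x) = form_map \<Omega> 1 N \<phi> (jet1_der M x)"
    unfolding jet1_der_def[of M] form_map_cls[OF M N \<phi> der_sum_valid[OF M ts]] .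
qed

text \<open>Checked in coordinates: \<phi> and \<open>\<Omega>^1(\<phi>)\<close> are linear, and the
  Leibniz term \<open>da \<otimes> \<pi> x\<close> is sent to the corresponding term for the
  image.\<close>

lemma jet1_map_linear: "jet1_map K \<Omega> N \<phi> \<in> mod_hom (alg \<Omega>) (jet1 K \<Omega> M) (jet1 K \<Omega> N)"
proof (rule mod_homI)
  interpret JM: left_module "alg \<Omega>" "jet1 K \<Omega> M" by (rule left_module_jet1[OF M])
  interpret JN: left_module "alg \<Omega>" "jet1 K \<Omega> N" by (rule left_module_jet1[OF N])
  note F = form_map_linear[OF M N \<phi>, of 1]
  fix x assume x: "x \<in> carrier (jet1 K \<Omega> M)"
  { fix y assume y: "y \<in> carrier (jet1 K \<Omega> M)"
    show "jet1_map K \<Omega> N \<phi> (x \<oplus>\<^bsub>jet1 K \<Omega> M\<^esub> y) = jet1_map K \<Omega> N \<phi> x \<oplus>\<^bsub>jet1 K \<Omega> N\<^esub> jet1_map K \<Omega> N \<phi> y"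
      by (rule jet1_eqI[OF N])
        (use x y in \<open>simp_all add: jet1_map_closed jet1_proj_map jet1_der_map mod_hom_add[OF jet1_proj_linear] M N
          additive_maps_add[OF jet1_der_additive] mod_hom_add[OF \<phi>] mod_hom_add[OF F] jet1_proj_closed jet1_der_closed\<close>) }
  { fix a assume a: "a \<in> carrier (alg \<Omega>)"
    show "jet1_map K \<Omega> N \<phi> (a \<odot>\<^bsub>jet1 K \<Omega> M\<^esub> x) = a \<odot>\<^bsub>jet1 K \<Omega> N\<^esub> jet1_map K \<Omega> N \<phi> x"
      by (rule jet1_eqI[OF N])
        (use x a in \<open>simp_all add: jet1_map_closed jet1_proj_map jet1_der_map mod_hom_smult[OF jet1_proj_linear] M N
          jet1_der_smult mod_hom_smult[OF \<phi>] mod_hom_smult[OF F] mod_hom_add[OF F] jet1_proj_closed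
          jet1_der_closed form_map_pure[OF M N \<phi>] smult_closed[OF left_module_jet1] pure_closed
          smult_closed[OF left_module_form]\<close>) }
qed (simp add: jet1_map_closed)

end

section \<open>The embedding of one-forms into first jets\<close>

context
  fixes M :: "('w, ('w, 'e) univ) module"
  assumes M: "left_module (alg \<Omega>) M"
begin

interpretation M: left_module "alg \<Omega>" M by (rule M)

interpretation F: formal_sums K \<Omega> 1 "carrier M" "form_eq 1 M" "form_cls \<Omega> 1 M" "form_module \<Omega> 1 M"
  by (rule formal_sums_form[OF M])

interpretation F: left_module "alg \<Omega>" "form_module \<Omega> 1 M" by (rule left_module_form[OF M])

interpretation F2: left_module "alg \<Omega>" "form_module \<Omega> 2 M" by (rule left_module_form[OF M])

interpretation J: formal_sums K \<Omega> 0 "carrier M" "jet1_eq M" "jet1_cls K \<Omega> M" "jet1 K \<Omega> M"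
  by (rule formal_sums_jet1[OF M])

interpretation J: left_module "alg \<Omega>" "jet1 K \<Omega> M" by (rule left_module_jet1[OF M])

abbreviation (input) "exact_valid zs \<equiv> set zs \<subseteq> G 0 \<times> G 0 \<times> carrier M"

abbreviation (input) "exact_form zs \<equiv> form_cls \<Omega> 1 M (map (\<lambda>(a, b, m). (a \<otimes>\<^bsub>\<Omega>\<^esub> deriv \<Omega> b, m)) zs)"

abbreviation (input) "exact_jet zs \<equiv> lsum (jet1 K \<Omega> M)
  (\<lambda>(a, b, m). jet1_cls K \<Omega> M [(a, b \<odot>\<^bsub>M\<^esub> m)] \<ominus>\<^bsub>jet1 K \<Omega> M\<^esub> jet1_cls K \<Omega> M [(a \<otimes>\<^bsub>\<Omega>\<^esub> b, m)]) zs"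

lemma exact_form_append:
  assumes "exact_valid ys" and "exact_valid zs"
  shows "exact_form (ys @ zs) = exact_form ys \<oplus>\<^bsub>form_module \<Omega> 1 M\<^esub> exact_form zs"
proof -
  have "set (map (\<lambda>(a, b, m). (a \<otimes>\<^bsub>\<Omega>\<^esub> deriv \<Omega> b, m)) xs) \<subseteq> G 1 \<times> carrier M" if "exact_valid xs" for xs
    using that by auto
  then show ?thesis
    using assms by (simp only: map_append F.cls_append)
qed

text \<open>One-forms are sums of terms \<open>a db\<close>, so every element of
  \<open>\<Omega>^1 \<otimes> M\<close> has a presentation of the kind quantified over in
  \<open>jet1_iota\<close>.\<close>

lemma exact_form_exists:
  assumes "t \<in> carrier (form_module \<Omega> 1 M)"
  shows "\<exists>zs. exact_valid zs \<and> t = exact_form zs"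
proof -
  have pure: "\<exists>zs. exact_valid zs \<and> pure 1 M w m = exact_form zs" if "w \<in> G 1" "m \<in> carrier M" for w m
    using that(1)
  proof (induction w rule: one_form_induct)
    case zero
    then show ?case using that(2)
      by (intro exI[of _ "[]"]) (simp add: pure_zero_left[OF M] F.zero_M)
  next
    case (exact a b)
    then show ?case using that(2) by (intro exI[of _ "[(a, b, m)]"]) simp
  next
    case (add v w)
    then obtain ys zs where "exact_valid ys" "exact_valid zs" "pure 1 M v m = exact_form ys" "pure 1 M w m = exact_form zs"
      by blast
    then show ?case
      using add(1,2) that(2) exact_form_append[of ys zs]
      by (intro exI[of _ "ys @ zs"]) (simp add: pure_add_left[OF M])
  qed
  obtain ts where ts: "set ts \<subseteq> G 1 \<times> carrier M" "t = form_cls \<Omega> 1 M ts"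
    using assms by (auto simp: F.carrier_M)
  show ?thesis
    using ts(1) unfolding ts(2)
  proof (induction ts)
    case Nil
    then show ?case by (intro exI[of _ "[]"]) simp
  next
    case (Cons p ts)
    obtain w m where p: "p = (w, m)" "w \<in> G 1" "m \<in> carrier M" using Cons.prems by (cases p) auto
    obtain ys where "exact_valid ys" "pure 1 M w m = exact_form ys" using pure p by blast
    moreover obtain zs where "exact_valid zs" "form_cls \<Omega> 1 M ts = exact_form zs" using Cons by auto
    ultimately show ?case
      using exact_form_append[of ys zs] F.cls_append[of "[p]" ts] p Cons.prems
      by (intro exI[of _ "ys @ zs"]) simp
  qed
qed

text \<open>The coordinates of the candidate value depend on the presentation \<open>zs\<close> only
  through the form that it presents. With \<open>jet1_eqI\<close>, this makes the description in
  \<open>jet1_iota\<close> unambiguous.\<close>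

lemma
  assumes "exact_valid zs"
  shows exact_jet_closed: "exact_jet zs \<in> carrier (jet1 K \<Omega> M)"
    and jet1_proj_exact: "jet1_proj M (exact_jet zs) = \<zero>\<^bsub>M\<^esub>"
    and jet1_der_exact: "jet1_der M (exact_jet zs) = \<ominus>\<^bsub>form_module \<Omega> 1 M\<^esub> exact_form zs"
proof -
  have cl: "jet1_cls K \<Omega> M [(a, m)] \<in> carrier (jet1 K \<Omega> M)" if "a \<in> G 0" "m \<in> carrier M" for a m
    using that by (intro J.cls_closed) simp
  have "exact_jet zs \<in> carrier (jet1 K \<Omega> M) \<and> jet1_proj M (exact_jet zs) = \<zero>\<^bsub>M\<^esub> \<and>
      jet1_der M (exact_jet zs) = \<ominus>\<^bsub>form_module \<Omega> 1 M\<^esub> exact_form zs"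
    using assms
  proof (induction zs)
    case Nil
    then show ?case
      by (simp add: F.zero_M[symmetric]
          additive_maps_zero[OF abelian_group_jet1[OF M] abelian_group_form[OF M] jet1_der_additive[OF M]]
          additive_maps_zero[OF abelian_group_jet1[OF M] left_module_abelian_group[OF M] mod_hom_additive[OF jet1_proj_linear[OF M]]])
  next
    case (Cons z zs)
    obtain a b m where z: "z = (a, b, m)" "a \<in> G 0" "b \<in> G 0" "m \<in> carrier M" using Cons.prems by (cases z) auto
    let ?x = "jet1_cls K \<Omega> M [(a, b \<odot>\<^bsub>M\<^esub> m)]" and ?y = "jet1_cls K \<Omega> M [(a \<otimes>\<^bsub>\<Omega>\<^esub> b, m)]"
    have xy: "?x \<in> carrier (jet1 K \<Omega> M)" "?y \<in> carrier (jet1 K \<Omega> M)"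
      using z smult_closed[OF M] by (simp_all add: cl)
    have IH: "exact_jet zs \<in> carrier (jet1 K \<Omega> M)" "jet1_proj M (exact_jet zs) = \<zero>\<^bsub>M\<^esub>"
      "jet1_der M (exact_jet zs) = \<ominus>\<^bsub>form_module \<Omega> 1 M\<^esub> exact_form zs"
      using Cons by auto
    have "jet1_proj M ?x = jet1_proj M ?y"
      using z smult_closed[OF M] M.lsmult_assoc[of a b m] by (simp add: jet1_proj_cls[OF M])
    then have proj: "jet1_proj M (?x \<ominus>\<^bsub>jet1 K \<Omega> M\<^esub> ?y) = \<zero>\<^bsub>M\<^esub>"
      using xy by (simp add: additive_maps_diff[OF abelian_group_jet1[OF M] left_module_abelian_group[OF M]
            mod_hom_additive[OF jet1_proj_linear[OF M]]] jet1_proj_closed[OF M] M.r_neg M.minus_eq)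
    \<comment> \<open>In \<open>d(a b) \<otimes> m\<close> the part
      \<open>da b \<otimes> m = da \<otimes> b m\<close> is the derivative of \<open>?x\<close>; it
      cancels in the difference and leaves \<open>a db \<otimes> m\<close> with a minus
      sign.\<close>
    have "jet1_der M ?y = jet1_der M ?x \<oplus>\<^bsub>form_module \<Omega> 1 M\<^esub> pure 1 M (a \<otimes>\<^bsub>\<Omega>\<^esub> deriv \<Omega> b) m"
      using z smult_closed[OF M]
      by (simp add: jet1_der_cls[OF M] deriv_mult pure_add_left[OF M] pure_balanced[OF M, symmetric])
    then have der: "jet1_der M (?x \<ominus>\<^bsub>jet1 K \<Omega> M\<^esub> ?y) = \<ominus>\<^bsub>form_module \<Omega> 1 M\<^esub> pure 1 M (a \<otimes>\<^bsub>\<Omega>\<^esub> deriv \<Omega> b) m"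
      using xy z pure_closed[OF M, of "a \<otimes>\<^bsub>\<Omega>\<^esub> deriv \<Omega> b" 1 m] jet1_der_closed[OF M xy(1)]
      by (simp add: additive_maps_diff[OF abelian_group_jet1[OF M] abelian_group_form[OF M]
            jet1_der_additive[OF M]] F.M.minus_eq F.M.minus_add F.M.r_neg2)
    have valid: "exact_valid [z]" "exact_valid zs" using Cons.prems by auto
    have "exact_form (z # zs) = pure 1 M (a \<otimes>\<^bsub>\<Omega>\<^esub> deriv \<Omega> b) m \<oplus>\<^bsub>form_module \<Omega> 1 M\<^esub> exact_form zs"
      using exact_form_append[OF valid] z by simp
    moreover have "exact_form zs \<in> carrier (form_module \<Omega> 1 M)"
      using valid(2) by (intro F.cls_closed) auto
    ultimately show ?case
      using IH proj der xy z pure_closed[OF M, of "a \<otimes>\<^bsub>\<Omega>\<^esub> deriv \<Omega> b" 1 m]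
      by (simp add: mod_hom_add[OF jet1_proj_linear[OF M]] additive_maps_add[OF jet1_der_additive[OF M]]
          F.M.minus_add J.M.minus_closed)
  qed
  then show "exact_jet zs \<in> carrier (jet1 K \<Omega> M)" "jet1_proj M (exact_jet zs) = \<zero>\<^bsub>M\<^esub>"
    "jet1_der M (exact_jet zs) = \<ominus>\<^bsub>form_module \<Omega> 1 M\<^esub> exact_form zs" by auto
qed

lemma
  assumes t: "t \<in> carrier (form_module \<Omega> 1 M)"
  shows jet1_iota_closed: "jet1_iota K \<Omega> M t \<in> carrier (jet1 K \<Omega> M)"
    and jet1_proj_iota: "jet1_proj M (jet1_iota K \<Omega> M t) = \<zero>\<^bsub>M\<^esub>"
    and jet1_der_iota: "jet1_der M (jet1_iota K \<Omega> M t) = \<ominus>\<^bsub>form_module \<Omega> 1 M\<^esub> t"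
proof -
  obtain zs where zs: "exact_valid zs" "t = exact_form zs"
    using exact_form_exists[OF t] by blast
  have "jet1_iota K \<Omega> M t = exact_jet zs"
    unfolding jet1_iota_def
  proof (rule the_equality)
    fix x assume "\<exists>ys. set ys \<subseteq> carrier (alg \<Omega>) \<times> carrier (alg \<Omega>) \<times> carrier M \<and>
       t = exact_form ys \<and> x = exact_jet ys"
    then obtain ys where "exact_valid ys" "t = exact_form ys" "x = exact_jet ys"
      by auto
    then show "x = exact_jet zs"
      using zs exact_jet_closed jet1_proj_exact jet1_der_exact by (rule_tac jet1_eqI[OF M]) simp_all
  qed (use zs in auto)
  then show "jet1_iota K \<Omega> M t \<in> carrier (jet1 K \<Omega> M)" "jet1_proj M (jet1_iota K \<Omega> M t) = \<zero>\<^bsub>M\<^esub>"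
    "jet1_der M (jet1_iota K \<Omega> M t) = \<ominus>\<^bsub>form_module \<Omega> 1 M\<^esub> t"
    using zs exact_jet_closed jet1_proj_exact jet1_der_exact by auto
qed

text \<open>\<pi> vanishes on the image, so the inhomogeneous Leibniz term is
  \<open>da \<otimes> 0\<close>: on this part of the jets \<delta> is linear.\<close>

lemma jet1_iota_linear: "jet1_iota K \<Omega> M \<in> mod_hom (alg \<Omega>) (form_module \<Omega> 1 M) (jet1 K \<Omega> M)"
proof (rule mod_homI)
  fix t assume t: "t \<in> carrier (form_module \<Omega> 1 M)"
  { fix u assume u: "u \<in> carrier (form_module \<Omega> 1 M)"
    show "jet1_iota K \<Omega> M (t \<oplus>\<^bsub>form_module \<Omega> 1 M\<^esub> u) = jet1_iota K \<Omega> M t \<oplus>\<^bsub>jet1 K \<Omega> M\<^esub> jet1_iota K \<Omega> M u"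
      by (rule jet1_eqI[OF M])
        (use t u in \<open>simp_all add: jet1_iota_closed jet1_proj_iota jet1_der_iota mod_hom_add[OF jet1_proj_linear[OF M]]
          additive_maps_add[OF jet1_der_additive[OF M]] F.M.minus_add\<close>) }
  fix a assume a: "a \<in> carrier (alg \<Omega>)"
  have "pure 1 M (deriv \<Omega> a) \<zero>\<^bsub>M\<^esub> = \<zero>\<^bsub>form_module \<Omega> 1 M\<^esub>"
    by (rule additive_maps_zero[OF left_module_abelian_group[OF M] abelian_group_form[OF M] pure_additive_right[OF M]])
      (use a in simp)
  moreover have "a \<odot>\<^bsub>form_module \<Omega> 1 M\<^esub> (\<ominus>\<^bsub>form_module \<Omega> 1 M\<^esub> t) = \<ominus>\<^bsub>form_module \<Omega> 1 M\<^esub> (a \<odot>\<^bsub>form_module \<Omega> 1 M\<^esub> t)"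
    by (rule additive_maps_minus[OF abelian_group_form[OF M] abelian_group_form[OF M]
          left_module_smult_additive[OF left_module_form[OF M] a] t])
  ultimately show "jet1_iota K \<Omega> M (a \<odot>\<^bsub>form_module \<Omega> 1 M\<^esub> t) = a \<odot>\<^bsub>jet1 K \<Omega> M\<^esub> jet1_iota K \<Omega> M t"
    using t a by (rule_tac jet1_eqI[OF M])
      (simp_all add: jet1_iota_closed jet1_proj_iota jet1_der_iota mod_hom_smult[OF jet1_proj_linear[OF M]]
          jet1_der_smult[OF M] smult_closed[OF left_module_form[OF M]] smult_closed[OF left_module_jet1[OF M]]
          left_module_smult_zero[OF M])
qed (simp add: jet1_iota_closed)

section \<open>The holonomy conditions\<close>

interpretation JJ: formal_sums K \<Omega> 0 "carrier (jet1 K \<Omega> M)" "jet1_eq (jet1 K \<Omega> M)"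
    "jet1_cls K \<Omega> (jet1 K \<Omega> M)" "jet1 K \<Omega> (jet1 K \<Omega> M)"
  by (rule formal_sums_jet1[OF left_module_jet1[OF M]])

text \<open>With \<open>x\<close> a sum of terms \<open>a \<otimes> y\<close>, apply \<delta> to
  \<open>\<pi> x\<close>, the sum of the \<open>a y\<close>. The Leibniz rule yields
  \<open>da \<otimes> \<pi> y\<close>, which sums to \<open>\<Omega>^1(\<pi>) (\<delta> x)\<close>,
  and \<open>a (\<delta> y)\<close>, which sums to \<open>D_I x\<close>.\<close>

lemma D_I_eq:
  assumes x: "x \<in> carrier (jet1 K \<Omega> (jet1 K \<Omega> M))"
  shows "D_I \<Omega> M x = jet1_der M (jet1_proj (jet1 K \<Omega> M) x) \<ominus>\<^bsub>form_module \<Omega> 1 M\<^esub>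
    form_map \<Omega> 1 M (jet1_proj M) (jet1_der (jet1 K \<Omega> M) x)"
proof -
  let ?F = "form_module \<Omega> 1 M" and ?J = "jet1 K \<Omega> M" and ?ts = "summands x"
  have ts: "set ?ts \<subseteq> G 0 \<times> carrier ?J" by (rule JJ.summands_valid[OF x])
  let ?us = "map (\<lambda>(a, y). map (apfst (\<lambda>v. a \<otimes>\<^bsub>\<Omega>\<^esub> deriv \<Omega> v)) (summands y)) ?ts"
  have dv: "set (map (apfst (deriv \<Omega>)) (summands y)) \<subseteq> G 1 \<times> carrier M" if "y \<in> carrier ?J" for y
    using der_sum_valid[OF M J.summands_valid[OF that]] .
  have split: "map (apfst (\<lambda>v. a \<otimes>\<^bsub>\<Omega>\<^esub> deriv \<Omega> v)) zs
      = map (apfst (\<lambda>v. a \<otimes>\<^bsub>\<Omega>\<^esub> v)) (map (apfst (deriv \<Omega>)) zs)" for a and zs :: "('w \<times> ('w, 'e) univ) list"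
    by (simp add: apfst_eq)
  have "D_I \<Omega> M x = form_cls \<Omega> 1 M (concat ?us)"
    unfolding D_I_def flatten_def by (simp add: apfst_def map_prod_def)
  also have "\<dots> = lsum ?F (form_cls \<Omega> 1 M) ?us"
  proof (rule F.cls_concat)
    fix us assume "us \<in> set ?us"
    then obtain a y where "a \<in> G 0" "y \<in> carrier ?J" "us = map (apfst (\<lambda>v. a \<otimes>\<^bsub>\<Omega>\<^esub> deriv \<Omega> v)) (summands y)"
      using ts by auto
    then show "set us \<subseteq> G 1 \<times> carrier M"
      using F.set_action[OF _ dv[of y]] by (simp only: split)
  qed
  also have "\<dots> = lsum ?F (\<lambda>p. fst p \<odot>\<^bsub>?F\<^esub> jet1_der M (snd p)) ?ts"
    unfolding lsum_map
  proof (rule lsum_cong)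
    fix p assume "p \<in> set ?ts"
    with ts obtain a y where p: "p = (a, y)" "a \<in> G 0" "y \<in> carrier ?J" by auto
    then show "form_cls \<Omega> 1 M (case p of (a, y) \<Rightarrow> map (apfst (\<lambda>v. a \<otimes>\<^bsub>\<Omega>\<^esub> deriv \<Omega> v)) (summands y))
        = fst p \<odot>\<^bsub>?F\<^esub> jet1_der M (snd p)"
      using F.smult_cls[OF p(2) dv[OF p(3)]] by (simp add: split jet1_der_def del: map_map)
  qed
  finally have D: "D_I \<Omega> M x = lsum ?F (\<lambda>p. fst p \<odot>\<^bsub>?F\<^esub> jet1_der M (snd p)) ?ts" .
  have cl1: "pure 1 M (deriv \<Omega> (fst p)) (jet1_proj M (snd p)) \<in> carrier ?F"
    and cl2: "fst p \<odot>\<^bsub>?F\<^esub> jet1_der M (snd p) \<in> carrier ?F" if "p \<in> set ?ts" for p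
    using that ts jet1_proj_closed[OF M] jet1_der_closed[OF M] smult_closed[OF left_module_form[OF M]]
    by (auto intro!: pure_closed[OF M])
  have "jet1_der M (jet1_proj ?J x) = lsum ?F (\<lambda>p. jet1_der M (fst p \<odot>\<^bsub>?J\<^esub> snd p)) ?ts"
    unfolding jet1_proj_def case_prod_unfold
    using ts smult_closed[OF left_module_jet1[OF M]]
    by (intro additive_maps_lsum[OF abelian_group_jet1[OF M] abelian_group_form[OF M] jet1_der_additive[OF M]]) auto
  also have "\<dots> = lsum ?F (\<lambda>p. pure 1 M (deriv \<Omega> (fst p)) (jet1_proj M (snd p)) \<oplus>\<^bsub>?F\<^esub> fst p \<odot>\<^bsub>?F\<^esub> jet1_der M (snd p)) ?ts"
    using ts by (intro lsum_cong) (auto simp: jet1_der_smult[OF M])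
  also have "\<dots> = lsum ?F (\<lambda>p. pure 1 M (deriv \<Omega> (fst p)) (jet1_proj M (snd p))) ?ts \<oplus>\<^bsub>?F\<^esub> D_I \<Omega> M x"
    unfolding D by (rule lsum_plus[OF abelian_group_form[OF M] cl1 cl2])
  also have "lsum ?F (\<lambda>p. pure 1 M (deriv \<Omega> (fst p)) (jet1_proj M (snd p))) ?ts
      = form_map \<Omega> 1 M (jet1_proj M) (jet1_der ?J x)"
  proof -
    have v: "set (map (apsnd (jet1_proj M)) (map (apfst (deriv \<Omega>)) ?ts)) \<subseteq> G 1 \<times> carrier M"
      using ts jet1_proj_closed[OF M] by auto
    have "form_map \<Omega> 1 M (jet1_proj M) (jet1_der ?J x)
        = form_cls \<Omega> 1 M (map (apsnd (jet1_proj M)) (map (apfst (deriv \<Omega>)) ?ts))"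
      unfolding jet1_der_def
      by (rule form_map_cls[OF left_module_jet1[OF M] M jet1_proj_linear[OF M] der_sum_valid[OF left_module_jet1[OF M] ts]])
    also have "\<dots> = lsum ?F (\<lambda>p. pure 1 M (deriv \<Omega> (fst p)) (jet1_proj M (snd p))) ?ts"
      unfolding form_cls_lsum[OF M v] lsum_map by (intro lsum_cong) auto
    finally show ?thesis by simp
  qed
  finally have eq: "jet1_der M (jet1_proj ?J x) = form_map \<Omega> 1 M (jet1_proj M) (jet1_der ?J x) \<oplus>\<^bsub>?F\<^esub> D_I \<Omega> M x" .
  have "D_I \<Omega> M x \<in> carrier ?F"
    unfolding D by (rule lsum_closed[OF abelian_group_form[OF M] cl2])
  moreover have "form_map \<Omega> 1 M (jet1_proj M) (jet1_der ?J x) \<in> carrier ?F"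
    using mod_hom_closed[OF form_map_linear[OF left_module_jet1[OF M] M jet1_proj_linear[OF M]]
        jet1_der_closed[OF left_module_jet1[OF M] x]] .
  ultimately show ?thesis
    unfolding eq by (simp add: F.M.minus_eq F.M.a_ac F.M.r_neg F.M.r_neg2)
qed

text \<open>
  The map \<open>w \<otimes> x \<mapsto> w \<and> \<delta> x\<close> alone, with \<open>\<delta> [c \<otimes> e] = dc \<otimes> e\<close>, is not balanced over \<open>A\<close>, since
  \<open>\<delta>\<close> is not \<open>A\<close>-linear; the second term corrects this and vanishes when \<open>w\<close> is exact.
\<close>

definition jet1_wedge
  where "jet1_wedge t = lsum (form_module \<Omega> 2 M)
    (\<lambda>(w, x). wedge_left M w (jet1_der M x) \<ominus>\<^bsub>form_module \<Omega> 2 M\<^esub> pure 2 M (deriv \<Omega> w) (jet1_proj M x)) (summands t)"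

lemma
  shows jet1_wedge_additive: "jet1_wedge \<in> additive_maps (form_module \<Omega> 1 (jet1 K \<Omega> M)) (form_module \<Omega> 2 M)"
    and jet1_wedge_pure: "\<lbrakk>w \<in> G 1; x \<in> carrier (jet1 K \<Omega> M)\<rbrakk> \<Longrightarrow>
      jet1_wedge (pure 1 (jet1 K \<Omega> M) w x)
        = wedge_left M w (jet1_der M x) \<ominus>\<^bsub>form_module \<Omega> 2 M\<^esub> pure 2 M (deriv \<Omega> w) (jet1_proj M x)"
proof -
  let ?g = "\<lambda>w x. wedge_left M w (jet1_der M x) \<ominus>\<^bsub>form_module \<Omega> 2 M\<^esub> pure 2 M (deriv \<Omega> w) (jet1_proj M x)"
  have left: "(\<lambda>w. ?g w x) \<in> additive_maps (forms \<Omega> 1) (form_module \<Omega> 2 M)" if "x \<in> carrier (jet1 K \<Omega> M)" for x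
  proof (rule additive_maps_subtract[OF abelian_group_form[OF M]])
    show "(\<lambda>w. wedge_left M w (jet1_der M x)) \<in> additive_maps (forms \<Omega> 1) (form_module \<Omega> 2 M)"
      by (rule wedge_left_additive_left[OF M jet1_der_closed[OF M that]])
    show "(\<lambda>w. pure 2 M (deriv \<Omega> w) (jet1_proj M x)) \<in> additive_maps (forms \<Omega> 1) (form_module \<Omega> 2 M)"
      by (rule additive_mapsI) (simp_all add: deriv_add[of _ 1] pure_add_left[OF M] pure_closed[OF M] jet1_proj_closed[OF M that])
  qed
  have right: "?g w \<in> additive_maps (jet1 K \<Omega> M) (form_module \<Omega> 2 M)" if w: "w \<in> G 1" for w
    by (rule additive_maps_subtract[OF abelian_group_form[OF M]
          additive_maps_compose[OF jet1_der_additive[OF M] wedge_left_additive[OF M w]]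
          additive_maps_compose[OF mod_hom_additive[OF jet1_proj_linear[OF M]] pure_additive_right[OF M]]]) (use w in simp)
  \<comment> \<open>On the right, \<open>w \<and> \<delta> (a x)\<close> produces the extra term
    \<open>w \<and> da \<otimes> \<pi> x\<close>. On the left,
    \<open>d(w a) = dw a - w \<and> da\<close>, with the sign of odd degree, produces the same term
    through the subtracted correction.\<close>
  have bal: "?g (w \<otimes>\<^bsub>\<Omega>\<^esub> a) x = ?g w (a \<odot>\<^bsub>jet1 K \<Omega> M\<^esub> x)"
    if w: "w \<in> G 1" and a: "a \<in> G 0" and x: "x \<in> carrier (jet1 K \<Omega> M)" for w a x
  proof -
    let ?\<delta> = "jet1_der M x" and ?\<pi> = "jet1_proj M x"
    have cl: "?\<delta> \<in> carrier (form_module \<Omega> 1 M)" "?\<pi> \<in> carrier M"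
      "wedge_left M w (a \<odot>\<^bsub>form_module \<Omega> 1 M\<^esub> ?\<delta>) \<in> carrier (form_module \<Omega> 2 M)"
      "pure 2 M (w \<otimes>\<^bsub>\<Omega>\<^esub> deriv \<Omega> a) ?\<pi> \<in> carrier (form_module \<Omega> 2 M)"
      "pure 2 M (deriv \<Omega> w \<otimes>\<^bsub>\<Omega>\<^esub> a) ?\<pi> \<in> carrier (form_module \<Omega> 2 M)"
      using w a x jet1_der_closed[OF M] jet1_proj_closed[OF M]
      by (auto intro!: wedge_left_closed[OF M] pure_closed[OF M] smult_closed[OF left_module_form[OF M]])
    have "pure 2 M (deriv \<Omega> (w \<otimes>\<^bsub>\<Omega>\<^esub> a)) ?\<pi>
        = pure 2 M (deriv \<Omega> w \<otimes>\<^bsub>\<Omega>\<^esub> a) ?\<pi> \<ominus>\<^bsub>form_module \<Omega> 2 M\<^esub> pure 2 M (w \<otimes>\<^bsub>\<Omega>\<^esub> deriv \<Omega> a) ?\<pi>"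
      using additive_maps_diff[OF abelian_group_forms abelian_group_form[OF M] pure_additive_left[OF M cl(2)],
          of "deriv \<Omega> w \<otimes>\<^bsub>\<Omega>\<^esub> a" 2 "w \<otimes>\<^bsub>\<Omega>\<^esub> deriv \<Omega> a"] w a
      by (simp add: deriv_one_form_mult')
    moreover have "wedge_left M w (jet1_der M (a \<odot>\<^bsub>jet1 K \<Omega> M\<^esub> x))
        = pure 2 M (w \<otimes>\<^bsub>\<Omega>\<^esub> deriv \<Omega> a) ?\<pi> \<oplus>\<^bsub>form_module \<Omega> 2 M\<^esub> wedge_left M w (a \<odot>\<^bsub>form_module \<Omega> 1 M\<^esub> ?\<delta>)"
      using w a x cl
      by (simp add: jet1_der_smult[OF M] additive_maps_add[OF wedge_left_additive[OF M]] wedge_left_pure[OF M]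
          pure_closed[OF M] smult_closed[OF left_module_form[OF M]])
    moreover have "pure 2 M (deriv \<Omega> w) (jet1_proj M (a \<odot>\<^bsub>jet1 K \<Omega> M\<^esub> x)) = pure 2 M (deriv \<Omega> w \<otimes>\<^bsub>\<Omega>\<^esub> a) ?\<pi>"
      using w a x cl by (simp add: mod_hom_smult[OF jet1_proj_linear[OF M]] pure_balanced[OF M])
    ultimately show ?thesis
      using w a cl
      by (simp add: wedge_left_smult(1)[OF M] F2.M.minus_eq F2.M.minus_add F2.M.minus_minus F2.M.a_ac)
  qed
  show "jet1_wedge \<in> additive_maps (form_module \<Omega> 1 (jet1 K \<Omega> M)) (form_module \<Omega> 2 M)"
    unfolding jet1_wedge_def[abs_def]
    by (rule form_lift_additive[OF left_module_jet1[OF M] abelian_group_form[OF M] left right bal])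
  show "jet1_wedge (pure 1 (jet1 K \<Omega> M) w x) = ?g w x" if "w \<in> G 1" "x \<in> carrier (jet1 K \<Omega> M)" for w x
    unfolding jet1_wedge_def
    by (rule form_lift_pure[OF left_module_jet1[OF M] abelian_group_form[OF M] left right bal that])
qed

text \<open>For a second jet \<open>x\<close>, \<delta> yields a sum of terms
  \<open>da \<otimes> y\<close> with exact coefficients, on which the correction in
  \<open>jet1_wedge\<close> vanishes by \<open>d(da) = 0\<close>.\<close>

lemma D_II_eq:
  assumes x: "x \<in> carrier (jet1 K \<Omega> (jet1 K \<Omega> M))"
  shows "D_II \<Omega> M x = jet1_wedge (jet1_der (jet1 K \<Omega> M) x)"
proof -
  let ?F = "form_module \<Omega> 2 M" and ?J = "jet1 K \<Omega> M" and ?ts = "summands x"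
  have ts: "set ?ts \<subseteq> G 0 \<times> carrier ?J" by (rule JJ.summands_valid[OF x])
  let ?us = "map (\<lambda>(a, y). map (apfst (\<lambda>v. deriv \<Omega> a \<otimes>\<^bsub>\<Omega>\<^esub> deriv \<Omega> v)) (summands y)) ?ts"
  have dv: "set (map (apfst (deriv \<Omega>)) (summands y)) \<subseteq> G 1 \<times> carrier M" if "y \<in> carrier ?J" for y
    using der_sum_valid[OF M J.summands_valid[OF that]] .
  have split: "map (apfst (\<lambda>v. deriv \<Omega> a \<otimes>\<^bsub>\<Omega>\<^esub> deriv \<Omega> v)) zs
      = map (apfst (\<lambda>v. deriv \<Omega> a \<otimes>\<^bsub>\<Omega>\<^esub> v)) (map (apfst (deriv \<Omega>)) zs)" for a and zs :: "('w \<times> ('w, 'e) univ) list"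
    by (simp add: apfst_eq)
  have "D_II \<Omega> M x = form_cls \<Omega> 2 M (concat ?us)"
    unfolding D_II_def flatten_def by (simp add: apfst_def map_prod_def)
  also have "\<dots> = lsum ?F (form_cls \<Omega> 2 M) ?us"
  proof (rule formal_sums.cls_concat[OF formal_sums_form[OF M]])
    fix us assume "us \<in> set ?us"
    then obtain a y where "a \<in> G 0" "y \<in> carrier ?J"
      "us = map (apfst (\<lambda>v. deriv \<Omega> a \<otimes>\<^bsub>\<Omega>\<^esub> deriv \<Omega> v)) (summands y)"
      using ts by auto
    then show "set us \<subseteq> G 2 \<times> carrier M"
      using J.summands_valid[of y] by auto
  qed
  also have "\<dots> = lsum ?F (\<lambda>p. jet1_wedge (form_cls \<Omega> 1 ?J [apfst (deriv \<Omega>) p])) ?ts"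
    unfolding lsum_map
  proof (rule lsum_cong)
    fix p assume "p \<in> set ?ts"
    with ts obtain a y where p: "p = (a, y)" "a \<in> G 0" "y \<in> carrier ?J" by auto
    have "wedge_left M (deriv \<Omega> a) (jet1_der M y) \<in> carrier ?F"
      using p by (intro wedge_left_closed[OF M] jet1_der_closed[OF M]) auto
    then show "form_cls \<Omega> 2 M (case p of (a, y) \<Rightarrow> map (apfst (\<lambda>v. deriv \<Omega> a \<otimes>\<^bsub>\<Omega>\<^esub> deriv \<Omega> v)) (summands y))
        = jet1_wedge (form_cls \<Omega> 1 ?J [apfst (deriv \<Omega>) p])"
      using p wedge_left_cls[OF M _ dv[OF p(3)], of "deriv \<Omega> a"]
      by (simp add: split jet1_wedge_pure deriv_deriv pure_zero_left[OF M] jet1_proj_closed[OF M]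
          F2.M.minus_eq F2.M.a_inv_zero jet1_der_def del: map_map)
  qed
  also have "\<dots> = jet1_wedge (jet1_der ?J x)"
    unfolding jet1_der_def
    using formal_sums.additive_cls[OF formal_sums_form[OF left_module_jet1[OF M]] abelian_group_form[OF M]
        jet1_wedge_additive der_sum_valid[OF left_module_jet1[OF M] ts]]
    by (simp add: lsum_map)
  finally show ?thesis .
qed

text \<open>Linearity fails through the correction term: \<open>d(a w) = da \<and> w + a dw\<close>,
  and the part \<open>da \<and> w \<otimes> \<pi> x\<close> is \<open>da\<close> wedged with
  \<open>\<Omega>^1(\<pi>)\<close> of the argument.\<close>

lemma jet1_wedge_smult:
  assumes a: "a \<in> G 0" and t: "t \<in> carrier (form_module \<Omega> 1 (jet1 K \<Omega> M))"
  shows "jet1_wedge (a \<odot>\<^bsub>form_module \<Omega> 1 (jet1 K \<Omega> M)\<^esub> t) = a \<odot>\<^bsub>form_module \<Omega> 2 M\<^esub> jet1_wedge t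
    \<ominus>\<^bsub>form_module \<Omega> 2 M\<^esub> wedge_left M (deriv \<Omega> a) (form_map \<Omega> 1 M (jet1_proj M) t)"
proof -
  note J = left_module_jet1[OF M] and F2 = left_module_form[OF M, of 2]
  have a': "a \<in> carrier (alg \<Omega>)" "deriv \<Omega> a \<in> G 1" using a by simp_all
  note \<pi> = form_map_linear[OF J M jet1_proj_linear[OF M]]
  show ?thesis
  proof (rule form_additive_eqI[OF J abelian_group_form[OF M]
        additive_maps_compose[OF left_module_smult_additive[OF left_module_form[OF J] a'(1)] jet1_wedge_additive]
        additive_maps_subtract[OF abelian_group_form[OF M]
          additive_maps_compose[OF jet1_wedge_additive left_module_smult_additive[OF F2 a'(1)]]
          additive_maps_compose[OF mod_hom_additive[OF \<pi>] wedge_left_additive[OF M a'(2)]]] _ t])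
    fix w x assume w: "w \<in> G 1" and x: "x \<in> carrier (jet1 K \<Omega> M)"
    have cl: "wedge_left M w (jet1_der M x) \<in> carrier (form_module \<Omega> 2 M)"
      "pure 2 M (deriv \<Omega> w) (jet1_proj M x) \<in> carrier (form_module \<Omega> 2 M)"
      "pure 2 M (deriv \<Omega> a \<otimes>\<^bsub>\<Omega>\<^esub> w) (jet1_proj M x) \<in> carrier (form_module \<Omega> 2 M)"
      using w x a' jet1_der_closed[OF M x] jet1_proj_closed[OF M x]
      by (auto intro!: wedge_left_closed[OF M] pure_closed[OF M])
    note cl' = cl[THEN smult_closed[OF F2 a]]
    have "a \<odot>\<^bsub>form_module \<Omega> 2 M\<^esub> (wedge_left M w (jet1_der M x) \<ominus>\<^bsub>form_module \<Omega> 2 M\<^esub> pure 2 M (deriv \<Omega> w) (jet1_proj M x))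
        = a \<odot>\<^bsub>form_module \<Omega> 2 M\<^esub> wedge_left M w (jet1_der M x) \<ominus>\<^bsub>form_module \<Omega> 2 M\<^esub>
          a \<odot>\<^bsub>form_module \<Omega> 2 M\<^esub> pure 2 M (deriv \<Omega> w) (jet1_proj M x)"
      by (rule additive_maps_diff[OF abelian_group_form[OF M] abelian_group_form[OF M]
            left_module_smult_additive[OF F2 a'(1)] cl(1,2)])
    then show "jet1_wedge (a \<odot>\<^bsub>form_module \<Omega> 1 (jet1 K \<Omega> M)\<^esub> pure 1 (jet1 K \<Omega> M) w x) =
        a \<odot>\<^bsub>form_module \<Omega> 2 M\<^esub> jet1_wedge (pure 1 (jet1 K \<Omega> M) w x) \<ominus>\<^bsub>form_module \<Omega> 2 M\<^esub>
        wedge_left M (deriv \<Omega> a) (form_map \<Omega> 1 M (jet1_proj M) (pure 1 (jet1 K \<Omega> M) w x))"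
      using w x a a' cl cl' jet1_proj_closed[OF M x] jet1_der_closed[OF M x]
      by (simp add: pure_smult[OF J] jet1_wedge_pure form_map_pure[OF J M jet1_proj_linear[OF M]]
          wedge_left_pure[OF M] wedge_left_smult(2)[OF M] deriv_mult pure_add_left[OF M] pure_smult[OF M]
          F2.M.minus_eq F2.M.minus_add F2.M.a_ac)
  qed
qed

text \<open>With \<open>p = \<pi> x\<close> and \<open>d = \<delta> x\<close>, the Leibniz rule and
  \<open>jet1_wedge_smult\<close> give \<open>D_II (a x) = da \<and> \<delta> p + a D_II x - da
  \<and> \<Omega>^1(\<pi>) d\<close>. The outer terms cancel because \<open>D_I x = 0\<close> says
  \<open>\<delta> p = \<Omega>^1(\<pi>) d\<close>.\<close>

lemma holonomic_smult:
  assumes a: "a \<in> G 0" and x: "x \<in> carrier (jet1 K \<Omega> (jet1 K \<Omega> M))"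
    and "D_I \<Omega> M x = \<zero>\<^bsub>form_module \<Omega> 1 M\<^esub>" and "D_II \<Omega> M x = \<zero>\<^bsub>form_module \<Omega> 2 M\<^esub>"
  shows "D_I \<Omega> M (a \<odot>\<^bsub>jet1 K \<Omega> (jet1 K \<Omega> M)\<^esub> x) = \<zero>\<^bsub>form_module \<Omega> 1 M\<^esub>"
    and "D_II \<Omega> M (a \<odot>\<^bsub>jet1 K \<Omega> (jet1 K \<Omega> M)\<^esub> x) = \<zero>\<^bsub>form_module \<Omega> 2 M\<^esub>"
proof -
  note J = left_module_jet1[OF M]
  note JJ = left_module_jet1[OF J]
  note \<pi> = form_map_linear[OF J M jet1_proj_linear[OF M], of 1]
  let ?J = "jet1 K \<Omega> M" and ?F = "form_module \<Omega> 1 M"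
  let ?p = "jet1_proj ?J x" and ?d = "jet1_der ?J x"
  have a': "a \<in> carrier (alg \<Omega>)" "deriv \<Omega> a \<in> G 1" using a by simp_all
  have cl: "?p \<in> carrier ?J" "?d \<in> carrier (form_module \<Omega> 1 ?J)" "a \<odot>\<^bsub>jet1 K \<Omega> ?J\<^esub> x \<in> carrier (jet1 K \<Omega> ?J)"
    "form_map \<Omega> 1 M (jet1_proj M) ?d \<in> carrier ?F" "jet1_der M ?p \<in> carrier ?F" "jet1_proj M ?p \<in> carrier M"
    using jet1_proj_closed[OF J x] jet1_der_closed[OF J x] smult_closed[OF JJ a x]
      mod_hom_closed[OF \<pi> jet1_der_closed[OF J x]] jet1_der_closed[OF M] jet1_proj_closed[OF M] by auto
  have eq: "jet1_der M ?p = form_map \<Omega> 1 M (jet1_proj M) ?d"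
    using assms(3) cl(5,4) unfolding D_I_eq[OF x] by (rule F.M.eq_if_minus_eq_zero)
  have pure: "pure 1 ?J (deriv \<Omega> a) ?p \<in> carrier (form_module \<Omega> 1 ?J)"
    using pure_closed[OF J a'(2) cl(1)] .
  have cl2: "pure 1 M (deriv \<Omega> a) (jet1_proj M ?p) \<in> carrier ?F"
      "a \<odot>\<^bsub>?F\<^esub> form_map \<Omega> 1 M (jet1_proj M) ?d \<in> carrier ?F"
      "a \<odot>\<^bsub>form_module \<Omega> 1 ?J\<^esub> ?d \<in> carrier (form_module \<Omega> 1 ?J)"
    using pure_closed[OF M a'(2) cl(6)] smult_closed[OF left_module_form[OF M] a cl(4)]
      smult_closed[OF left_module_form[OF J] a cl(2)] by auto
  show "D_I \<Omega> M (a \<odot>\<^bsub>jet1 K \<Omega> ?J\<^esub> x) = \<zero>\<^bsub>?F\<^esub>"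
    using a a' x cl pure cl2
    by (simp add: D_I_eq mod_hom_smult[OF jet1_proj_linear[OF J]] jet1_der_smult[OF J] jet1_der_smult[OF M]
        mod_hom_add[OF \<pi>] mod_hom_smult[OF \<pi>] form_map_pure[OF J M jet1_proj_linear[OF M]] eq F.M.minus_eq F.M.r_neg)
  have W: "wedge_left M (deriv \<Omega> a) (form_map \<Omega> 1 M (jet1_proj M) ?d) \<in> carrier (form_module \<Omega> 2 M)"
    using wedge_left_closed[OF M a'(2) cl(4)] .
  have "jet1_wedge ?d = \<zero>\<^bsub>form_module \<Omega> 2 M\<^esub>"
    using assms(4) D_II_eq[OF x] by simp
  then show "D_II \<Omega> M (a \<odot>\<^bsub>jet1 K \<Omega> ?J\<^esub> x) = \<zero>\<^bsub>form_module \<Omega> 2 M\<^esub>"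
    using a a' x cl pure cl2 W
    by (simp add: D_II_eq jet1_der_smult[OF J] additive_maps_add[OF jet1_wedge_additive] jet1_wedge_pure
        jet1_wedge_smult deriv_deriv pure_zero_left[OF M] left_module_smult_zero[OF left_module_form[OF M]]
        eq F2.M.minus_eq F2.M.r_neg F2.M.a_inv_zero)
qed

lemma D_I_additive: "D_I \<Omega> M \<in> additive_maps (jet1 K \<Omega> (jet1 K \<Omega> M)) (form_module \<Omega> 1 M)"
proof -
  note J = left_module_jet1[OF M]
  note \<pi> = form_map_linear[OF J M jet1_proj_linear[OF M], of 1]
  have *: "(\<lambda>x. jet1_der M (jet1_proj (jet1 K \<Omega> M) x) \<ominus>\<^bsub>form_module \<Omega> 1 M\<^esub>
      form_map \<Omega> 1 M (jet1_proj M) (jet1_der (jet1 K \<Omega> M) x))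
    \<in> additive_maps (jet1 K \<Omega> (jet1 K \<Omega> M)) (form_module \<Omega> 1 M)"
    by (rule additive_maps_subtract[OF abelian_group_form[OF M]
          additive_maps_compose[OF mod_hom_additive[OF jet1_proj_linear[OF J]] jet1_der_additive[OF M]]
          additive_maps_compose[OF jet1_der_additive[OF J] mod_hom_additive[OF \<pi>]]])
  show ?thesis
    using additive_maps_closed[OF *] additive_maps_add[OF *] JJ.abelian_group_M
    by (intro additive_mapsI) (simp_all add: D_I_eq abelian_groupE(1))
qed

lemma D_II_additive: "D_II \<Omega> M \<in> additive_maps (jet1 K \<Omega> (jet1 K \<Omega> M)) (form_module \<Omega> 2 M)"
proof -
  note * = additive_maps_compose[OF jet1_der_additive[OF left_module_jet1[OF M]] jet1_wedge_additive]
  show ?thesis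
    using additive_maps_closed[OF *] additive_maps_add[OF *] JJ.abelian_group_M
    by (intro additive_mapsI) (simp_all add: D_II_eq abelian_groupE(1))
qed

end

end

context exterior_algebra
begin

section \<open>Holonomic jets and symmetric forms\<close>

lemma left_module_base:
  assumes "left_module (alg \<Omega>) E"
  shows "left_module (alg \<Omega>) (base_module E)"
proof -
  interpret E: left_module "alg \<Omega>" E by fact
  show ?thesis
  proof (rule left_moduleI[OF ring_alg])
    show "abelian_group (base_module E)"
    proof (rule abelian_groupI)
      show "\<exists>y\<in>carrier (base_module E). y \<oplus>\<^bsub>base_module E\<^esub> x = \<zero>\<^bsub>base_module E\<^esub>" if "x \<in> carrier (base_module E)" for x
        using that by (intro bexI[of _ "Base (\<ominus>\<^bsub>E\<^esub> the_base x)"]) (auto simp: base_module_def E.M.l_neg)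
    qed (auto simp: base_module_def E.M.a_ac)
  qed (use E.lsmult_closed E.lsmult_l_distr E.lsmult_r_distr E.lsmult_assoc E.lsmult_one in \<open>auto simp: base_module_def\<close>)
qed

context
  fixes E :: "('w, 'e) module"
  assumes E: "left_module (alg \<Omega>) E"
begin

abbreviation "Jet \<equiv> jet K \<Omega> E"

abbreviation "Sym \<equiv> sym_form \<Omega> E"

lemma jet_Suc:
  shows "x \<in> carrier (Jet (Suc n)) \<Longrightarrow> x \<in> carrier (jet1 K \<Omega> (Jet n))"
    and jet_Suc_zero: "zero (Jet (Suc n)) = zero (jet1 K \<Omega> (Jet n))"
    and "add (Jet (Suc n)) = add (jet1 K \<Omega> (Jet n))"
    and "smult (Jet (Suc n)) = smult (jet1 K \<Omega> (Jet n))"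
  by (cases n; simp)+

lemma jet_Suc_Suc_iff:
  "x \<in> carrier (Jet (Suc (Suc n))) \<longleftrightarrow> x \<in> carrier (jet1 K \<Omega> (Jet (Suc n))) \<and>
    D_I \<Omega> (Jet n) (jet1_map K \<Omega> (jet1 K \<Omega> (Jet n)) (\<lambda>u. u) x) = \<zero>\<^bsub>form_module \<Omega> 1 (Jet n)\<^esub> \<and>
    D_II \<Omega> (Jet n) (jet1_map K \<Omega> (jet1 K \<Omega> (Jet n)) (\<lambda>u. u) x) = \<zero>\<^bsub>form_module \<Omega> 2 (Jet n)\<^esub>"
  by (simp add: Let_def)

lemma sym_Suc:
  shows sym_Suc_carrier: "t \<in> carrier (Sym (Suc n)) \<Longrightarrow> t \<in> carrier (form_module \<Omega> 1 (Sym n))"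
    and "zero (Sym (Suc n)) = zero (form_module \<Omega> 1 (Sym n))"
    and "add (Sym (Suc n)) = add (form_module \<Omega> 1 (Sym n))"
    and "smult (Sym (Suc n)) = smult (form_module \<Omega> 1 (Sym n))"
  by (cases n; simp)+

lemma sym_Suc_Suc_iff:
  "t \<in> carrier (Sym (Suc (Suc n))) \<longleftrightarrow> t \<in> carrier (form_module \<Omega> 1 (Sym (Suc n))) \<and>
    wedge_map \<Omega> (Sym n) (form_map \<Omega> 1 (form_module \<Omega> 1 (Sym n)) (\<lambda>u. u) t) = \<zero>\<^bsub>form_module \<Omega> 2 (Sym n)\<^esub>"
  by simp

declare jet.simps(2,3) [simp del] sym_form.simps(2,3) [simp del] iota.simps(2) [simp del]

text \<open>The identity function plays the role of the inclusion \<open>l\<close>. It is kept as a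
  map because applying \<open>J^1\<close> or \<open>\<Omega>^1\<close> to it passes to classes, and
  chosen representatives, over the larger module.\<close>

lemma jet_inclusion: "(\<lambda>u. u) \<in> mod_hom (alg \<Omega>) (Jet (Suc n)) (jet1 K \<Omega> (Jet n))"
  by (rule mod_homI) (simp_all add: jet_Suc)

lemma sym_inclusion: "(\<lambda>u. u) \<in> mod_hom (alg \<Omega>) (Sym (Suc n)) (form_module \<Omega> 1 (Sym n))"
  by (rule mod_homI) (simp_all add: sym_Suc)

text \<open>The holonomy conditions are pulled back along the linear map \<open>J^1(l)\<close>;
  closure under scalars is \<open>holonomic_smult\<close>, where both conditions act
  together.\<close>

lemma left_module_jet: "left_module (alg \<Omega>) (Jet n)"
proof (induction n rule: induct_nat_012)
  case 0
  then show ?case using left_module_base[OF E] by simp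
next
  case 1
  then show ?case using left_module_jet1[OF left_module_base[OF E]] by (simp add: jet.simps(2))
next
  case (ge2 n)
  let ?J = "jet1 K \<Omega> (Jet n)" and ?I = "jet1_map K \<Omega> (jet1 K \<Omega> (Jet n)) (\<lambda>u. u)"
  note J = left_module_jet1[OF ge2(1)]
  note I = jet1_map_linear[OF ge2(2) J jet_inclusion]
  note S = left_module_jet1[OF ge2(2)]
  have I0: "?I \<zero>\<^bsub>jet1 K \<Omega> (Jet (Suc n))\<^esub> = \<zero>\<^bsub>jet1 K \<Omega> ?J\<^esub>"
    by (rule additive_maps_zero[OF abelian_group_jet1[OF ge2(2)] abelian_group_jet1[OF J] mod_hom_additive[OF I]])
  have D0: "D_I \<Omega> (Jet n) \<zero>\<^bsub>jet1 K \<Omega> ?J\<^esub> = \<zero>\<^bsub>form_module \<Omega> 1 (Jet n)\<^esub>"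
    "D_II \<Omega> (Jet n) \<zero>\<^bsub>jet1 K \<Omega> ?J\<^esub> = \<zero>\<^bsub>form_module \<Omega> 2 (Jet n)\<^esub>"
    using additive_maps_zero[OF abelian_group_jet1[OF J] abelian_group_form[OF ge2(1)]]
      D_I_additive[OF ge2(1)] D_II_additive[OF ge2(1)] by blast+
  note add = mod_hom_add[OF I] additive_maps_add[OF D_I_additive[OF ge2(1)]] additive_maps_add[OF D_II_additive[OF ge2(1)]]
    abelian_groupE(1)[OF abelian_group_jet1[OF ge2(2)]]
  have "left_module (alg \<Omega>) (jet1 K \<Omega> (Jet (Suc n))\<lparr>carrier := carrier (Jet (Suc (Suc n)))\<rparr>)"
  proof (rule left_module_restrict_carrier[OF S])
    show "x \<oplus>\<^bsub>jet1 K \<Omega> (Jet (Suc n))\<^esub> y \<in> carrier (Jet (Suc (Suc n)))"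
      if "x \<in> carrier (Jet (Suc (Suc n)))" "y \<in> carrier (Jet (Suc (Suc n)))" for x y
      using that abelian_groupE(2,5)[OF abelian_group_form[OF ge2(1)]]
      by (simp add: jet_Suc_Suc_iff add mod_hom_closed[OF I])
    show "a \<odot>\<^bsub>jet1 K \<Omega> (Jet (Suc n))\<^esub> x \<in> carrier (Jet (Suc (Suc n)))"
      if "a \<in> carrier (alg \<Omega>)" "x \<in> carrier (Jet (Suc (Suc n)))" for a x
      using that holonomic_smult[OF ge2(1), of a "?I x"]
      by (simp add: jet_Suc_Suc_iff mod_hom_smult[OF I] smult_closed[OF S] mod_hom_closed[OF I])
  qed (use abelian_groupE(2)[OF abelian_group_jet1[OF ge2(2)]] in \<open>auto simp: jet_Suc_Suc_iff I0 D0\<close>)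
  moreover have "Jet (Suc (Suc n)) = jet1 K \<Omega> (Jet (Suc n))\<lparr>carrier := carrier (Jet (Suc (Suc n)))\<rparr>"
    by (simp add: jet.simps(3))
  ultimately show ?case by simp
qed

lemma left_module_sym: "left_module (alg \<Omega>) (Sym n)"
proof (induction n rule: induct_nat_012)
  case 0
  then show ?case using left_module_base[OF E] by simp
next
  case 1
  then show ?case using left_module_form[OF left_module_base[OF E]] by (simp add: sym_form.simps(2))
next
  case (ge2 n)
  let ?F = "form_module \<Omega> 1 (Sym n)"
  note F = left_module_form[OF ge2(1), of 1] and S = left_module_form[OF ge2(2), of 1]
  note W = mod_hom_compose[OF form_map_linear[OF ge2(2) F sym_inclusion] wedge_map_linear[OF ge2(1)]]
  have "left_module (alg \<Omega>) (form_module \<Omega> 1 (Sym (Suc n))\<lparr>carrier := carrier (Sym (Suc (Suc n)))\<rparr>)"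
  proof (rule left_module_restrict_carrier[OF S])
    show "x \<oplus>\<^bsub>form_module \<Omega> 1 (Sym (Suc n))\<^esub> y \<in> carrier (Sym (Suc (Suc n)))"
      if "x \<in> carrier (Sym (Suc (Suc n)))" "y \<in> carrier (Sym (Suc (Suc n)))" for x y
      using that abelian_groupE(2,5)[OF abelian_group_form[OF ge2(1)]] abelian_groupE(1)[OF abelian_group_form[OF ge2(2)]]
      by (simp add: sym_Suc_Suc_iff mod_hom_add[OF W])
    show "a \<odot>\<^bsub>form_module \<Omega> 1 (Sym (Suc n))\<^esub> x \<in> carrier (Sym (Suc (Suc n)))"
      if "a \<in> carrier (alg \<Omega>)" "x \<in> carrier (Sym (Suc (Suc n)))" for a x
      using that left_module_smult_zero[OF left_module_form[OF ge2(1)]]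
      by (simp add: sym_Suc_Suc_iff mod_hom_smult[OF W] smult_closed[OF S])
  qed (use abelian_groupE(2)[OF abelian_group_form[OF ge2(2)]]
      additive_maps_zero[OF abelian_group_form[OF ge2(2)] abelian_group_form[OF ge2(1)] mod_hom_additive[OF W]]
      in \<open>auto simp: sym_Suc_Suc_iff\<close>)
  moreover have "Sym (Suc (Suc n)) = form_module \<Omega> 1 (Sym (Suc n))\<lparr>carrier := carrier (Sym (Suc (Suc n)))\<rparr>"
    by (simp add: sym_form.simps(3))
  ultimately show ?case by simp
qed

section \<open>Projections and prolongations\<close>

lemma jet_proj_linear: "jet1_proj (Jet n) \<in> mod_hom (alg \<Omega>) (Jet (Suc n)) (Jet n)"
  using mod_hom_compose[OF jet_inclusion jet1_proj_linear[OF left_module_jet]] .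

text \<open>In coordinates, \<open>J^1(l)\<close> sends the prolongation of \<open>q\<close> to
  \<open>(q, 0)\<close>. Hence \<open>D_II\<close> vanishes, and \<open>D_I\<close> reduces to
  \<open>\<delta> q\<close>, which is zero because \<open>q\<close> is itself a
  prolongation.\<close>

lemma prolong_closed: "e \<in> carrier E \<Longrightarrow> prolong K \<Omega> E n e \<in> carrier (Jet n)"
proof (induction n rule: induct_nat_012)
  case 0
  then show ?case by (simp add: base_module_def)
next
  case 1
  then show ?case
    using jet1_prolong_closed[OF left_module_base[OF E], of "Base e"] by (simp add: jet.simps(2) base_module_def)
next
  case (ge2 n)
  note J = left_module_jet1[OF left_module_jet[of n]]
  let ?p = "prolong K \<Omega> E n e" and ?q = "prolong K \<Omega> E (Suc n) e"
  have p: "?p \<in> carrier (Jet n)" and q: "?q \<in> carrier (Jet (Suc n))" using ge2 by auto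
  let ?x = "jet1_prolong K \<Omega> (Jet (Suc n)) ?q"
  let ?y = "jet1_map K \<Omega> (jet1 K \<Omega> (Jet n)) (\<lambda>u. u) ?x"
  note incl = left_module_jet J jet_inclusion
  have x: "?x \<in> carrier (jet1 K \<Omega> (Jet (Suc n)))"
    by (rule jet1_prolong_closed[OF left_module_jet q])
  have y: "?y \<in> carrier (jet1 K \<Omega> (jet1 K \<Omega> (Jet n)))"
    "jet1_proj (jet1 K \<Omega> (Jet n)) ?y = ?q"
    "jet1_der (jet1 K \<Omega> (Jet n)) ?y = \<zero>\<^bsub>form_module \<Omega> 1 (jet1 K \<Omega> (Jet n))\<^esub>"
    using jet1_map_closed[OF incl x] jet1_proj_map[OF incl x] jet1_der_map[OF incl x]
      additive_maps_zero[OF abelian_group_form[OF left_module_jet] abelian_group_form[OF J] mod_hom_additive[OF form_map_linear[OF incl]]]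
    by (simp_all add: jet1_proj_prolong[OF left_module_jet q] jet1_der_prolong[OF left_module_jet q] del: prolong.simps)
  have "jet1_der (Jet n) ?q = \<zero>\<^bsub>form_module \<Omega> 1 (Jet n)\<^esub>"
    using jet1_der_prolong[OF left_module_jet p] by simp
  moreover have "form_map \<Omega> 1 (Jet n) (jet1_proj (Jet n)) \<zero>\<^bsub>form_module \<Omega> 1 (jet1 K \<Omega> (Jet n))\<^esub>
      = \<zero>\<^bsub>form_module \<Omega> 1 (Jet n)\<^esub>"
    by (rule additive_maps_zero[OF abelian_group_form[OF J] abelian_group_form[OF left_module_jet]
          mod_hom_additive[OF form_map_linear[OF J left_module_jet jet1_proj_linear[OF left_module_jet]]]])
  ultimately have "D_I \<Omega> (Jet n) ?y = \<zero>\<^bsub>form_module \<Omega> 1 (Jet n)\<^esub>"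
    using abelian_group.r_neg[OF abelian_group_form[OF left_module_jet]
        abelian_groupE(2)[OF abelian_group_form[OF left_module_jet]]]
    by (simp only: D_I_eq[OF left_module_jet y(1)] y(2,3) a_minus_def)
  moreover have "D_II \<Omega> (Jet n) ?y = \<zero>\<^bsub>form_module \<Omega> 2 (Jet n)\<^esub>"
    by (simp only: D_II_eq[OF left_module_jet y(1)] y(3)
        additive_maps_zero[OF abelian_group_form[OF J] abelian_group_form[OF left_module_jet] jet1_wedge_additive[OF left_module_jet]])
  ultimately show ?case
    using x by (simp add: jet_Suc_Suc_iff)
qed

lemma jet_proj_prolong: "e \<in> carrier E \<Longrightarrow> jet1_proj (Jet n) (prolong K \<Omega> E (Suc n) e) = prolong K \<Omega> E n e"
  by (simp add: jet1_proj_prolong[OF left_module_jet prolong_closed])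

lemma prolong_add:
  assumes "e \<in> carrier E" and "f \<in> carrier E"
  shows "prolong K \<Omega> E n (e \<oplus>\<^bsub>E\<^esub> f) = prolong K \<Omega> E n e \<oplus>\<^bsub>Jet n\<^esub> prolong K \<Omega> E n f"
proof (induction n)
  case 0
  then show ?case by (simp add: base_module_def)
next
  case (Suc n)
  note J = left_module_jet[of n] and p = prolong_closed[where n = n]
  note p' = p[OF assms(1)] p[OF assms(2)]
  have ef: "e \<oplus>\<^bsub>E\<^esub> f \<in> carrier E"
    using assms abelian_groupE(1)[OF left_module_abelian_group[OF E]] by simp
  have "jet1_prolong K \<Omega> (Jet n) (prolong K \<Omega> E n (e \<oplus>\<^bsub>E\<^esub> f))
      = jet1_prolong K \<Omega> (Jet n) (prolong K \<Omega> E n e) \<oplus>\<^bsub>jet1 K \<Omega> (Jet n)\<^esub> jet1_prolong K \<Omega> (Jet n) (prolong K \<Omega> E n f)"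
    by (rule jet1_eqI[OF J])
      (simp_all add: jet1_prolong_closed[OF J] p p' ef jet1_proj_prolong[OF J] jet1_der_prolong[OF J]
        mod_hom_add[OF jet1_proj_linear[OF J]] additive_maps_add[OF jet1_der_additive[OF J]] Suc.IH
        abelian_groupE(1)[OF abelian_group_jet1[OF J]] abelian_groupE(1)[OF left_module_abelian_group[OF J]]
        abelian_groupE(2,5)[OF abelian_group_form[OF J]])
  then show ?case by (simp add: jet_Suc)
qed

text \<open>For a general element of \<open>A\<close> the Leibniz term of \<delta> obstructs
  linearity; for \<open>c 1\<close> it vanishes, because \<open>c 1\<close> is closed.\<close>

lemma prolong_ksmult:
  assumes c: "c \<in> carrier K" and e: "e \<in> carrier E"
  shows "prolong K \<Omega> E n ((c \<odot>\<^bsub>\<Omega>\<^esub> \<one>\<^bsub>\<Omega>\<^esub>) \<odot>\<^bsub>E\<^esub> e) = (c \<odot>\<^bsub>\<Omega>\<^esub> \<one>\<^bsub>\<Omega>\<^esub>) \<odot>\<^bsub>Jet n\<^esub> prolong K \<Omega> E n e"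
proof (induction n)
  case 0
  then show ?case by (simp add: base_module_def)
next
  case (Suc n)
  let ?c = "c \<odot>\<^bsub>\<Omega>\<^esub> \<one>\<^bsub>\<Omega>\<^esub>"
  note J = left_module_jet[of n] and p = prolong_closed[OF e, of n]
  have c': "?c \<in> G 0" using c by simp
  have "jet1_prolong K \<Omega> (Jet n) (?c \<odot>\<^bsub>Jet n\<^esub> prolong K \<Omega> E n e)
      = ?c \<odot>\<^bsub>jet1 K \<Omega> (Jet n)\<^esub> jet1_prolong K \<Omega> (Jet n) (prolong K \<Omega> E n e)"
    by (rule jet1_eqI[OF J])
      (use c c' p in \<open>simp_all add: jet1_prolong_closed[OF J] jet1_proj_prolong[OF J] jet1_der_prolong[OF J]
        mod_hom_smult[OF jet1_proj_linear[OF J]] jet1_der_smult[OF J] smult_closed[OF J] smult_closed[OF left_module_jet1[OF J]]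
        deriv_smult_one pure_zero_left[OF J] left_module_smult_zero[OF left_module_form[OF J]]
        abelian_groupE(2,5)[OF abelian_group_form[OF J]]\<close>)
  then show ?case by (simp add: jet_Suc Suc.IH)
qed

text \<open>The coordinates are those of \<open>jet1_iota\<close>. The substance is that the values
  are holonomic, which is verified through the coordinate formulas for \<open>D_I\<close> and
  \<open>D_II\<close>.\<close>

lemma
  shows iota_linear: "iota K \<Omega> E n \<in> mod_hom (alg \<Omega>) (Sym n) (Jet n)"
    and jet_proj_iota: "t \<in> carrier (Sym (Suc n)) \<Longrightarrow> jet1_proj (Jet n) (iota K \<Omega> E (Suc n) t) = \<zero>\<^bsub>Jet n\<^esub>"
    and jet_der_iota: "t \<in> carrier (Sym (Suc n)) \<Longrightarrow>
      jet1_der (Jet n) (iota K \<Omega> E (Suc n) t) = \<ominus>\<^bsub>form_module \<Omega> 1 (Jet n)\<^esub> form_map \<Omega> 1 (Jet n) (iota K \<Omega> E n) t"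
proof -
  note J = left_module_jet and S = left_module_sym
  \<comment> \<open>The target here is the full first jet module; from order 2 on, membership in the
    holonomic jets has to be shown separately.\<close>
  have step: "iota K \<Omega> E (Suc n) \<in> mod_hom (alg \<Omega>) (Sym (Suc n)) (jet1 K \<Omega> (Jet n))"
    "t \<in> carrier (Sym (Suc n)) \<Longrightarrow> jet1_proj (Jet n) (iota K \<Omega> E (Suc n) t) = \<zero>\<^bsub>Jet n\<^esub>"
    "t \<in> carrier (Sym (Suc n)) \<Longrightarrow>
      jet1_der (Jet n) (iota K \<Omega> E (Suc n) t) = \<ominus>\<^bsub>form_module \<Omega> 1 (Jet n)\<^esub> form_map \<Omega> 1 (Jet n) (iota K \<Omega> E n) t"
    if n: "iota K \<Omega> E n \<in> mod_hom (alg \<Omega>) (Sym n) (Jet n)" for n t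
  proof -
    note m = mod_hom_compose[OF sym_inclusion form_map_linear[OF S J n]]
    show "iota K \<Omega> E (Suc n) \<in> mod_hom (alg \<Omega>) (Sym (Suc n)) (jet1 K \<Omega> (Jet n))"
      using mod_hom_compose[OF m jet1_iota_linear[OF J]] by (simp add: iota.simps(2)[abs_def])
    show "jet1_proj (Jet n) (iota K \<Omega> E (Suc n) t) = \<zero>\<^bsub>Jet n\<^esub>"
      "jet1_der (Jet n) (iota K \<Omega> E (Suc n) t) = \<ominus>\<^bsub>form_module \<Omega> 1 (Jet n)\<^esub> form_map \<Omega> 1 (Jet n) (iota K \<Omega> E n) t"
      if "t \<in> carrier (Sym (Suc n))"
      using jet1_proj_iota[OF J] jet1_der_iota[OF J] mod_hom_closed[OF m that] by (simp_all add: iota.simps(2))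
  qed
  have lin: "iota K \<Omega> E n \<in> mod_hom (alg \<Omega>) (Sym n) (Jet n)" for n
  proof (induction n rule: induct_nat_012)
    case 0
    then show ?case by (auto intro!: mod_homI)
  next
    case 1
    have "iota K \<Omega> E 0 \<in> mod_hom (alg \<Omega>) (Sym 0) (Jet 0)"
      by (auto intro!: mod_homI)
    from step(1)[OF this] show ?case by (simp add: jet.simps(2))
  next
    case (ge2 n)
    note J1 = left_module_jet1[OF J]
    let ?i = "iota K \<Omega> E (Suc n)"
    have "iota K \<Omega> E (Suc (Suc n)) t \<in> carrier (Jet (Suc (Suc n)))" if t: "t \<in> carrier (Sym (Suc (Suc n)))" for t
    proof -
      have t1: "t \<in> carrier (form_module \<Omega> 1 (Sym (Suc n)))" by (rule sym_Suc_carrier[OF t])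
      let ?x = "iota K \<Omega> E (Suc (Suc n)) t"
      let ?y = "jet1_map K \<Omega> (jet1 K \<Omega> (Jet n)) (\<lambda>u. u) ?x"
      note incl = J[of "Suc n"] J1[of n] jet_inclusion
      note i = step(1)[OF ge2(1)]
      have i_map: "form_map \<Omega> 1 (Jet (Suc n)) ?i t \<in> carrier (form_module \<Omega> 1 (Jet (Suc n)))"
        by (rule mod_hom_closed[OF form_map_linear[OF S J ge2(2)] t1])
      have x: "?x \<in> carrier (jet1 K \<Omega> (Jet (Suc n)))"
        by (rule mod_hom_closed[OF step(1)[OF ge2(2)] t])
      let ?u = "form_map \<Omega> 1 (jet1 K \<Omega> (Jet n)) ?i t"
      have u: "?u \<in> carrier (form_module \<Omega> 1 (jet1 K \<Omega> (Jet n)))"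
        by (rule mod_hom_closed[OF form_map_linear[OF S J1 i] t1])
      have y: "?y \<in> carrier (jet1 K \<Omega> (jet1 K \<Omega> (Jet n)))"
        by (rule jet1_map_closed[OF incl x])
      have y1: "jet1_proj (jet1 K \<Omega> (Jet n)) ?y = \<zero>\<^bsub>jet1 K \<Omega> (Jet n)\<^esub>"
        unfolding jet1_proj_map[OF incl x] step(2)[OF ge2(2) t] by (rule jet_Suc_zero)
      have y2: "jet1_der (jet1 K \<Omega> (Jet n)) ?y = \<ominus>\<^bsub>form_module \<Omega> 1 (jet1 K \<Omega> (Jet n))\<^esub> ?u"
        unfolding jet1_der_map[OF incl x] step(3)[OF ge2(2) t]
          additive_maps_minus[OF abelian_group_form[OF J] abelian_group_form[OF J1] mod_hom_additive[OF form_map_linear[OF incl]] i_map]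
        by (simp only: form_map_comp[OF S incl(1,2) ge2(2) incl(3) t1])
      note \<pi> = form_map_linear[OF J1 J jet1_proj_linear[OF J], of 1 n]
      \<comment> \<open>\<pi> annihilates the embedded forms of order \<open>n + 1\<close>, so this
        term of \<open>D_I\<close> vanishes; the other one is \<delta> of zero by
        \<open>y1\<close>.\<close>
      have "form_map \<Omega> 1 (Jet n) (jet1_proj (Jet n)) ?u = \<zero>\<^bsub>form_module \<Omega> 1 (Jet n)\<^esub>"
        unfolding form_map_comp[OF S J1 J i jet1_proj_linear[OF J] t1]
        by (rule form_map_eq_zero[OF S J mod_hom_compose[OF i jet1_proj_linear[OF J]] step(2)[OF ge2(1)] t1])
      then have "D_I \<Omega> (Jet n) ?y = \<zero>\<^bsub>form_module \<Omega> 1 (Jet n)\<^esub>"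
        unfolding D_I_eq[OF J y] y1 y2
          additive_maps_zero[OF abelian_group_jet1[OF J] abelian_group_form[OF J] jet1_der_additive[OF J]]
          additive_maps_minus[OF abelian_group_form[OF J1] abelian_group_form[OF J] mod_hom_additive[OF \<pi>] u]
        using abelian_group.a_inv_zero[OF abelian_group_form[OF J]] abelian_groupE(2,5)[OF abelian_group_form[OF J]]
        by (simp add: a_minus_def)
      moreover have "D_II \<Omega> (Jet n) ?y = \<zero>\<^bsub>form_module \<Omega> 2 (Jet n)\<^esub>"
      proof -
        let ?F = "form_module \<Omega> 1 (Sym n)"
        let ?W = "\<lambda>t. wedge_map \<Omega> (Sym n) (form_map \<Omega> 1 ?F (\<lambda>u. u) t)"
        note F = left_module_form[OF S[of n], of 1]
        note W = mod_hom_compose[OF form_map_linear[OF S F sym_inclusion] wedge_map_linear[OF S]]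
        note i2 = form_map_linear[OF S J ge2(1), of 2]
        interpret F2: abelian_group "form_module \<Omega> 2 (Jet n)" by (rule abelian_group_form[OF J])
        \<comment> \<open>On \<open>w \<otimes> v\<close> the correction drops out since \<pi>
          annihilates the embedded \<open>v\<close>, and \<delta> contributes
          \<open>- \<Omega>^1(\<iota>) v\<close>. So \<open>D_II\<close> is, up to sign, the wedge
          condition on \<open>t\<close> pushed forward by
          \<open>\<Omega>^2(\<iota>)\<close>.\<close>
        have "jet1_wedge (Jet n) ?u = \<ominus>\<^bsub>form_module \<Omega> 2 (Jet n)\<^esub> form_map \<Omega> 2 (Jet n) (iota K \<Omega> E n) (?W t)"
        proof (rule form_additive_eqI[OF S abelian_group_form[OF J]
              additive_maps_compose[OF mod_hom_additive[OF form_map_linear[OF S J1 i]] jet1_wedge_additive[OF J]]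
              additive_maps_uminus[OF abelian_group_form[OF J] additive_maps_compose[OF mod_hom_additive[OF W] mod_hom_additive[OF i2]]] _ t1])
          fix w v assume w: "w \<in> G 1" and v: "v \<in> carrier (Sym (Suc n))"
          have v1: "v \<in> carrier ?F" by (rule sym_Suc_carrier[OF v])
          have iv: "form_map \<Omega> 1 (Jet n) (iota K \<Omega> E n) v \<in> carrier (form_module \<Omega> 1 (Jet n))"
            by (rule mod_hom_closed[OF form_map_linear[OF S J ge2(1)] v1])
          have p0: "pure 2 (Jet n) (deriv \<Omega> w) \<zero>\<^bsub>Jet n\<^esub> = \<zero>\<^bsub>form_module \<Omega> 2 (Jet n)\<^esub>"
            by (rule additive_maps_zero[OF left_module_abelian_group[OF J] abelian_group_form[OF J] pure_additive_right[OF J]])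
              (use w in simp)
          have "jet1_wedge (Jet n) (form_map \<Omega> 1 (jet1 K \<Omega> (Jet n)) ?i (pure 1 (Sym (Suc n)) w v))
              = wedge_left (Jet n) w (\<ominus>\<^bsub>form_module \<Omega> 1 (Jet n)\<^esub> form_map \<Omega> 1 (Jet n) (iota K \<Omega> E n) v)
                \<ominus>\<^bsub>form_module \<Omega> 2 (Jet n)\<^esub> \<zero>\<^bsub>form_module \<Omega> 2 (Jet n)\<^esub>"
            unfolding form_map_pure[OF S J1 i w v] jet1_wedge_pure[OF J w mod_hom_closed[OF i v]]
              step(2)[OF ge2(1) v] step(3)[OF ge2(1) v] p0 ..
          also have "\<dots> = \<ominus>\<^bsub>form_module \<Omega> 2 (Jet n)\<^esub> wedge_left (Jet n) w (form_map \<Omega> 1 (Jet n) (iota K \<Omega> E n) v)"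
            using wedge_left_closed[OF J w iv]
            by (simp add: additive_maps_minus[OF abelian_group_form[OF J] abelian_group_form[OF J] wedge_left_additive[OF J w] iv]
                F2.minus_eq)
          also have "\<dots> = \<ominus>\<^bsub>form_module \<Omega> 2 (Jet n)\<^esub> form_map \<Omega> 2 (Jet n) (iota K \<Omega> E n) (wedge_left (Sym n) w v)"
            unfolding wedge_left_natural[OF S J ge2(1) w v1] ..
          also have "wedge_left (Sym n) w v = ?W (pure 1 (Sym (Suc n)) w v)"
            unfolding form_map_pure[OF S F sym_inclusion w v] wedge_map_pure[OF S w v1] ..
          finally show "jet1_wedge (Jet n) (form_map \<Omega> 1 (jet1 K \<Omega> (Jet n)) ?i (pure 1 (Sym (Suc n)) w v))
              = \<ominus>\<^bsub>form_module \<Omega> 2 (Jet n)\<^esub> form_map \<Omega> 2 (Jet n) (iota K \<Omega> E n) (?W (pure 1 (Sym (Suc n)) w v))" .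
        qed
        also have "?W t = \<zero>\<^bsub>form_module \<Omega> 2 (Sym n)\<^esub>"
          using t by (simp add: sym_Suc_Suc_iff)
        finally have "jet1_wedge (Jet n) ?u = \<zero>\<^bsub>form_module \<Omega> 2 (Jet n)\<^esub>"
          using additive_maps_zero[OF abelian_group_form[OF S] abelian_group_form[OF J] mod_hom_additive[OF i2]] by simp
        then show ?thesis
          unfolding D_II_eq[OF J y] y2
            additive_maps_minus[OF abelian_group_form[OF J1] abelian_group_form[OF J] jet1_wedge_additive[OF J] u]
          by simp
      qed
      ultimately show ?thesis using x by (simp only: jet_Suc_Suc_iff)
    qed
    then show ?case
      using step(1)[OF ge2(2)] by (auto intro!: mod_homI simp: mod_hom_iff additive_maps_def jet_Suc)
  qed
  show "iota K \<Omega> E n \<in> mod_hom (alg \<Omega>) (Sym n) (Jet n)" by (rule lin)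
  show "t \<in> carrier (Sym (Suc n)) \<Longrightarrow> jet1_proj (Jet n) (iota K \<Omega> E (Suc n) t) = \<zero>\<^bsub>Jet n\<^esub>"
    and "t \<in> carrier (Sym (Suc n)) \<Longrightarrow>
      jet1_der (Jet n) (iota K \<Omega> E (Suc n) t) = \<ominus>\<^bsub>form_module \<Omega> 1 (Jet n)\<^esub> form_map \<Omega> 1 (Jet n) (iota K \<Omega> E n) t"
    by (rule step(2,3)[OF lin], assumption)+
qed

section \<open>The lift of the iterated connections\<close>

text \<open>Step \<open>n + 1\<close> is \<open>J^1\<close> of the preceding lift \<lambda>, then
  the lift of the connection on \<open>S^n\<close>, then the splitting. Only the coordinates of the
  middle jet enter, and these are \<open>\<lambda> (\<pi> x)\<close> and
  \<open>\<Omega>^1(\<lambda>) (\<delta> x)\<close>.\<close>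

fun jet_lift
  where
    "jet_lift s D 0 x = x"
  | "jet_lift s D (Suc n) x = s n (D n (jet_lift s D n (jet1_proj (Jet n) x)) \<ominus>\<^bsub>form_module \<Omega> 1 (Sym n)\<^esub>
      form_map \<Omega> 1 (Sym n) (jet_lift s D n) (jet1_der (Jet n) x))"

lemma left_connection_additive: "left_connection K \<Omega> M D \<Longrightarrow> D \<in> additive_maps M (form_module \<Omega> 1 M)"
  by (auto simp: left_connection_def mod_hom_def additive_maps_def)

lemma left_connection_smult:
  "\<lbrakk>left_connection K \<Omega> M D; a \<in> G 0; m \<in> carrier M\<rbrakk> \<Longrightarrow>
    D (a \<odot>\<^bsub>M\<^esub> m) = pure 1 M (deriv \<Omega> a) m \<oplus>\<^bsub>form_module \<Omega> 1 M\<^esub> a \<odot>\<^bsub>form_module \<Omega> 1 M\<^esub> D m"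
  by (simp add: left_connection_def)

lemma
  assumes "\<And>k. k < n \<Longrightarrow> left_connection K \<Omega> (Sym k) (D k)" and "\<And>k. k < n \<Longrightarrow> left_splitting \<Omega> E k (s k)"
  shows jet_lift_linear: "jet_lift s D n \<in> mod_hom (alg \<Omega>) (Jet n) (Sym n)"
    and jet_lift_prolong: "e \<in> carrier E \<Longrightarrow> jet_lift s D n (prolong K \<Omega> E n e) = iterated s D n e"
    and jet_lift_iota: "t \<in> carrier (Sym n) \<Longrightarrow> jet_lift s D n (iota K \<Omega> E n t) = t"
proof -
  note J = left_module_jet and S = left_module_sym
  have "jet_lift s D n \<in> mod_hom (alg \<Omega>) (Jet n) (Sym n) \<and>
      (\<forall>e\<in>carrier E. jet_lift s D n (prolong K \<Omega> E n e) = iterated s D n e) \<and>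
      (\<forall>t\<in>carrier (Sym n). jet_lift s D n (iota K \<Omega> E n t) = t)"
    using assms
  proof (induction n)
    case 0
    then show ?case by (auto intro!: mod_homI)
  next
    case (Suc n)
    then have lin: "jet_lift s D n \<in> mod_hom (alg \<Omega>) (Jet n) (Sym n)"
      and prol: "\<And>e. e \<in> carrier E \<Longrightarrow> jet_lift s D n (prolong K \<Omega> E n e) = iterated s D n e"
      and iot: "\<And>t. t \<in> carrier (Sym n) \<Longrightarrow> jet_lift s D n (iota K \<Omega> E n t) = t" by auto
    have D: "left_connection K \<Omega> (Sym n) (D n)" and s: "left_splitting \<Omega> E n (s n)"
      using Suc.prems by auto
    note F = left_module_form[OF S[of n], of 1]
    interpret F: left_module "alg \<Omega>" "form_module \<Omega> 1 (Sym n)" by (rule F)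
    note fm = form_map_linear[OF J S lin, of 1]
    note D_add = left_connection_additive[OF D]
    \<comment> \<open>The step before the splitting is applied. It is linear on the whole first jet
      module of \<open>Jet n\<close> and is then restricted to the holonomic jets.\<close>
    define c where "c x = D n (jet_lift s D n (jet1_proj (Jet n) x)) \<ominus>\<^bsub>form_module \<Omega> 1 (Sym n)\<^esub>
      form_map \<Omega> 1 (Sym n) (jet_lift s D n) (jet1_der (Jet n) x)" for x
    have c_add: "c \<in> additive_maps (jet1 K \<Omega> (Jet n)) (form_module \<Omega> 1 (Sym n))"
      unfolding c_def[abs_def]
      by (rule additive_maps_subtract[OF abelian_group_form[OF S]
            additive_maps_compose[OF mod_hom_additive[OF mod_hom_compose[OF jet1_proj_linear[OF J] lin]] D_add]
            additive_maps_compose[OF jet1_der_additive[OF J] mod_hom_additive[OF fm]]])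
    \<comment> \<open>The connection and \<delta> both contribute the term
      \<open>da \<otimes> ?p\<close>, so it cancels in their difference.\<close>
    have c_smult: "c (a \<odot>\<^bsub>jet1 K \<Omega> (Jet n)\<^esub> x) = a \<odot>\<^bsub>form_module \<Omega> 1 (Sym n)\<^esub> c x"
      if a: "a \<in> G 0" and x: "x \<in> carrier (jet1 K \<Omega> (Jet n))" for a x
    proof -
      let ?p = "jet_lift s D n (jet1_proj (Jet n) x)"
        and ?d = "form_map \<Omega> 1 (Sym n) (jet_lift s D n) (jet1_der (Jet n) x)"
      have cl: "jet1_proj (Jet n) x \<in> carrier (Jet n)" "jet1_der (Jet n) x \<in> carrier (form_module \<Omega> 1 (Jet n))"
        "?p \<in> carrier (Sym n)" "?d \<in> carrier (form_module \<Omega> 1 (Sym n))" "D n ?p \<in> carrier (form_module \<Omega> 1 (Sym n))"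
        "pure 1 (Sym n) (deriv \<Omega> a) ?p \<in> carrier (form_module \<Omega> 1 (Sym n))"
        using jet1_proj_closed[OF J x] jet1_der_closed[OF J x] mod_hom_closed[OF lin] mod_hom_closed[OF fm]
          additive_maps_closed[OF D_add] pure_closed[OF S, of "deriv \<Omega> a" 1 ?p] a by simp_all
      note cl' = cl(4,5)[THEN smult_closed[OF F a]]
      have "a \<odot>\<^bsub>form_module \<Omega> 1 (Sym n)\<^esub> c x = a \<odot>\<^bsub>form_module \<Omega> 1 (Sym n)\<^esub> D n ?p \<ominus>\<^bsub>form_module \<Omega> 1 (Sym n)\<^esub>
          a \<odot>\<^bsub>form_module \<Omega> 1 (Sym n)\<^esub> ?d"
        unfolding c_def using a cl
        by (rule_tac additive_maps_diff[OF abelian_group_form[OF S] abelian_group_form[OF S] left_module_smult_additive[OF F]]) simp_all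
      moreover have "c (a \<odot>\<^bsub>jet1 K \<Omega> (Jet n)\<^esub> x) = (pure 1 (Sym n) (deriv \<Omega> a) ?p \<oplus>\<^bsub>form_module \<Omega> 1 (Sym n)\<^esub>
          a \<odot>\<^bsub>form_module \<Omega> 1 (Sym n)\<^esub> D n ?p) \<ominus>\<^bsub>form_module \<Omega> 1 (Sym n)\<^esub>
          (pure 1 (Sym n) (deriv \<Omega> a) ?p \<oplus>\<^bsub>form_module \<Omega> 1 (Sym n)\<^esub> a \<odot>\<^bsub>form_module \<Omega> 1 (Sym n)\<^esub> ?d)"
        unfolding c_def using a x cl
        by (simp add: mod_hom_smult[OF jet1_proj_linear[OF J]] mod_hom_smult[OF lin] left_connection_smult[OF D]
            jet1_der_smult[OF J] mod_hom_add[OF fm] mod_hom_smult[OF fm] form_map_pure[OF J S lin]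
            pure_closed[OF J] smult_closed[OF left_module_form[OF J]])
      ultimately show ?thesis
        using cl cl' by (simp add: F.M.minus_eq F.M.minus_add F.M.a_ac F.M.r_neg2)
    qed
    have c_lin: "c \<in> mod_hom (alg \<Omega>) (Jet (Suc n)) (form_module \<Omega> 1 (Sym n))"
      by (rule mod_homI) (simp_all add: jet_Suc additive_maps_closed[OF c_add] additive_maps_add[OF c_add] c_smult)
    have s_lin: "s n \<in> mod_hom (alg \<Omega>) (form_module \<Omega> 1 (Sym n)) (Sym (Suc n))"
      and s_id: "\<And>t. t \<in> carrier (Sym (Suc n)) \<Longrightarrow> s n t = t"
      using s by (auto simp: left_splitting_def)
    have eq: "jet_lift s D (Suc n) = (\<lambda>x. s n (c x))"
      by (rule ext) (simp add: c_def)
    \<comment> \<open>A prolongation has \<delta> zero, so only the connection applied to the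
      preceding lift remains.\<close>
    have "jet_lift s D (Suc n) (prolong K \<Omega> E (Suc n) e) = iterated s D (Suc n) e" if e: "e \<in> carrier E" for e
    proof -
      note p = prolong_closed[OF e, of n]
      have "c (prolong K \<Omega> E (Suc n) e) = D n (iterated s D n e)"
        using p additive_maps_closed[OF D_add] mod_hom_closed[OF lin p]
          additive_maps_zero[OF abelian_group_form[OF J] abelian_group_form[OF S] mod_hom_additive[OF fm]]
        by (simp add: c_def jet1_proj_prolong[OF J] jet1_der_prolong[OF J] flip: prol[OF e])
          (simp add: F.M.minus_eq)
      then show ?thesis unfolding eq by simp
    qed
    \<comment> \<open>Here \<pi> is zero and the two minus signs cancel. What remains is
      \<open>\<Omega>^1\<close> of the preceding lift after \<open>\<Omega>^1(\<iota>)\<close>, the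
      identity by induction; the splitting then fixes \<open>t\<close>, which already is a symmetric
      form.\<close>
    moreover have "jet_lift s D (Suc n) (iota K \<Omega> E (Suc n) t) = t" if t: "t \<in> carrier (Sym (Suc n))" for t
    proof -
      have t1: "t \<in> carrier (form_module \<Omega> 1 (Sym n))" by (rule sym_Suc_carrier[OF t])
      have "D n (jet_lift s D n \<zero>\<^bsub>Jet n\<^esub>) = \<zero>\<^bsub>form_module \<Omega> 1 (Sym n)\<^esub>"
        using additive_maps_zero[OF left_module_abelian_group[OF J] abelian_group_form[OF S]
            additive_maps_compose[OF mod_hom_additive[OF lin] D_add]] .
      moreover have "form_map \<Omega> 1 (Sym n) (jet_lift s D n) (form_map \<Omega> 1 (Jet n) (iota K \<Omega> E n) t) = t"
        unfolding form_map_comp[OF S J S iota_linear lin t1]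
        by (rule form_map_eq_identity[OF S iot t1])
      ultimately have "c (iota K \<Omega> E (Suc n) t) = t"
        unfolding c_def jet_proj_iota[OF t] jet_der_iota[OF t]
          additive_maps_minus[OF abelian_group_form[OF J] abelian_group_form[OF S] mod_hom_additive[OF fm]
            mod_hom_closed[OF form_map_linear[OF S J iota_linear] t1]]
        using t1 by (simp add: F.M.minus_eq F.M.minus_minus)
      then show ?thesis unfolding eq using s_id[OF t] by simp
    qed
    ultimately show ?case
      using mod_hom_compose[OF c_lin s_lin] unfolding eq by auto
  qed
  then show "jet_lift s D n \<in> mod_hom (alg \<Omega>) (Jet n) (Sym n)"
    "e \<in> carrier E \<Longrightarrow> jet_lift s D n (prolong K \<Omega> E n e) = iterated s D n e"
    "t \<in> carrier (Sym n) \<Longrightarrow> jet_lift s D n (iota K \<Omega> E n t) = t" by auto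
qed

end

end

section \<open>Sums and differences of module homomorphisms\<close>

lemma additive_maps_finsum:
  assumes "abelian_group M" and "abelian_group N" and "h \<in> additive_maps M N" and "finite S" and "f \<in> S \<rightarrow> carrier M"
  shows "h (finsum M f S) = finsum N (\<lambda>x. h (f x)) S"
proof -
  interpret M: abelian_group M by fact
  interpret N: abelian_group N by fact
  show ?thesis
    using assms(4,5)
  proof (induction S)
    case empty
    then show ?case using additive_maps_zero[OF assms(1-3)] by simp
  next
    case (insert x S)
    then have "(\<lambda>x. h (f x)) \<in> S \<rightarrow> carrier N" "h (f x) \<in> carrier N" "f \<in> S \<rightarrow> carrier M" "f x \<in> carrier M"
      using additive_maps_closed[OF assms(3)] by auto
    then show ?case using insert by (simp add: additive_maps_add[OF assms(3)])
  qed
qed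

lemma mod_hom_zero_map:
  assumes "left_module R N"
  shows "(\<lambda>x. \<zero>\<^bsub>N\<^esub>) \<in> mod_hom R M N"
  using left_module_smult_zero[OF assms] abelian_groupE(2,5)[OF left_module_abelian_group[OF assms]]
  by (auto intro!: mod_homI)

lemma mod_hom_plus:
  assumes "left_module R N" and "f \<in> mod_hom R M N" and "g \<in> mod_hom R M N"
  shows "(\<lambda>x. f x \<oplus>\<^bsub>N\<^esub> g x) \<in> mod_hom R M N"
  using additive_maps_plus[OF left_module_abelian_group[OF assms(1)] assms(2,3)[THEN mod_hom_additive]]
    left_module.lsmult_r_distr[OF assms(1)] assms(2,3)[THEN mod_hom_closed]
  by (auto simp: mod_hom_iff[of "\<lambda>x. f x \<oplus>\<^bsub>N\<^esub> g x"] mod_hom_smult[OF assms(2)] mod_hom_smult[OF assms(3)])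

lemma mod_hom_subtract:
  assumes "left_module R N" and "f \<in> mod_hom R M N" and "g \<in> mod_hom R M N"
  shows "(\<lambda>x. f x \<ominus>\<^bsub>N\<^esub> g x) \<in> mod_hom R M N"
proof -
  note N = left_module_abelian_group[OF assms(1)]
  have "a \<odot>\<^bsub>N\<^esub> (f x \<ominus>\<^bsub>N\<^esub> g x) = a \<odot>\<^bsub>N\<^esub> f x \<ominus>\<^bsub>N\<^esub> a \<odot>\<^bsub>N\<^esub> g x" if "a \<in> carrier R" "x \<in> carrier M" for a x
    using that mod_hom_closed assms(2,3)
    by (metis additive_maps_diff[OF N N left_module_smult_additive[OF assms(1) that(1)]])
  then show ?thesis
    using additive_maps_subtract[OF N assms(2,3)[THEN mod_hom_additive]]
    by (auto simp: mod_hom_iff[of "\<lambda>x. f x \<ominus>\<^bsub>N\<^esub> g x"] mod_hom_smult[OF assms(2)] mod_hom_smult[OF assms(3)])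
qed

section \<open>Differential operators\<close>

context exterior_algebra
begin

lemma left_module_kmod:
  assumes "left_module (alg \<Omega>) M"
  shows "left_module K (kmod \<Omega> M)"
proof -
  interpret M: left_module "alg \<Omega>" M by fact
  show ?thesis
  proof (rule left_moduleI)
    show "ring K" by (rule Mod.R.ring_axioms)
    show "abelian_group (kmod \<Omega> M)"
    proof (rule abelian_groupI)
      show "\<exists>y\<in>carrier (kmod \<Omega> M). y \<oplus>\<^bsub>kmod \<Omega> M\<^esub> x = \<zero>\<^bsub>kmod \<Omega> M\<^esub>" if "x \<in> carrier (kmod \<Omega> M)" for x
        using that by (intro bexI[of _ "\<ominus>\<^bsub>M\<^esub> x"]) (simp_all add: M.M.l_neg)
    qed (simp_all add: M.M.a_ac)
    show "(a \<otimes>\<^bsub>K\<^esub> b) \<odot>\<^bsub>kmod \<Omega> M\<^esub> x = a \<odot>\<^bsub>kmod \<Omega> M\<^esub> (b \<odot>\<^bsub>kmod \<Omega> M\<^esub> x)"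
      if "a \<in> carrier K" "b \<in> carrier K" "x \<in> carrier (kmod \<Omega> M)" for a b x
      using that M.lsmult_assoc[of "a \<odot>\<^bsub>\<Omega>\<^esub> \<one>\<^bsub>\<Omega>\<^esub>" "b \<odot>\<^bsub>\<Omega>\<^esub> \<one>\<^bsub>\<Omega>\<^esub>" x] smult_one_mult[of a "b \<odot>\<^bsub>\<Omega>\<^esub> \<one>\<^bsub>\<Omega>\<^esub>"]
      by (simp add: Mod.smult_assoc1)
  qed (use smult_closed[OF assms] M.lsmult_l_distr M.lsmult_r_distr M.lsmult_one in \<open>simp_all add: Mod.smult_l_distr\<close>)
qed

text \<open>Pointwise multiplication by an element of \<open>A\<close> need not preserve linearity;
  multiplication by \<open>c 1\<close> does, since \<open>c 1\<close> is central. This makes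
  operators a \<open>K\<close>-module.\<close>

lemma mod_hom_ksmult:
  assumes F: "left_module (alg \<Omega>) F" and f: "f \<in> mod_hom (alg \<Omega>) M F" and c: "c \<in> carrier K"
  shows "(\<lambda>x. (c \<odot>\<^bsub>\<Omega>\<^esub> \<one>\<^bsub>\<Omega>\<^esub>) \<odot>\<^bsub>F\<^esub> f x) \<in> mod_hom (alg \<Omega>) M F"
proof (rule mod_homI)
  interpret F: left_module "alg \<Omega>" F by (rule F)
  have c': "c \<odot>\<^bsub>\<Omega>\<^esub> \<one>\<^bsub>\<Omega>\<^esub> \<in> G 0" using c by simp
  fix x assume x: "x \<in> carrier M"
  show "(c \<odot>\<^bsub>\<Omega>\<^esub> \<one>\<^bsub>\<Omega>\<^esub>) \<odot>\<^bsub>F\<^esub> f x \<in> carrier F"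
    by (rule smult_closed[OF F c' mod_hom_closed[OF f x]])
  { fix y assume "y \<in> carrier M"
    then show "(c \<odot>\<^bsub>\<Omega>\<^esub> \<one>\<^bsub>\<Omega>\<^esub>) \<odot>\<^bsub>F\<^esub> f (x \<oplus>\<^bsub>M\<^esub> y) = (c \<odot>\<^bsub>\<Omega>\<^esub> \<one>\<^bsub>\<Omega>\<^esub>) \<odot>\<^bsub>F\<^esub> f x \<oplus>\<^bsub>F\<^esub> (c \<odot>\<^bsub>\<Omega>\<^esub> \<one>\<^bsub>\<Omega>\<^esub>) \<odot>\<^bsub>F\<^esub> f y"
      using x c' F.lsmult_r_distr mod_hom_closed[OF f] by (simp add: mod_hom_add[OF f]) }
  fix a assume "a \<in> carrier (alg \<Omega>)"
  then have a: "a \<in> G 0" by simp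
  have "(c \<odot>\<^bsub>\<Omega>\<^esub> \<one>\<^bsub>\<Omega>\<^esub>) \<otimes>\<^bsub>\<Omega>\<^esub> a = a \<otimes>\<^bsub>\<Omega>\<^esub> (c \<odot>\<^bsub>\<Omega>\<^esub> \<one>\<^bsub>\<Omega>\<^esub>)"
    using a c smult_one_mult[of c a] smult_mult_one[of c a] by simp
  then show "(c \<odot>\<^bsub>\<Omega>\<^esub> \<one>\<^bsub>\<Omega>\<^esub>) \<odot>\<^bsub>F\<^esub> f (a \<odot>\<^bsub>M\<^esub> x) = a \<odot>\<^bsub>F\<^esub> ((c \<odot>\<^bsub>\<Omega>\<^esub> \<one>\<^bsub>\<Omega>\<^esub>) \<odot>\<^bsub>F\<^esub> f x)"
    using a c' x mod_hom_closed[OF f] F.lsmult_assoc[of a "c \<odot>\<^bsub>\<Omega>\<^esub> \<one>\<^bsub>\<Omega>\<^esub>" "f x"] F.lsmult_assoc[of "c \<odot>\<^bsub>\<Omega>\<^esub> \<one>\<^bsub>\<Omega>\<^esub>" a "f x"]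
    by (simp add: mod_hom_smult[OF f])
qed

lemma operator_module_simps [simp]:
  "carrier (operator_module \<Omega> E F D) = D"
  "\<zero>\<^bsub>operator_module \<Omega> E F D\<^esub> = (\<lambda>e\<in>carrier E. \<zero>\<^bsub>F\<^esub>)"
  "\<Delta> \<oplus>\<^bsub>operator_module \<Omega> E F D\<^esub> \<Delta>' = (\<lambda>e\<in>carrier E. \<Delta> e \<oplus>\<^bsub>F\<^esub> \<Delta>' e)"
  "c \<odot>\<^bsub>operator_module \<Omega> E F D\<^esub> \<Delta> = (\<lambda>e\<in>carrier E. (c \<odot>\<^bsub>\<Omega>\<^esub> \<one>\<^bsub>\<Omega>\<^esub>) \<odot>\<^bsub>F\<^esub> \<Delta> e)"
  "operator_module \<Omega> E F D\<lparr>carrier := D'\<rparr> = operator_module \<Omega> E F D'"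
  by (simp_all add: operator_module_def)

text \<open>Serves for the operators of order at most \<open>n\<close>, for all operators together,
  and for the zero module that stands below order \<open>0\<close>.\<close>

lemma left_module_operators:
  assumes F: "left_module (alg \<Omega>) F" and D: "D \<subseteq> (carrier E \<rightarrow>\<^sub>E carrier F)"
    and zero: "(\<lambda>e\<in>carrier E. \<zero>\<^bsub>F\<^esub>) \<in> D"
    and add: "\<And>\<Delta> \<Delta>'. \<lbrakk>\<Delta> \<in> D; \<Delta>' \<in> D\<rbrakk> \<Longrightarrow> (\<lambda>e\<in>carrier E. \<Delta> e \<oplus>\<^bsub>F\<^esub> \<Delta>' e) \<in> D"
    and smult: "\<And>c \<Delta>. \<lbrakk>c \<in> carrier K; \<Delta> \<in> D\<rbrakk> \<Longrightarrow> (\<lambda>e\<in>carrier E. (c \<odot>\<^bsub>\<Omega>\<^esub> \<one>\<^bsub>\<Omega>\<^esub>) \<odot>\<^bsub>F\<^esub> \<Delta> e) \<in> D"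
  shows "left_module K (operator_module \<Omega> E F D)"
proof -
  interpret F: left_module "alg \<Omega>" F by (rule F)
  interpret k: left_module K "kmod \<Omega> F" by (rule left_module_kmod[OF F])
  have cl: "\<Delta> e \<in> carrier F" if "\<Delta> \<in> D" "e \<in> carrier E" for \<Delta> e
    using that D by auto
  \<comment> \<open>The laws of zero and of the unit compare a restricted function with \<Delta>
    itself, hence rest on extensionality.\<close>
  have ext: "\<Delta> = (\<lambda>e\<in>carrier E. \<Delta> e)" if "\<Delta> \<in> D" for \<Delta>
    using that D by (simp add: PiE_def extensional_restrict subset_iff)
  show ?thesis
  proof (rule left_moduleI)
    show "ring K" by (rule Mod.R.ring_axioms)
    show "abelian_group (operator_module \<Omega> E F D)"
    proof (rule abelian_groupI; unfold operator_module_simps)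
      fix \<Delta> assume \<Delta>: "\<Delta> \<in> D"
      show "(\<lambda>e\<in>carrier E. (\<lambda>e\<in>carrier E. \<zero>\<^bsub>F\<^esub>) e \<oplus>\<^bsub>F\<^esub> \<Delta> e) = \<Delta>"
        by (subst (2) ext[OF \<Delta>]) (use cl[OF \<Delta>] in \<open>auto intro!: restrict_ext\<close>)
      have "\<ominus>\<^bsub>K\<^esub> \<one>\<^bsub>K\<^esub> \<in> carrier K" by simp
      from smult[OF this \<Delta>]
      show "\<exists>\<Delta>'\<in>D. (\<lambda>e\<in>carrier E. \<Delta>' e \<oplus>\<^bsub>F\<^esub> \<Delta> e) = (\<lambda>e\<in>carrier E. \<zero>\<^bsub>F\<^esub>)"
      proof (rule bexI[rotated], intro restrict_ext)
        fix e assume e: "e \<in> carrier E"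
        have "((\<ominus>\<^bsub>K\<^esub> \<one>\<^bsub>K\<^esub>) \<odot>\<^bsub>\<Omega>\<^esub> \<one>\<^bsub>\<Omega>\<^esub>) \<odot>\<^bsub>F\<^esub> \<Delta> e \<oplus>\<^bsub>F\<^esub> \<Delta> e = \<zero>\<^bsub>F\<^esub>"
          using left_module_minus_one_smult[OF left_module_kmod[OF F], of "\<Delta> e"] k.M.l_neg[of "\<Delta> e"] cl[OF \<Delta> e] by simp
        then show "(\<lambda>e\<in>carrier E. ((\<ominus>\<^bsub>K\<^esub> \<one>\<^bsub>K\<^esub>) \<odot>\<^bsub>\<Omega>\<^esub> \<one>\<^bsub>\<Omega>\<^esub>) \<odot>\<^bsub>F\<^esub> \<Delta> e) e \<oplus>\<^bsub>F\<^esub> \<Delta> e = \<zero>\<^bsub>F\<^esub>"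
          using e by simp
      qed
      fix \<Delta>' assume \<Delta>': "\<Delta>' \<in> D"
      show "(\<lambda>e\<in>carrier E. \<Delta> e \<oplus>\<^bsub>F\<^esub> \<Delta>' e) = (\<lambda>e\<in>carrier E. \<Delta>' e \<oplus>\<^bsub>F\<^esub> \<Delta> e)"
        using cl \<Delta> \<Delta>' by (intro restrict_ext) (simp add: F.M.a_comm)
      fix \<Delta>'' assume "\<Delta>'' \<in> D"
      then show "(\<lambda>e\<in>carrier E. (\<lambda>e\<in>carrier E. \<Delta> e \<oplus>\<^bsub>F\<^esub> \<Delta>' e) e \<oplus>\<^bsub>F\<^esub> \<Delta>'' e)
          = (\<lambda>e\<in>carrier E. \<Delta> e \<oplus>\<^bsub>F\<^esub> (\<lambda>e\<in>carrier E. \<Delta>' e \<oplus>\<^bsub>F\<^esub> \<Delta>'' e) e)"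
        using cl \<Delta> \<Delta>' by (intro restrict_ext) (simp add: F.M.a_assoc)
    qed (use zero add in auto)
    show "\<one>\<^bsub>K\<^esub> \<odot>\<^bsub>operator_module \<Omega> E F D\<^esub> \<Delta> = \<Delta>" if "\<Delta> \<in> carrier (operator_module \<Omega> E F D)" for \<Delta>
    proof -
      from that have \<Delta>: "\<Delta> \<in> D" by simp
      then show ?thesis
        unfolding operator_module_simps
        by (subst (2) ext[OF \<Delta>]) (use cl[OF \<Delta>] k.lsmult_one in \<open>auto intro!: restrict_ext\<close>)
    qed
  qed (use smult cl k.lsmult_l_distr k.lsmult_r_distr k.lsmult_assoc in \<open>auto intro!: restrict_ext\<close>)
qed

context
  fixes E :: "('w, 'e) module"
  assumes E: "left_module (alg \<Omega>) E"
begin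

abbreviation "Prol \<equiv> prolong K \<Omega> E"

text \<open>Together with \<open>diff_opE\<close> this presents every operator of order
  \<open>n\<close> by a linear map on \<open>Jet n\<close>; the later arguments are carried out on
  these lifts. \<open>K\<close>-linearity is inherited from prolongation.\<close>

lemma lift_diff_op:
  assumes "L \<in> mod_hom (alg \<Omega>) (Jet E n) F"
  shows "(\<lambda>e\<in>carrier E. L (Prol n e)) \<in> diff_ops K \<Omega> E F n"
  unfolding diff_ops_def
proof (intro CollectI conjI IntI bexI[of _ L] assms)
  note p = prolong_closed[OF E]
  show "(\<lambda>e\<in>carrier E. L (Prol n e)) \<in> mod_hom K (kmod \<Omega> E) (kmod \<Omega> F)"
  proof (rule mod_homI)
    show "(\<lambda>e\<in>carrier E. L (Prol n e)) (c \<odot>\<^bsub>kmod \<Omega> E\<^esub> e) = c \<odot>\<^bsub>kmod \<Omega> F\<^esub> (\<lambda>e\<in>carrier E. L (Prol n e)) e"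
      if "c \<in> carrier K" "e \<in> carrier (kmod \<Omega> E)" for c e
      using that p smult_closed[OF E] prolong_ksmult[OF E, of c e n] mod_hom_smult[OF assms, of "c \<odot>\<^bsub>\<Omega>\<^esub> \<one>\<^bsub>\<Omega>\<^esub>" "Prol n e"]
      by simp
    show "(\<lambda>e\<in>carrier E. L (Prol n e)) (e \<oplus>\<^bsub>kmod \<Omega> E\<^esub> f)
        = (\<lambda>e\<in>carrier E. L (Prol n e)) e \<oplus>\<^bsub>kmod \<Omega> F\<^esub> (\<lambda>e\<in>carrier E. L (Prol n e)) f"
      if "e \<in> carrier (kmod \<Omega> E)" "f \<in> carrier (kmod \<Omega> E)" for e f
      using that p abelian_groupE(1)[OF left_module_abelian_group[OF E]]
      by (simp add: prolong_add[OF E] mod_hom_add[OF assms])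
  qed (use p mod_hom_closed[OF assms] in simp)
qed auto

lemma diff_opE:
  assumes "\<Delta> \<in> diff_ops K \<Omega> E F n"
  obtains L where "L \<in> mod_hom (alg \<Omega>) (Jet E n) F" and "\<Delta> = (\<lambda>e\<in>carrier E. L (Prol n e))"
proof -
  from assms obtain L where "L \<in> mod_hom (alg \<Omega>) (Jet E n) F" "\<forall>e\<in>carrier E. L (Prol n e) = \<Delta> e"
    and "\<Delta> \<in> extensional (carrier E)"
    by (auto simp: diff_ops_def)
  then show ?thesis
    by (intro that[of L]) (auto simp: extensional_def)
qed

text \<open>A lift of order \<open>n\<close> becomes one of order \<open>n + 1\<close> by
  composition with \<pi>, since \<pi> sends prolongations to prolongations.\<close>

lemma diff_ops_Suc: "diff_ops K \<Omega> E F n \<subseteq> diff_ops K \<Omega> E F (Suc n)"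
proof
  fix \<Delta> assume "\<Delta> \<in> diff_ops K \<Omega> E F n"
  then obtain L where L: "L \<in> mod_hom (alg \<Omega>) (Jet E n) F" "\<Delta> = (\<lambda>e\<in>carrier E. L (Prol n e))"
    by (rule diff_opE)
  have "\<Delta> = (\<lambda>e\<in>carrier E. L (jet1_proj (Jet E n) (Prol (Suc n) e)))"
    unfolding L(2) using jet_proj_prolong[OF E] by (intro restrict_ext) simp
  then show "\<Delta> \<in> diff_ops K \<Omega> E F (Suc n)"
    using lift_diff_op[OF mod_hom_compose[OF jet_proj_linear[OF E] L(1)]] by simp
qed

lemma diff_ops_mono: "m \<le> n \<Longrightarrow> diff_ops K \<Omega> E F m \<subseteq> diff_ops K \<Omega> E F n"
  using lift_Suc_mono_le[of "diff_ops K \<Omega> E F"] diff_ops_Suc by blast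

lemma diff_ops_extensional: "diff_ops K \<Omega> E F n \<subseteq> (carrier E \<rightarrow>\<^sub>E carrier F)"
  by (auto simp: diff_ops_def mod_hom_def PiE_def)

context
  fixes F :: "('w, 'f) module"
  assumes F: "left_module (alg \<Omega>) F"
begin

lemma diff_ops_zero: "(\<lambda>e\<in>carrier E. \<zero>\<^bsub>F\<^esub>) \<in> diff_ops K \<Omega> E F n"
  using lift_diff_op[OF mod_hom_zero_map[OF F]] .

lemma diff_ops_add:
  assumes "\<Delta> \<in> diff_ops K \<Omega> E F n" and "\<Delta>' \<in> diff_ops K \<Omega> E F n"
  shows "(\<lambda>e\<in>carrier E. \<Delta> e \<oplus>\<^bsub>F\<^esub> \<Delta>' e) \<in> diff_ops K \<Omega> E F n"
proof -
  obtain L where L: "L \<in> mod_hom (alg \<Omega>) (Jet E n) F" "\<Delta> = (\<lambda>e\<in>carrier E. L (Prol n e))"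
    using assms(1) by (rule diff_opE)
  obtain L' where L': "L' \<in> mod_hom (alg \<Omega>) (Jet E n) F" "\<Delta>' = (\<lambda>e\<in>carrier E. L' (Prol n e))"
    using assms(2) by (rule diff_opE)
  show ?thesis
    using lift_diff_op[OF mod_hom_plus[OF F L(1) L'(1)]] by (simp add: L(2) L'(2) cong: restrict_cong)
qed

lemma diff_ops_smult:
  assumes "c \<in> carrier K" and "\<Delta> \<in> diff_ops K \<Omega> E F n"
  shows "(\<lambda>e\<in>carrier E. (c \<odot>\<^bsub>\<Omega>\<^esub> \<one>\<^bsub>\<Omega>\<^esub>) \<odot>\<^bsub>F\<^esub> \<Delta> e) \<in> diff_ops K \<Omega> E F n"
proof -
  obtain L where L: "L \<in> mod_hom (alg \<Omega>) (Jet E n) F" "\<Delta> = (\<lambda>e\<in>carrier E. L (Prol n e))"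
    using assms(2) by (rule diff_opE)
  show ?thesis
    using lift_diff_op[OF mod_hom_ksmult[OF F L(1) assms(1)]] by (simp add: L(2) cong: restrict_cong)
qed

lemma left_module_Diff_n: "left_module K (Diff_n K \<Omega> E n F)"
  unfolding Diff_n_def
  by (rule left_module_operators[OF F diff_ops_extensional diff_ops_zero diff_ops_add diff_ops_smult])

lemma left_module_Diff: "left_module K (Diff K \<Omega> E F)"
  unfolding Diff_def
proof (rule left_module_operators[OF F])
  fix \<Delta> \<Delta>' assume "\<Delta> \<in> (\<Union>n. diff_ops K \<Omega> E F n)" "\<Delta>' \<in> (\<Union>n. diff_ops K \<Omega> E F n)"
  then obtain m n where "\<Delta> \<in> diff_ops K \<Omega> E F m" "\<Delta>' \<in> diff_ops K \<Omega> E F n" by blast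
  then have "\<Delta> \<in> diff_ops K \<Omega> E F (max m n)" "\<Delta>' \<in> diff_ops K \<Omega> E F (max m n)"
    using diff_ops_mono[of m "max m n"] diff_ops_mono[of n "max m n"] by auto
  from diff_ops_add[OF this]
  show "(\<lambda>e\<in>carrier E. \<Delta> e \<oplus>\<^bsub>F\<^esub> \<Delta>' e) \<in> (\<Union>n. diff_ops K \<Omega> E F n)"
    by (rule UN_I[OF UNIV_I])
next
  show "(\<Union>n. diff_ops K \<Omega> E F n) \<subseteq> (carrier E \<rightarrow>\<^sub>E carrier F)"
    by (rule UN_least[OF diff_ops_extensional])
  show "(\<lambda>e\<in>carrier E. \<zero>\<^bsub>F\<^esub>) \<in> (\<Union>n. diff_ops K \<Omega> E F n)"
    by (rule UN_I[OF UNIV_I], rule diff_ops_zero)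
  fix c \<Delta> assume c: "c \<in> carrier K" and "\<Delta> \<in> (\<Union>n. diff_ops K \<Omega> E F n)"
  then obtain n where "\<Delta> \<in> diff_ops K \<Omega> E F n" by blast
  from diff_ops_smult[OF c this]
  show "(\<lambda>e\<in>carrier E. (c \<odot>\<^bsub>\<Omega>\<^esub> \<one>\<^bsub>\<Omega>\<^esub>) \<odot>\<^bsub>F\<^esub> \<Delta> e) \<in> (\<Union>n. diff_ops K \<Omega> E F n)"
    by (rule UN_I[OF UNIV_I])
qed

section \<open>Operators of lower order and symbols\<close>

lemma diff_ops_below_subset: "diff_ops_below K \<Omega> E F n \<subseteq> diff_ops K \<Omega> E F n"
  using diff_ops_Suc diff_ops_zero by (cases n) (auto simp: diff_ops_below_def)

lemma left_module_below: "left_module K (Diff_n K \<Omega> E n F\<lparr>carrier := diff_ops_below K \<Omega> E F n\<rparr>)"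
proof (cases n)
  case 0
  have "left_module K (operator_module \<Omega> E F {\<lambda>e\<in>carrier E. \<zero>\<^bsub>F\<^esub>})"
    using abelian_groupE(2,5)[OF left_module_abelian_group[OF F]] left_module_smult_zero[OF F]
    by (intro left_module_operators[OF F]) (auto intro!: restrict_ext)
  then show ?thesis using 0 by (simp add: Diff_n_def diff_ops_below_def)
next
  case (Suc m)
  have "left_module K (operator_module \<Omega> E F (diff_ops K \<Omega> E F m))"
    by (rule left_module_operators[OF F diff_ops_extensional diff_ops_zero diff_ops_add diff_ops_smult])
  then show ?thesis using Suc by (simp add: Diff_n_def diff_ops_below_def)
qed

lemma carrier_Diff_n: "carrier (Diff_n K \<Omega> E n F) = diff_ops K \<Omega> E F n"
  and zero_Diff_n: "\<zero>\<^bsub>Diff_n K \<Omega> E n F\<^esub> = (\<lambda>e\<in>carrier E. \<zero>\<^bsub>F\<^esub>)"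
  and add_Diff_n: "\<Delta> \<oplus>\<^bsub>Diff_n K \<Omega> E n F\<^esub> \<Delta>' = (\<lambda>e\<in>carrier E. \<Delta> e \<oplus>\<^bsub>F\<^esub> \<Delta>' e)"
  and smult_Diff_n: "c \<odot>\<^bsub>Diff_n K \<Omega> E n F\<^esub> \<Delta> = (\<lambda>e\<in>carrier E. (c \<odot>\<^bsub>\<Omega>\<^esub> \<one>\<^bsub>\<Omega>\<^esub>) \<odot>\<^bsub>F\<^esub> \<Delta> e)"
  by (simp_all add: Diff_n_def)

lemma below_subset_carrier: "diff_ops_below K \<Omega> E F n \<subseteq> carrier (Diff_n K \<Omega> E n F)"
  unfolding carrier_Diff_n by (rule diff_ops_below_subset)

lemmas Diff_n_coset = left_module_Diff_n left_module_below below_subset_carrier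

lemma symb_self: "\<Delta> \<in> diff_ops K \<Omega> E F n \<Longrightarrow> \<Delta> \<in> symb K \<Omega> E n F \<Delta>"
  unfolding symb_def using coset_self[OF Diff_n_coset] by (simp add: carrier_Diff_n)

lemma symb_memD: "\<Delta>' \<in> symb K \<Omega> E n F \<Delta> \<Longrightarrow> \<exists>\<delta>\<in>diff_ops_below K \<Omega> E F n. \<Delta>' = \<delta> \<oplus>\<^bsub>Diff_n K \<Omega> E n F\<^esub> \<Delta>"
  unfolding symb_def using coset_memD[OF Diff_n_coset] .

lemma symb_add_below:
  "\<lbrakk>\<Delta> \<in> diff_ops K \<Omega> E F n; \<delta> \<in> diff_ops_below K \<Omega> E F n\<rbrakk> \<Longrightarrow>
    symb K \<Omega> E n F (\<delta> \<oplus>\<^bsub>Diff_n K \<Omega> E n F\<^esub> \<Delta>) = symb K \<Omega> E n F \<Delta>"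
  unfolding symb_def using coset_eq[OF Diff_n_coset] by (simp add: carrier_Diff_n)

lemma symb_add:
  "\<lbrakk>\<Delta> \<in> diff_ops K \<Omega> E F n; \<Delta>' \<in> diff_ops K \<Omega> E F n\<rbrakk> \<Longrightarrow>
    symb K \<Omega> E n F \<Delta> \<oplus>\<^bsub>Symb_n K \<Omega> E n F\<^esub> symb K \<Omega> E n F \<Delta>' = symb K \<Omega> E n F (\<Delta> \<oplus>\<^bsub>Diff_n K \<Omega> E n F\<^esub> \<Delta>')"
  unfolding symb_def Symb_n_def using coset_add[OF Diff_n_coset] by (simp add: carrier_Diff_n)

lemma symb_smult:
  "\<lbrakk>c \<in> carrier K; \<Delta> \<in> diff_ops K \<Omega> E F n\<rbrakk> \<Longrightarrow>
    c \<odot>\<^bsub>Symb_n K \<Omega> E n F\<^esub> symb K \<Omega> E n F \<Delta> = symb K \<Omega> E n F (c \<odot>\<^bsub>Diff_n K \<Omega> E n F\<^esub> \<Delta>)"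
  unfolding symb_def Symb_n_def using coset_smult[OF Diff_n_coset] by (simp add: carrier_Diff_n)

lemma symb_zero: "\<zero>\<^bsub>Symb_n K \<Omega> E n F\<^esub> = symb K \<Omega> E n F \<zero>\<^bsub>Diff_n K \<Omega> E n F\<^esub>"
  unfolding symb_def Symb_n_def by (rule coset_zero[OF Diff_n_coset])

lemma carrier_Symb_n: "carrier (Symb_n K \<Omega> E n F) = symb K \<Omega> E n F ` diff_ops K \<Omega> E F n"
  by (simp add: Symb_n_def carrier_quot_module carrier_Diff_n symb_def image_def)

lemma left_module_Symb_n: "left_module K (Symb_n K \<Omega> E n F)"
proof -
  let ?D = "Diff_n K \<Omega> E n F" and ?S = "Symb_n K \<Omega> E n F" and ?s = "symb K \<Omega> E n F"
  interpret D: left_module K ?D by (rule left_module_Diff_n)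
  note symb = symb_add[folded carrier_Diff_n] symb_smult[folded carrier_Diff_n]
  have symbE: thesis if "\<sigma> \<in> carrier ?S" and "\<And>\<Delta>. \<lbrakk>\<Delta> \<in> carrier ?D; \<sigma> = ?s \<Delta>\<rbrakk> \<Longrightarrow> thesis" for \<sigma> thesis
    using that by (auto simp: carrier_Symb_n carrier_Diff_n)
  have symb_closed: "?s \<Delta> \<in> carrier ?S" if "\<Delta> \<in> carrier ?D" for \<Delta>
    using that by (simp add: carrier_Symb_n carrier_Diff_n)
  show ?thesis
  proof (rule left_moduleI[OF left_module_ring[OF left_module_Diff_n]])
    show "abelian_group ?S"
    proof (rule abelian_groupI)
      show "\<exists>\<tau>\<in>carrier ?S. \<tau> \<oplus>\<^bsub>?S\<^esub> \<sigma> = \<zero>\<^bsub>?S\<^esub>" if "\<sigma> \<in> carrier ?S" for \<sigma>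
        using that
      proof (rule symbE)
        fix \<Delta> assume "\<Delta> \<in> carrier ?D" "\<sigma> = ?s \<Delta>"
        then show ?thesis
          by (intro bexI[of _ "?s (\<ominus>\<^bsub>?D\<^esub> \<Delta>)"]) (simp_all add: symb symb_closed symb_zero D.M.l_neg)
      qed
    qed (auto elim!: symbE simp: symb symb_closed symb_zero D.M.a_ac)
  qed (auto elim!: symbE simp: symb symb_closed D.lsmult_closed D.lsmult_l_distr D.lsmult_r_distr D.lsmult_assoc D.lsmult_one)
qed

section \<open>Lifts and restriction symbols\<close>

lemma lift_unique:
  assumes gen: "generated_by_prolongations K \<Omega> E n"
    and L: "L \<in> mod_hom (alg \<Omega>) (Jet E n) F" and L': "L' \<in> mod_hom (alg \<Omega>) (Jet E n) F"
    and eq: "\<And>e. e \<in> carrier E \<Longrightarrow> L (Prol n e) = L' (Prol n e)" and x: "x \<in> carrier (Jet E n)"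
  shows "L x = L' x"
proof -
  obtain ts where ts: "set ts \<subseteq> G 0 \<times> carrier E" "x = lsum (Jet E n) (\<lambda>(a, e). a \<odot>\<^bsub>Jet E n\<^esub> Prol n e) ts"
    using gen x by (auto simp: generated_by_prolongations_def)
  have sum: "H x = lsum F (\<lambda>p. H (case p of (a, e) \<Rightarrow> a \<odot>\<^bsub>Jet E n\<^esub> Prol n e)) ts"
    if "H \<in> mod_hom (alg \<Omega>) (Jet E n) F" for H
    unfolding ts(2) using ts(1) prolong_closed[OF E] smult_closed[OF left_module_jet[OF E]]
    by (intro additive_maps_lsum[OF left_module_abelian_group[OF left_module_jet[OF E]] left_module_abelian_group[OF F]
          mod_hom_additive[OF that]]) auto
  show ?thesis
    unfolding sum[OF L] sum[OF L']
    using ts(1) prolong_closed[OF E] eq by (intro lsum_cong) (auto simp: mod_hom_smult[OF L] mod_hom_smult[OF L'])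
qed

text \<open>An operator of order \<open>n - 1\<close> has a lift that factors through \<pi>, and
  uniqueness of lifts forces \<open>L\<close> to be that one; \<pi> annihilates the embedded forms.
  This is why the restriction symbol depends only on the class of an operator.\<close>

lemma below_lift_iota:
  assumes gen: "generated_by_prolongations K \<Omega> E n"
    and L: "L \<in> mod_hom (alg \<Omega>) (Jet E n) F"
    and below: "(\<lambda>e\<in>carrier E. L (Prol n e)) \<in> diff_ops_below K \<Omega> E F n"
    and t: "t \<in> carrier (Sym E n)"
  shows "L (iota K \<Omega> E n t) = \<zero>\<^bsub>F\<^esub>"
proof (cases n)
  case 0
  \<comment> \<open>Below order \<open>0\<close> there is only the zero operator, so here
    \<open>L\<close> itself is zero.\<close>
  then have "(\<lambda>e\<in>carrier E. L (Prol n e)) = (\<lambda>e\<in>carrier E. \<zero>\<^bsub>F\<^esub>)"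
    using below by (simp add: diff_ops_below_def)
  from fun_cong[OF this] have "L (Prol n e) = \<zero>\<^bsub>F\<^esub>" if "e \<in> carrier E" for e
    using that by (simp add: restrict_def split: if_splits) metis
  then show ?thesis
    using lift_unique[OF gen L mod_hom_zero_map[OF F]] mod_hom_closed[OF iota_linear[OF E] t] by simp
next
  case (Suc m)
  then obtain L' where L': "L' \<in> mod_hom (alg \<Omega>) (Jet E m) F"
    "(\<lambda>e\<in>carrier E. L (Prol n e)) = (\<lambda>e\<in>carrier E. L' (Prol m e))"
    using below by (auto simp: diff_ops_below_def elim!: diff_opE)
  have "L (Prol n e) = L' (jet1_proj (Jet E m) (Prol n e))" if "e \<in> carrier E" for e
    using fun_cong[OF L'(2), of e] that jet_proj_prolong[OF E that] by (simp add: Suc)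
  then have "L (iota K \<Omega> E n t) = L' (jet1_proj (Jet E m) (iota K \<Omega> E n t))"
    using mod_hom_compose[OF jet_proj_linear[OF E] L'(1)] mod_hom_closed[OF iota_linear[OF E] t]
    by (rule_tac lift_unique[OF gen L]) (simp_all add: Suc del: prolong.simps)
  also have "\<dots> = \<zero>\<^bsub>F\<^esub>"
    using jet_proj_iota[OF E, of t m] t Suc
      additive_maps_zero[OF left_module_abelian_group[OF left_module_jet[OF E]] left_module_abelian_group[OF F] mod_hom_additive[OF L'(1)]]
    by simp
  finally show ?thesis .
qed

text \<open>The converse, from exactness: \<open>L\<close> vanishes on the image of the embedding,
  which is the kernel of the surjection \<pi>, and so factors through the jets of order
  \<open>n - 1\<close>.\<close>

lemma lift_vanishing_below:
  assumes exact: "jet_sequence_right_exact K \<Omega> E n"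
    and L: "L \<in> mod_hom (alg \<Omega>) (Jet E n) F"
    and vanish: "\<And>t. t \<in> carrier (Sym E n) \<Longrightarrow> L (iota K \<Omega> E n t) = \<zero>\<^bsub>F\<^esub>"
  shows "(\<lambda>e\<in>carrier E. L (Prol n e)) \<in> diff_ops_below K \<Omega> E F n"
proof (cases n)
  case 0
  \<comment> \<open>In order \<open>0\<close> the embedding is the identity, so the hypothesis
    applies to the prolongation itself.\<close>
  have "L (Prol n e) = \<zero>\<^bsub>F\<^esub>" if "e \<in> carrier E" for e
    using vanish[of "Prol n e"] that 0 by (simp add: base_module_def)
  then show ?thesis
    using 0 by (simp add: diff_ops_below_def cong: restrict_cong)
next
  case (Suc m)
  let ?\<pi> = "jet1_proj (Jet E m)"
  note J = left_module_jet[OF E]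
  interpret Jm: left_module "alg \<Omega>" "Jet E m" by (rule J)
  interpret Jn: left_module "alg \<Omega>" "Jet E n" by (rule J)
  interpret F: left_module "alg \<Omega>" F by (rule F)
  have \<pi>: "?\<pi> \<in> mod_hom (alg \<Omega>) (Jet E n) (Jet E m)"
    unfolding Suc by (rule jet_proj_linear[OF E])
  have ker: "iota K \<Omega> E n ` carrier (Sym E n) = {x \<in> carrier (Jet E n). ?\<pi> x = \<zero>\<^bsub>Jet E m\<^esub>}"
    and surj: "?\<pi> ` carrier (Jet E n) = carrier (Jet E m)"
    using exact by (simp_all add: jet_sequence_right_exact_def Suc)
  have welldef: "L x = L y" if x: "x \<in> carrier (Jet E n)" and y: "y \<in> carrier (Jet E n)" and "?\<pi> x = ?\<pi> y" for x y
  proof -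
    have "?\<pi> (x \<ominus>\<^bsub>Jet E n\<^esub> y) = \<zero>\<^bsub>Jet E m\<^esub>"
      using that mod_hom_closed[OF \<pi>]
      by (simp add: additive_maps_diff[OF left_module_abelian_group[OF J] left_module_abelian_group[OF J] mod_hom_additive[OF \<pi>]]
          Jm.M.minus_eq Jm.M.r_neg)
    then have "x \<ominus>\<^bsub>Jet E n\<^esub> y \<in> iota K \<Omega> E n ` carrier (Sym E n)"
      unfolding ker using x y by simp
    then have "L x \<ominus>\<^bsub>F\<^esub> L y = \<zero>\<^bsub>F\<^esub>"
      using vanish additive_maps_diff[OF left_module_abelian_group[OF J] left_module_abelian_group[OF F] mod_hom_additive[OF L] x y]
      by auto
    then show ?thesis
      by (rule F.M.eq_if_minus_eq_zero) (simp_all add: mod_hom_closed[OF L] x y)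
  qed
  \<comment> \<open>An arbitrary set-theoretic section of \<pi>, in general not linear;
    \<open>L \<circ> r\<close> is linear because \<open>L\<close> is constant on the fibres of
    \<pi>.\<close>
  define r where "r = inv_into (carrier (Jet E n)) ?\<pi>"
  have r: "r y \<in> carrier (Jet E n)" "?\<pi> (r y) = y" if "y \<in> carrier (Jet E m)" for y
    using that surj inv_into_into[of y ?\<pi>] f_inv_into_f[of y ?\<pi>] by (auto simp: r_def)
  have lin: "(\<lambda>y. L (r y)) \<in> mod_hom (alg \<Omega>) (Jet E m) F"
  proof (rule mod_homI)
    fix x assume x: "x \<in> carrier (Jet E m)"
    show "L (r x) \<in> carrier F" by (rule mod_hom_closed[OF L r(1)[OF x]])
    { fix y assume y: "y \<in> carrier (Jet E m)"
      have "L (r (x \<oplus>\<^bsub>Jet E m\<^esub> y)) = L (r x \<oplus>\<^bsub>Jet E n\<^esub> r y)"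
        by (rule welldef) (use x y in \<open>simp_all add: r mod_hom_add[OF \<pi>]\<close>)
      then show "L (r (x \<oplus>\<^bsub>Jet E m\<^esub> y)) = L (r x) \<oplus>\<^bsub>F\<^esub> L (r y)"
        using x y by (simp add: mod_hom_add[OF L] r) }
    fix a assume a: "a \<in> carrier (alg \<Omega>)"
    have "L (r (a \<odot>\<^bsub>Jet E m\<^esub> x)) = L (a \<odot>\<^bsub>Jet E n\<^esub> r x)"
      by (rule welldef) (use x a in \<open>simp_all add: r mod_hom_smult[OF \<pi>] smult_closed[OF J]\<close>)
    then show "L (r (a \<odot>\<^bsub>Jet E m\<^esub> x)) = a \<odot>\<^bsub>F\<^esub> L (r x)"
      using x a by (simp add: mod_hom_smult[OF L] r)
  qed
  have "L (r (Prol m e)) = L (Prol n e)" if "e \<in> carrier E" for e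
  proof (rule welldef)
    have "?\<pi> (Prol n e) = Prol m e"
      unfolding Suc by (rule jet_proj_prolong[OF E that])
    then show "?\<pi> (r (Prol m e)) = ?\<pi> (Prol n e)"
      using r(2)[OF prolong_closed[OF E that]] by simp
  qed (use r(1) prolong_closed[OF E that] in auto)
  then have "(\<lambda>e\<in>carrier E. L (Prol n e)) = (\<lambda>e\<in>carrier E. L (r (Prol m e)))"
    by (intro restrict_ext) simp
  then show ?thesis
    using lift_diff_op[OF lin] by (simp add: diff_ops_below_def Suc del: prolong.simps)
qed

text \<open>The description ranges over all representatives of the symbol and all their lifts. The
  difference of two such lifts presents an operator of order \<open>n - 1\<close>, so it vanishes on
  embedded forms by \<open>below_lift_iota\<close>.\<close>

lemma restriction_symbol_eq:
  assumes gen: "generated_by_prolongations K \<Omega> E n" and L: "L \<in> mod_hom (alg \<Omega>) (Jet E n) F"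
  shows "restriction_symbol K \<Omega> E n F (symb K \<Omega> E n F (\<lambda>e\<in>carrier E. L (Prol n e)))
    = (\<lambda>t\<in>carrier (Sym E n). L (iota K \<Omega> E n t))"
  unfolding restriction_symbol_def
proof (rule the_equality)
  let ?\<Delta> = "\<lambda>e\<in>carrier E. L (Prol n e)"
  show "\<exists>\<Delta>\<in>symb K \<Omega> E n F ?\<Delta>. \<exists>L'\<in>mod_hom (alg \<Omega>) (Jet E n) F. (\<forall>e\<in>carrier E. L' (Prol n e) = \<Delta> e) \<and>
      (\<lambda>t\<in>carrier (Sym E n). L (iota K \<Omega> E n t)) = (\<lambda>t\<in>carrier (Sym E n). L' (iota K \<Omega> E n t))"
    using symb_self[OF lift_diff_op[OF L]] L by (intro bexI[of _ ?\<Delta>] bexI[of _ L]) auto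
  fix \<rho> assume "\<exists>\<Delta>\<in>symb K \<Omega> E n F ?\<Delta>. \<exists>L'\<in>mod_hom (alg \<Omega>) (Jet E n) F. (\<forall>e\<in>carrier E. L' (Prol n e) = \<Delta> e) \<and>
      \<rho> = (\<lambda>t\<in>carrier (Sym E n). L' (iota K \<Omega> E n t))"
  then obtain \<Delta> L' where \<Delta>: "\<Delta> \<in> symb K \<Omega> E n F ?\<Delta>" and L': "L' \<in> mod_hom (alg \<Omega>) (Jet E n) F"
    "\<And>e. e \<in> carrier E \<Longrightarrow> L' (Prol n e) = \<Delta> e" and \<rho>: "\<rho> = (\<lambda>t\<in>carrier (Sym E n). L' (iota K \<Omega> E n t))"
    by blast
  interpret F: left_module "alg \<Omega>" F by (rule F)
  obtain \<delta> where \<delta>: "\<delta> \<in> diff_ops_below K \<Omega> E F n" "\<Delta> = \<delta> \<oplus>\<^bsub>Diff_n K \<Omega> E n F\<^esub> ?\<Delta>"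
    using symb_memD[OF \<Delta>] by blast
  have ext: "\<delta> \<in> carrier E \<rightarrow>\<^sub>E carrier F"
    using \<delta>(1) diff_ops_below_subset diff_ops_extensional by blast
  have "L' (Prol n e) \<ominus>\<^bsub>F\<^esub> L (Prol n e) = \<delta> e" if e: "e \<in> carrier E" for e
  proof -
    have "L (Prol n e) \<in> carrier F" "\<delta> e \<in> carrier F"
      using mod_hom_closed[OF L prolong_closed[OF E e]] ext e by auto
    then show ?thesis
      using L'(2)[OF e] e by (simp add: \<delta>(2) add_Diff_n F.M.minus_eq F.M.a_assoc F.M.r_neg)
  qed
  then have "(\<lambda>e\<in>carrier E. L' (Prol n e) \<ominus>\<^bsub>F\<^esub> L (Prol n e)) = \<delta>"
    using ext by (auto simp: restrict_def PiE_def extensional_def)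
  then have zero: "L' (iota K \<Omega> E n t) \<ominus>\<^bsub>F\<^esub> L (iota K \<Omega> E n t) = \<zero>\<^bsub>F\<^esub>" if "t \<in> carrier (Sym E n)" for t
    using below_lift_iota[OF gen mod_hom_subtract[OF F L'(1) L] _ that] \<delta>(1) by simp
  show "\<rho> = (\<lambda>t\<in>carrier (Sym E n). L (iota K \<Omega> E n t))"
    unfolding \<rho>
  proof (rule restrict_ext)
    fix t assume t: "t \<in> carrier (Sym E n)"
    note i = mod_hom_closed[OF iota_linear[OF E] t]
    show "L' (iota K \<Omega> E n t) = L (iota K \<Omega> E n t)"
      by (rule F.M.eq_if_minus_eq_zero[OF zero[OF t] mod_hom_closed[OF L'(1) i] mod_hom_closed[OF L i]])
  qed
qed

end

section \<open>Functoriality of operators and symbols\<close>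

lemma Diff_map_add:
  assumes \<psi>: "\<psi> \<in> additive_maps F F'" and "\<Delta> \<in> carrier E \<rightarrow>\<^sub>E carrier F" and "\<Delta>' \<in> carrier E \<rightarrow>\<^sub>E carrier F"
  shows "Diff_map E F F' \<psi> (\<lambda>e\<in>carrier E. \<Delta> e \<oplus>\<^bsub>F\<^esub> \<Delta>' e)
    = (\<lambda>e\<in>carrier E. Diff_map E F F' \<psi> \<Delta> e \<oplus>\<^bsub>F'\<^esub> Diff_map E F F' \<psi> \<Delta>' e)"
  unfolding Diff_map_def compose_def
proof (rule restrict_ext)
  fix e assume e: "e \<in> carrier E"
  then show "\<psi> ((\<lambda>e\<in>carrier E. \<Delta> e \<oplus>\<^bsub>F\<^esub> \<Delta>' e) e)
      = (\<lambda>e\<in>carrier E. \<psi> (\<Delta> e)) e \<oplus>\<^bsub>F'\<^esub> (\<lambda>e\<in>carrier E. \<psi> (\<Delta>' e)) e"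
    using additive_maps_add[OF \<psi> assms(2,3)[THEN PiE_mem, OF e]] by simp
qed

lemma Diff_map_lift:
  "Diff_map E F F' \<psi> (\<lambda>e\<in>carrier E. L (Prol n e)) = (\<lambda>e\<in>carrier E. \<psi> (L (Prol n e)))"
  unfolding Diff_map_def compose_def by (intro restrict_ext) simp

lemma Diff_map_diff_op:
  assumes \<psi>: "\<psi> \<in> mod_hom (alg \<Omega>) F F'" and "\<Delta> \<in> diff_ops K \<Omega> E F n"
  shows "Diff_map E F F' \<psi> \<Delta> \<in> diff_ops K \<Omega> E F' n"
  using assms(2)
proof (rule diff_opE)
  fix L assume L: "L \<in> mod_hom (alg \<Omega>) (Jet E n) F" "\<Delta> = (\<lambda>e\<in>carrier E. L (Prol n e))"
  show ?thesis
    unfolding L(2) Diff_map_lift by (rule lift_diff_op[OF mod_hom_compose[OF L(1) \<psi>]])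
qed

lemma Diff_map_zero:
  assumes "left_module (alg \<Omega>) F" and "left_module (alg \<Omega>) F'" and "\<psi> \<in> mod_hom (alg \<Omega>) F F'"
  shows "Diff_map E F F' \<psi> (\<lambda>e\<in>carrier E. \<zero>\<^bsub>F\<^esub>) = (\<lambda>e\<in>carrier E. \<zero>\<^bsub>F'\<^esub>)"
  unfolding Diff_map_def compose_def
  using additive_maps_zero[OF assms(1,2)[THEN left_module_abelian_group] mod_hom_additive[OF assms(3)]]
  by (intro restrict_ext) simp

text \<open>\<open>Symb_n_map\<close> is a union over all representatives; postcomposition preserves
  lower order, so the union is over one and the same coset.\<close>

lemma Symb_n_map_symb:
  assumes F: "left_module (alg \<Omega>) F" and F': "left_module (alg \<Omega>) F'" and \<psi>: "\<psi> \<in> mod_hom (alg \<Omega>) F F'"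
    and \<Delta>: "\<Delta> \<in> diff_ops K \<Omega> E F n"
  shows "Symb_n_map K \<Omega> E n F F' \<psi> (symb K \<Omega> E n F \<Delta>) = symb K \<Omega> E n F' (Diff_map E F F' \<psi> \<Delta>)"
proof -
  have below: "Diff_map E F F' \<psi> \<delta> \<in> diff_ops_below K \<Omega> E F' n" if "\<delta> \<in> diff_ops_below K \<Omega> E F n" for \<delta>
    using that Diff_map_zero[OF F F' \<psi>] Diff_map_diff_op[OF \<psi>] by (cases n) (auto simp: diff_ops_below_def)
  have "symb K \<Omega> E n F' (Diff_map E F F' \<psi> \<Delta>') = symb K \<Omega> E n F' (Diff_map E F F' \<psi> \<Delta>)"
    if \<Delta>': "\<Delta>' \<in> symb K \<Omega> E n F \<Delta>" for \<Delta>'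
  proof -
    obtain \<delta> where \<delta>: "\<delta> \<in> diff_ops_below K \<Omega> E F n" "\<Delta>' = \<delta> \<oplus>\<^bsub>Diff_n K \<Omega> E n F\<^esub> \<Delta>"
      using symb_memD[OF F \<Delta>'] by blast
    have "\<delta> \<in> carrier E \<rightarrow>\<^sub>E carrier F" "\<Delta> \<in> carrier E \<rightarrow>\<^sub>E carrier F"
      using \<delta>(1) diff_ops_below_subset[OF F] diff_ops_extensional \<Delta> by blast+
    then have "Diff_map E F F' \<psi> \<Delta>' = Diff_map E F F' \<psi> \<delta> \<oplus>\<^bsub>Diff_n K \<Omega> E n F'\<^esub> Diff_map E F F' \<psi> \<Delta>"
      using Diff_map_add[OF mod_hom_additive[OF \<psi>]] by (simp add: \<delta>(2) add_Diff_n[OF F] add_Diff_n[OF F'])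
    then show ?thesis
      using symb_add_below[OF F' Diff_map_diff_op[OF \<psi> \<Delta>] below[OF \<delta>(1)]] by simp
  qed
  then have "Symb_n_map K \<Omega> E n F F' \<psi> (symb K \<Omega> E n F \<Delta>) = (\<Union>\<Delta>'\<in>symb K \<Omega> E n F \<Delta>. symb K \<Omega> E n F' (Diff_map E F F' \<psi> \<Delta>))"
    unfolding Symb_n_map_def by (rule SUP_cong[OF HOL.refl])
  also have "\<dots> = symb K \<Omega> E n F' (Diff_map E F F' \<psi> \<Delta>)"
    using symb_self[OF F \<Delta>] by auto
  finally show ?thesis .
qed

section \<open>Quantization\<close>

context
  fixes n s D
  assumes gen: "generated_by_prolongations K \<Omega> E n"
    and exact: "jet_sequence_right_exact K \<Omega> E n"
    and conn: "\<And>k. k < n \<Longrightarrow> left_connection K \<Omega> (Sym E k) (D k)"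
    and split: "\<And>k. k < n \<Longrightarrow> left_splitting \<Omega> E k (s k)"
begin

lemma iota_jet_lift_linear: "(\<lambda>x. iota K \<Omega> E n (jet_lift E s D n x)) \<in> mod_hom (alg \<Omega>) (Jet E n) (Jet E n)"
  by (rule mod_hom_compose[OF jet_lift_linear[OF E conn split] iota_linear[OF E]])

text \<open>The formula from which linearity, naturality and the order of the quantized operator are
  read off: on lifts, quantization is composition with \<open>iota \<circ> jet_lift\<close>,
  independent of \<open>L\<close> and \<open>F\<close>.\<close>

lemma induced_quantization_symb:
  assumes F: "left_module (alg \<Omega>) F" and L: "L \<in> mod_hom (alg \<Omega>) (Jet E n) F"
  shows "induced_quantization K \<Omega> E s D n F (symb K \<Omega> E n F (\<lambda>e\<in>carrier E. L (Prol n e)))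
    = (\<lambda>e\<in>carrier E. L (iota K \<Omega> E n (jet_lift E s D n (Prol n e))))"
  unfolding induced_quantization_def restriction_symbol_eq[OF F gen L]
proof (rule restrict_ext)
  fix e assume e: "e \<in> carrier E"
  have "jet_lift E s D n (Prol n e) \<in> carrier (Sym E n)"
    by (rule mod_hom_closed[OF jet_lift_linear[OF E conn split] prolong_closed[OF E e]])
  then show "(\<lambda>t\<in>carrier (Sym E n). L (iota K \<Omega> E n t)) (iterated s D n e)
      = L (iota K \<Omega> E n (jet_lift E s D n (Prol n e)))"
    by (simp add: jet_lift_prolong[OF E conn split e])
qed

lemma natural_quantization_induced: "natural_quantization K \<Omega> E n (induced_quantization K \<Omega> E s D n)"
  unfolding natural_quantization_def natural_transformation_def
proof (intro conjI allI impI ballI)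
  let ?q = "induced_quantization K \<Omega> E s D n"
  note lift = iota_jet_lift_linear
  fix F :: "('w, 'c) module" assume F: "left_module (alg \<Omega>) F"
  interpret F: left_module "alg \<Omega>" F by (rule F)
  note q = induced_quantization_symb[OF F]
  have symbE: thesis if "\<sigma> \<in> carrier (Symb_n K \<Omega> E n F)"
    and "\<And>L. \<lbrakk>L \<in> mod_hom (alg \<Omega>) (Jet E n) F; \<sigma> = symb K \<Omega> E n F (\<lambda>e\<in>carrier E. L (Prol n e))\<rbrakk> \<Longrightarrow> thesis" for \<sigma> thesis
    using that(1) unfolding carrier_Symb_n[OF F] by (auto elim!: diff_opE intro: that(2))
  show "?q F \<in> mod_hom K (Symb_n K \<Omega> E n F) (Diff_n K \<Omega> E n F)"
  proof (rule mod_homI)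
    fix \<sigma> assume "\<sigma> \<in> carrier (Symb_n K \<Omega> E n F)"
    then obtain L where L: "L \<in> mod_hom (alg \<Omega>) (Jet E n) F" "\<sigma> = symb K \<Omega> E n F (\<lambda>e\<in>carrier E. L (Prol n e))"
      by (rule symbE)
    note L_op = lift_diff_op[OF L(1)]
    show "?q F \<sigma> \<in> carrier (Diff_n K \<Omega> E n F)"
      unfolding L(2) q[OF L(1)] carrier_Diff_n[OF F] by (rule lift_diff_op[OF mod_hom_compose[OF lift L(1)]])
    { fix \<tau> assume "\<tau> \<in> carrier (Symb_n K \<Omega> E n F)"
      then obtain L' where L': "L' \<in> mod_hom (alg \<Omega>) (Jet E n) F" "\<tau> = symb K \<Omega> E n F (\<lambda>e\<in>carrier E. L' (Prol n e))"
        by (rule symbE)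
      have "\<sigma> \<oplus>\<^bsub>Symb_n K \<Omega> E n F\<^esub> \<tau> = symb K \<Omega> E n F (\<lambda>e\<in>carrier E. L (Prol n e) \<oplus>\<^bsub>F\<^esub> L' (Prol n e))"
        unfolding L(2) L'(2) symb_add[OF F L_op lift_diff_op[OF L'(1)]] add_Diff_n[OF F]
        by (rule arg_cong[where f = "symb K \<Omega> E n F"], rule restrict_ext) simp
      then show "?q F (\<sigma> \<oplus>\<^bsub>Symb_n K \<Omega> E n F\<^esub> \<tau>) = ?q F \<sigma> \<oplus>\<^bsub>Diff_n K \<Omega> E n F\<^esub> ?q F \<tau>"
        using q[OF mod_hom_plus[OF F L(1) L'(1)]]
        by (simp add: L(2) L'(2) q[OF L(1)] q[OF L'(1)] add_Diff_n[OF F] cong: restrict_cong) }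
    fix c assume c: "c \<in> carrier K"
    have "c \<odot>\<^bsub>Symb_n K \<Omega> E n F\<^esub> \<sigma> = symb K \<Omega> E n F (\<lambda>e\<in>carrier E. (c \<odot>\<^bsub>\<Omega>\<^esub> \<one>\<^bsub>\<Omega>\<^esub>) \<odot>\<^bsub>F\<^esub> L (Prol n e))"
      unfolding L(2) symb_smult[OF F c L_op] smult_Diff_n[OF F]
      by (rule arg_cong[where f = "symb K \<Omega> E n F"], rule restrict_ext) simp
    then show "?q F (c \<odot>\<^bsub>Symb_n K \<Omega> E n F\<^esub> \<sigma>) = c \<odot>\<^bsub>Diff_n K \<Omega> E n F\<^esub> ?q F \<sigma>"
      using q[OF mod_hom_ksmult[OF F L(1) c]]
      by (simp add: L(2) q[OF L(1)] smult_Diff_n[OF F] cong: restrict_cong)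
  qed
  { fix \<sigma> assume "\<sigma> \<in> carrier (Symb_n K \<Omega> E n F)"
    then obtain L where L: "L \<in> mod_hom (alg \<Omega>) (Jet E n) F" "\<sigma> = symb K \<Omega> E n F (\<lambda>e\<in>carrier E. L (Prol n e))"
      by (rule symbE)
    note L' = mod_hom_compose[OF lift L(1)]
    have "(\<lambda>e\<in>carrier E. L (iota K \<Omega> E n (jet_lift E s D n (Prol n e))) \<ominus>\<^bsub>F\<^esub> L (Prol n e)) \<in> diff_ops_below K \<Omega> E F n"
    proof (rule lift_vanishing_below[OF F exact mod_hom_subtract[OF F L' L(1)]])
      fix t assume t: "t \<in> carrier (Sym E n)"
      then show "L (iota K \<Omega> E n (jet_lift E s D n (iota K \<Omega> E n t))) \<ominus>\<^bsub>F\<^esub> L (iota K \<Omega> E n t) = \<zero>\<^bsub>F\<^esub>"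
        using mod_hom_closed[OF L(1) mod_hom_closed[OF iota_linear[OF E] t]]
        by (simp add: jet_lift_iota[OF E conn split] F.M.minus_eq F.M.r_neg)
    qed
    moreover have "(\<lambda>e\<in>carrier E. L (iota K \<Omega> E n (jet_lift E s D n (Prol n e))))
      = (\<lambda>e\<in>carrier E. L (iota K \<Omega> E n (jet_lift E s D n (Prol n e))) \<ominus>\<^bsub>F\<^esub> L (Prol n e))
        \<oplus>\<^bsub>Diff_n K \<Omega> E n F\<^esub> (\<lambda>e\<in>carrier E. L (Prol n e))"
      unfolding add_Diff_n[OF F]
      using mod_hom_closed[OF L' prolong_closed[OF E]] mod_hom_closed[OF L(1) prolong_closed[OF E]]
      by (intro restrict_ext) (simp add: F.M.minus_eq F.M.a_assoc F.M.l_neg)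
    ultimately show "symb K \<Omega> E n F (?q F \<sigma>) = \<sigma>"
      unfolding L(2) q[OF L(1)] using symb_add_below[OF F lift_diff_op[OF L(1)]] by simp }
  fix F' :: "('w, 'c) module" and \<psi> \<sigma>
  assume F': "left_module (alg \<Omega>) F'" and \<psi>: "\<psi> \<in> mod_hom (alg \<Omega>) F F'" and "\<sigma> \<in> carrier (Symb_n K \<Omega> E n F)"
  then obtain L where L: "L \<in> mod_hom (alg \<Omega>) (Jet E n) F" "\<sigma> = symb K \<Omega> E n F (\<lambda>e\<in>carrier E. L (Prol n e))"
    using symbE by blast
  \<comment> \<open>Postcomposition with \<psi> and precomposition with the fixed endomorphism act
    on opposite sides of \<open>L\<close>, hence commute.\<close>
  show "?q F' (Symb_n_map K \<Omega> E n F F' \<psi> \<sigma>) = Diff_map E F F' \<psi> (?q F \<sigma>)"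
    unfolding L(2) Symb_n_map_symb[OF F F' \<psi> lift_diff_op[OF L(1)]] Diff_map_lift
      induced_quantization_symb[OF F' mod_hom_compose[OF L(1) \<psi>]] q[OF L(1)]
    by (simp add: Diff_map_def compose_def cong: restrict_cong)
qed

end

text \<open>Valid for any family of natural quantizations: a symbol has finite support, and its
  quantized components can be added in \<open>Diff\<close> because all the \<open>Diff_n\<close>
  share its operations.\<close>

lemma natural_full_quantization_sum:
  assumes qs: "\<And>n. natural_quantization K \<Omega> E n (qs n)"
  shows "natural_full_quantization K \<Omega> E (sum_quantization K \<Omega> E qs)"
  unfolding natural_full_quantization_def
proof (intro conjI exI[of _ qs])
  have lin: "qs n F \<in> mod_hom K (Symb_n K \<Omega> E n F) (Diff_n K \<Omega> E n F)" if "left_module (alg \<Omega>) F" for n F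
    using qs[of n] that by (auto simp: natural_quantization_def natural_transformation_def)
  have nat: "qs n F' (Symb_n_map K \<Omega> E n F F' \<psi> \<sigma>) = Diff_map E F F' \<psi> (qs n F \<sigma>)"
    if "left_module (alg \<Omega>) F" "left_module (alg \<Omega>) F'" "\<psi> \<in> mod_hom (alg \<Omega>) F F'" "\<sigma> \<in> carrier (Symb_n K \<Omega> E n F)" for n F F' \<psi> \<sigma>
    using qs[of n] that by (auto simp: natural_quantization_def natural_transformation_def)
  have Diff_ops: "\<zero>\<^bsub>Diff_n K \<Omega> E n F\<^esub> = \<zero>\<^bsub>Diff K \<Omega> E F\<^esub>"
      "add (Diff_n K \<Omega> E n F) = add (Diff K \<Omega> E F)" "smult (Diff_n K \<Omega> E n F) = smult (Diff K \<Omega> E F)"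
      "carrier (Diff_n K \<Omega> E n F) \<subseteq> carrier (Diff K \<Omega> E F)" for n F
    by (auto simp: Diff_n_def Diff_def operator_module_def)
  \<comment> \<open>The supports of a sum, a multiple or an image of symbols may differ from the
    original ones. Allowing any finite set that contains the support makes the sums comparable; the
    additional terms are zero.\<close>
  have sum: "sum_quantization K \<Omega> E qs F \<sigma> = finsum (Diff K \<Omega> E F) (\<lambda>n. qs n F (\<sigma> n)) S"
    and closed: "(\<lambda>n. qs n F (\<sigma> n)) \<in> S \<rightarrow> carrier (Diff K \<Omega> E F)"
    if F: "left_module (alg \<Omega>) F" and \<sigma>: "\<And>n. \<sigma> n \<in> carrier (Symb_n K \<Omega> E n F)"
      and S: "finite S" "{n. \<sigma> n \<noteq> \<zero>\<^bsub>Symb_n K \<Omega> E n F\<^esub>} \<subseteq> S" for F \<sigma> S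
  proof -
    interpret D: left_module K "Diff K \<Omega> E F" by (rule left_module_Diff[OF F])
    show closed: "(\<lambda>n. qs n F (\<sigma> n)) \<in> S \<rightarrow> carrier (Diff K \<Omega> E F)" for S
      using mod_hom_closed[OF lin[OF F] \<sigma>] Diff_ops(4) by blast
    \<comment> \<open>By \<open>0 + 0 = 0\<close> and cancellation, with the addition of
      \<open>Diff_n\<close> read as that of \<open>Diff\<close>.\<close>
    have "qs n F \<zero>\<^bsub>Symb_n K \<Omega> E n F\<^esub> = \<zero>\<^bsub>Diff K \<Omega> E F\<^esub>" for n
    proof -
      let ?z = "\<zero>\<^bsub>Symb_n K \<Omega> E n F\<^esub>"
      note S = left_module_abelian_group[OF left_module_Symb_n[OF F]]
      have z: "?z \<in> carrier (Symb_n K \<Omega> E n F)"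
        by (rule abelian_groupE(2)[OF S])
      have "?z \<oplus>\<^bsub>Symb_n K \<Omega> E n F\<^esub> ?z = ?z"
        by (rule abelian_groupE(5)[OF S z])
      then have "qs n F ?z \<oplus>\<^bsub>Diff K \<Omega> E F\<^esub> qs n F ?z = qs n F ?z"
        using mod_hom_add[OF lin[OF F] z z] by (simp add: Diff_ops)
      moreover have "qs n F ?z \<in> carrier (Diff K \<Omega> E F)"
        using mod_hom_closed[OF lin[OF F] z] Diff_ops(4) by blast
      ultimately show ?thesis by simp
    qed
    then show "sum_quantization K \<Omega> E qs F \<sigma> = finsum (Diff K \<Omega> E F) (\<lambda>n. qs n F (\<sigma> n)) S"
      unfolding sum_quantization_def using S closed[of S]
      by (intro D.M.add.finprod_mono_neutral_cong_left) auto
  qed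
  show "natural_transformation K \<Omega> (Symb K \<Omega> E) (Symb_map K \<Omega> E) (Diff K \<Omega> E) (Diff_map E) (sum_quantization K \<Omega> E qs)"
    unfolding natural_transformation_def
  proof (intro conjI allI impI ballI)
    let ?q = "sum_quantization K \<Omega> E qs" and ?supp = "\<lambda>F \<sigma>. {n. \<sigma> n \<noteq> \<zero>\<^bsub>Symb_n K \<Omega> E n F\<^esub>}"
    fix F :: "('w, 'a) module" assume F: "left_module (alg \<Omega>) F"
    interpret D: left_module K "Diff K \<Omega> E F" by (rule left_module_Diff[OF F])
    have Symb: "\<sigma> n \<in> carrier (Symb_n K \<Omega> E n F)" "finite (?supp F \<sigma>)" if "\<sigma> \<in> carrier (Symb K \<Omega> E F)" for \<sigma> n
      using that by (simp_all add: Symb_def)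
    show "?q F \<in> mod_hom K (Symb K \<Omega> E F) (Diff K \<Omega> E F)"
    proof (rule mod_homI)
      fix \<sigma> assume \<sigma>: "\<sigma> \<in> carrier (Symb K \<Omega> E F)"
      note \<sigma>' = Symb[OF \<sigma>]
      show "?q F \<sigma> \<in> carrier (Diff K \<Omega> E F)"
        unfolding sum[OF F \<sigma>' subset_refl] by (rule D.M.finsum_closed[OF closed[OF F \<sigma>' subset_refl]])
      { fix \<tau> assume "\<tau> \<in> carrier (Symb K \<Omega> E F)"
        note \<tau>' = Symb[OF this]
        \<comment> \<open>A common index set for both symbols; cancellation may make the support of
          their sum smaller.\<close>
        let ?S = "?supp F \<sigma> \<union> ?supp F \<tau>"
        have S: "finite ?S" "?supp F \<sigma> \<subseteq> ?S" "?supp F \<tau> \<subseteq> ?S"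
          "?supp F (\<lambda>n. \<sigma> n \<oplus>\<^bsub>Symb_n K \<Omega> E n F\<^esub> \<tau> n) \<subseteq> ?S"
          using \<sigma>'(2) \<tau>'(2) abelian_groupE(2,5)[OF left_module_abelian_group[OF left_module_Symb_n[OF F]]] by auto
        have cl: "\<sigma> n \<oplus>\<^bsub>Symb_n K \<Omega> E n F\<^esub> \<tau> n \<in> carrier (Symb_n K \<Omega> E n F)" for n
          by (rule abelian_groupE(1)[OF left_module_abelian_group[OF left_module_Symb_n[OF F]] \<sigma>'(1) \<tau>'(1)])
        have "?q F (\<sigma> \<oplus>\<^bsub>Symb K \<Omega> E F\<^esub> \<tau>)
            = finsum (Diff K \<Omega> E F) (\<lambda>n. qs n F (\<sigma> n) \<oplus>\<^bsub>Diff K \<Omega> E F\<^esub> qs n F (\<tau> n)) ?S"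
          using sum[OF F cl S(1,4)] mod_hom_add[OF lin[OF F] \<sigma>'(1) \<tau>'(1)] by (simp add: Symb_def Diff_ops)
        also have "\<dots> = ?q F \<sigma> \<oplus>\<^bsub>Diff K \<Omega> E F\<^esub> ?q F \<tau>"
          unfolding sum[OF F \<sigma>'(1) S(1,2)] sum[OF F \<tau>'(1) S(1,3)]
          by (rule D.M.finsum_addf[OF closed[OF F \<sigma>'(1) S(1,2)] closed[OF F \<tau>'(1) S(1,3)]])
        finally show "?q F (\<sigma> \<oplus>\<^bsub>Symb K \<Omega> E F\<^esub> \<tau>) = ?q F \<sigma> \<oplus>\<^bsub>Diff K \<Omega> E F\<^esub> ?q F \<tau>" . }
      fix c assume c: "c \<in> carrier K"
      have S: "?supp F (\<lambda>n. c \<odot>\<^bsub>Symb_n K \<Omega> E n F\<^esub> \<sigma> n) \<subseteq> ?supp F \<sigma>"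
        using left_module_smult_zero[OF left_module_Symb_n[OF F] c] by auto
      have cl: "c \<odot>\<^bsub>Symb_n K \<Omega> E n F\<^esub> \<sigma> n \<in> carrier (Symb_n K \<Omega> E n F)" for n
        by (rule left_module.lsmult_closed[OF left_module_Symb_n[OF F] c \<sigma>'(1)])
      have "?q F (c \<odot>\<^bsub>Symb K \<Omega> E F\<^esub> \<sigma>) = finsum (Diff K \<Omega> E F) (\<lambda>n. c \<odot>\<^bsub>Diff K \<Omega> E F\<^esub> qs n F (\<sigma> n)) (?supp F \<sigma>)"
        using sum[OF F cl \<sigma>'(2) S] mod_hom_smult[OF lin[OF F] c \<sigma>'(1)] by (simp add: Symb_def Diff_ops)
      also have "\<dots> = c \<odot>\<^bsub>Diff K \<Omega> E F\<^esub> ?q F \<sigma>"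
        unfolding sum[OF F \<sigma>' subset_refl]
        by (rule additive_maps_finsum[OF D.M.abelian_group_axioms D.M.abelian_group_axioms
              left_module_smult_additive[OF left_module_Diff[OF F] c] \<sigma>'(2) closed[OF F \<sigma>' subset_refl], symmetric])
      finally show "?q F (c \<odot>\<^bsub>Symb K \<Omega> E F\<^esub> \<sigma>) = c \<odot>\<^bsub>Diff K \<Omega> E F\<^esub> ?q F \<sigma>" .
    qed
    fix F' :: "('w, 'a) module" and \<psi> \<sigma>
    assume F': "left_module (alg \<Omega>) F'" and \<psi>: "\<psi> \<in> mod_hom (alg \<Omega>) F F'" and \<sigma>: "\<sigma> \<in> carrier (Symb K \<Omega> E F)"
    note \<sigma>' = Symb[OF \<sigma>]
    have Symb': "Symb_n_map K \<Omega> E n F F' \<psi> \<tau> \<in> carrier (Symb_n K \<Omega> E n F')" if "\<tau> \<in> carrier (Symb_n K \<Omega> E n F)" for n \<tau>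
      using that Diff_map_diff_op[OF \<psi>] Symb_n_map_symb[OF F F' \<psi>]
      unfolding carrier_Symb_n[OF F] carrier_Symb_n[OF F'] by auto
    have "Symb_n_map K \<Omega> E n F F' \<psi> \<zero>\<^bsub>Symb_n K \<Omega> E n F\<^esub> = \<zero>\<^bsub>Symb_n K \<Omega> E n F'\<^esub>" for n
      using Symb_n_map_symb[OF F F' \<psi> diff_ops_zero[OF F]] Diff_map_zero[OF F F' \<psi>]
      by (simp add: symb_zero[OF F] symb_zero[OF F'] zero_Diff_n[OF F] zero_Diff_n[OF F'])
    then have S: "?supp F' (\<lambda>n. Symb_n_map K \<Omega> E n F F' \<psi> (\<sigma> n)) \<subseteq> ?supp F \<sigma>"
      by auto
    have \<psi>_add: "Diff_map E F F' \<psi> \<in> additive_maps (Diff K \<Omega> E F) (Diff K \<Omega> E F')"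
    proof (rule additive_mapsI)
      fix \<Delta> assume "\<Delta> \<in> carrier (Diff K \<Omega> E F)"
      then obtain m where m: "\<Delta> \<in> diff_ops K \<Omega> E F m" by (auto simp: Diff_def)
      then show "Diff_map E F F' \<psi> \<Delta> \<in> carrier (Diff K \<Omega> E F')"
        using Diff_map_diff_op[OF \<psi>] by (auto simp: Diff_def)
      fix \<Delta>' assume "\<Delta>' \<in> carrier (Diff K \<Omega> E F)"
      then obtain m' where "\<Delta>' \<in> diff_ops K \<Omega> E F m'" by (auto simp: Diff_def)
      then show "Diff_map E F F' \<psi> (\<Delta> \<oplus>\<^bsub>Diff K \<Omega> E F\<^esub> \<Delta>') = Diff_map E F F' \<psi> \<Delta> \<oplus>\<^bsub>Diff K \<Omega> E F'\<^esub> Diff_map E F F' \<psi> \<Delta>'"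
        using Diff_map_add[OF mod_hom_additive[OF \<psi>] subsetD[OF diff_ops_extensional m] subsetD[OF diff_ops_extensional]]
        by (simp add: Diff_def)
    qed
    have "?q F' (Symb_map K \<Omega> E F F' \<psi> \<sigma>) = finsum (Diff K \<Omega> E F') (\<lambda>n. Diff_map E F F' \<psi> (qs n F (\<sigma> n))) (?supp F \<sigma>)"
      using sum[OF F' Symb'[OF \<sigma>'(1)] \<sigma>'(2) S] nat[OF F F' \<psi> \<sigma>'(1)] by (simp add: Symb_map_def)
    also have "\<dots> = Diff_map E F F' \<psi> (?q F \<sigma>)"
      unfolding sum[OF F \<sigma>' subset_refl]
      by (rule additive_maps_finsum[OF D.M.abelian_group_axioms left_module_abelian_group[OF left_module_Diff[OF F']]
            \<psi>_add \<sigma>'(2) closed[OF F \<sigma>' subset_refl], symmetric])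
    finally show "?q F' (Symb_map K \<Omega> E F F' \<psi> \<sigma>) = Diff_map E F F' \<psi> (?q F \<sigma>)" .
  qed
qed (use qs in auto)

end

end

theorem corollary5p11:
  fixes K :: "'k ring" and \<Omega> :: "('k, 'w) dga" and E :: "('w, 'e) module"
  assumes "exterior_algebra K \<Omega>" and "left_module (alg \<Omega>) E"
  shows
    "(\<forall>(n::nat) D s.
        1 \<le> n \<and>
        generated_by_prolongations K \<Omega> E n \<and>
        jet_sequence_right_exact K \<Omega> E n \<and>
        (\<forall>k<n. left_connection K \<Omega> (sym_form \<Omega> E k) (D k) \<and> left_splitting \<Omega> E k (s k))
        \<longrightarrow>
        natural_quantization K \<Omega> E n
          (induced_quantization K \<Omega> E s D n :: ('w, 'f) module \<Rightarrow> ('e \<Rightarrow> 'f) set \<Rightarrow> ('e \<Rightarrow> 'f))) \<and>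
     (\<forall>D s.
        (\<forall>n. generated_by_prolongations K \<Omega> E n \<and>
             jet_sequence_right_exact K \<Omega> E n \<and>
             left_connection K \<Omega> (sym_form \<Omega> E n) (D n) \<and>
             left_splitting \<Omega> E n (s n))
        \<longrightarrow>
        (\<forall>n. natural_quantization K \<Omega> E n
          (induced_quantization K \<Omega> E s D n :: ('w, 'f) module \<Rightarrow> ('e \<Rightarrow> 'f) set \<Rightarrow> ('e \<Rightarrow> 'f))) \<and>
        natural_full_quantization K \<Omega> E
          (sum_quantization K \<Omega> E (induced_quantization K \<Omega> E s D)
             :: ('w, 'f) module \<Rightarrow> (nat \<Rightarrow> ('e \<Rightarrow> 'f) set) \<Rightarrow> ('e \<Rightarrow> 'f)))"
proof -
  interpret exterior_algebra K \<Omega> by (rule assms(1))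
  note E = assms(2)
  \<comment> \<open>Claimed for every \<open>n\<close>, since the full quantization also has a
    component of order \<open>0\<close>.\<close>
  have a: "natural_quantization K \<Omega> E n
      (induced_quantization K \<Omega> E s D n :: ('w, 'f) module \<Rightarrow> ('e \<Rightarrow> 'f) set \<Rightarrow> ('e \<Rightarrow> 'f))"
    if "generated_by_prolongations K \<Omega> E n" and "jet_sequence_right_exact K \<Omega> E n"
      and "\<forall>k<n. left_connection K \<Omega> (sym_form \<Omega> E k) (D k) \<and> left_splitting \<Omega> E k (s k)" for n D s
    using that by (intro natural_quantization_induced[OF E]) auto
  have b: "natural_full_quantization K \<Omega> E
      (sum_quantization K \<Omega> E (induced_quantization K \<Omega> E s D)
        :: ('w, 'f) module \<Rightarrow> (nat \<Rightarrow> ('e \<Rightarrow> 'f) set) \<Rightarrow> ('e \<Rightarrow> 'f))"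
    if "\<forall>n. generated_by_prolongations K \<Omega> E n \<and> jet_sequence_right_exact K \<Omega> E n \<and>
      left_connection K \<Omega> (sym_form \<Omega> E n) (D n) \<and> left_splitting \<Omega> E n (s n)" for D s
    using that by (intro natural_full_quantization_sum[OF E] a) auto
  show ?thesis
    using a b by blast
qed

end
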